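(* Let $c\in(0,1)$ be a constant and let $w(n)$ satisfy $n^{2/3}\ll w(n)\le cn$. Let $p=w(n)/n$ and $k\ge\frac{5}{1-p}w(n)^{1/2}$. There is an explicitly described algorithm running in time $n^{O(1)}$ such that for every adversarial planting strategy, when $G\sim AG(n,p,k)$ is generated with that strategy, the algorithm outputs a maximum clique of $G$ with probability tending to $1$ as $n\to\infty$.
   Context: $AG(n,p,k)$: sample $G'\sim G(n,p)$ (Erdős–Rényi random graph with edge probability $p$); a computationally unbounded adversary, as an arbitrary function of $G'$ (its strategy), selects a set $K$ of $k$ vertices; all missing edges inside $K$ are added, giving $G$. $f\ll g$ means $f/g\to0$. *)

theory Defs
  imports "HOL-Probability.Probability"
begin

text \<open>A graph on {0..<n} is its edge set; edges are two-element sets.\<close>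

definition all_pairs :: "nat \<Rightarrow> nat set set" where
  "all_pairs n = {e. \<exists>i j. i < n \<and> j < n \<and> i \<noteq> j \<and> e = {i, j}}"

definition is_clique :: "nat \<Rightarrow> nat set set \<Rightarrow> nat set \<Rightarrow> bool" where
  "is_clique n E C \<longleftrightarrow> C \<subseteq> {..<n} \<and> (\<forall>i\<in>C. \<forall>j\<in>C. i \<noteq> j \<longrightarrow> {i, j} \<in> E)"

definition is_max_clique :: "nat \<Rightarrow> nat set set \<Rightarrow> nat set \<Rightarrow> bool" where
  "is_max_clique n E C \<longleftrightarrow> is_clique n E C \<and> (\<forall>D. is_clique n E D \<longrightarrow> card D \<le> card C)"

definition gnp :: "nat \<Rightarrow> real \<Rightarrow> nat set set pmf" where
  "gnp n p = map_pmf (\<lambda>b. {e \<in> all_pairs n. b e})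
                     (Pi_pmf (all_pairs n) False (\<lambda>_. bernoulli_pmf p))"

text \<open>AG(n,p,k) for a given adversary strategy S (a function of G' returning the
  k-set K; validity |K| = k is imposed in the theorem): all missing edges inside K are added.\<close>
definition AG :: "nat \<Rightarrow> real \<Rightarrow> (nat set set \<Rightarrow> nat set) \<Rightarrow> nat set set pmf" where
  "AG n p S = map_pmf (\<lambda>G'. G' \<union> {e \<in> all_pairs n. e \<subseteq> S G'}) (gnp n p)"

definition valid_strategy :: "nat \<Rightarrow> nat \<Rightarrow> (nat set set \<Rightarrow> nat set) \<Rightarrow> bool" where
  "valid_strategy n k S \<longleftrightarrow> (\<forall>G'. S G' \<subseteq> {..<n} \<and> card (S G') = k)"

text \<open>Memory is a function nat => nat; all operands are memory addresses.
  This model is polynomially equivalent to Turing machines.\<close>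
datatype instr =
    LoadC nat nat
  | Add nat nat nat
  | Sub nat nat nat
  | LoadI nat nat
  | StoreI nat nat
  | Jz nat nat
  | Jmp nat
  | Halt

type_synonym config = "nat \<times> (nat \<Rightarrow> nat)"

definition halted :: "instr list \<Rightarrow> config \<Rightarrow> bool" where
  "halted P c \<longleftrightarrow> fst c \<ge> length P \<or> P ! fst c = Halt"

fun exec :: "instr \<Rightarrow> config \<Rightarrow> config" where
  "exec (LoadC a v) (pc, m) = (Suc pc, m(a := v))"
| "exec (Add a b c) (pc, m) = (Suc pc, m(a := m b + m c))"
| "exec (Sub a b c) (pc, m) = (Suc pc, m(a := m b - m c))"
| "exec (LoadI a b) (pc, m) = (Suc pc, m(a := m (m b)))"
| "exec (StoreI a b) (pc, m) = (Suc pc, m(m a := m b))"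
| "exec (Jz a t) (pc, m) = ((if m a = 0 then t else Suc pc), m)"
| "exec (Jmp t) (pc, m) = (t, m)"
| "exec Halt (pc, m) = (pc, m)"

definition step :: "instr list \<Rightarrow> config \<Rightarrow> config" where
  "step P c = (if halted P c then c else exec (P ! fst c) c)"

definition run :: "instr list \<Rightarrow> nat \<Rightarrow> config \<Rightarrow> config" where
  "run P t c = (step P ^^ t) c"

text \<open>Input encoding: M[0] = n, M[1 + i*n + j] = [{i,j} is an edge] for i,j < n,
  all other cells 0.  Output: vertex i < n is output iff M[1 + n*n + i] \<noteq> 0 at halting.\<close>
definition input_mem :: "nat \<Rightarrow> nat set set \<Rightarrow> nat \<Rightarrow> nat" where
  "input_mem n E a =
     (if a = 0 then n
      else if a - 1 < n * n \<and> {(a - 1) div n, (a - 1) mod n} \<in> E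
              \<and> (a - 1) div n \<noteq> (a - 1) mod n then 1
      else 0)"

definition ram_halts_within :: "instr list \<Rightarrow> nat \<Rightarrow> nat \<Rightarrow> nat set set \<Rightarrow> bool" where
  "ram_halts_within P T n E \<longleftrightarrow> halted P (run P T (0, input_mem n E))"

definition ram_output :: "instr list \<Rightarrow> nat \<Rightarrow> nat \<Rightarrow> nat set set \<Rightarrow> nat set" where
  "ram_output P T n E = {i. i < n \<and> snd (run P T (0, input_mem n E)) (1 + n * n + i) \<noteq> 0}"

end

theory Submission
  imports Defs "HOL-Library.Ramsey" "HOL-Real_Asymp.Real_Asymp"
begin

text \<open>
  Guess t vertices Q of the planted clique K, for a constant t depending on c only. In the planted
  graph the common neighbourhood V of Q contains K - Q, and its other vertices are common neighbours
  of Q in G(n,p), hence there are only about n p^t of them; so k exceeds the square root of |V| by as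
  large a constant factor as desired. Centre the adjacency matrix on V at p (guessed up to 1/n). It is
  then a rank-one matrix supported on K - Q plus noise, and the noise has small norm uniformly in K:
  a union bound over the integer lattice works, because sets K cost n^k only and the edges inside V
  are independent of the edges to Q. Some column of the n-th power of the matrix is therefore almost
  proportional to the indicator of K - Q, and cutting it at one of its own entries yields a set T close
  to K - Q. The vertices adjacent to almost all of T include K and every maximum clique, and at most
  O(log n) vertices outside K, since no O(log n) vertices have high density to a k-set in G(n,p).
  Deleting one endpoint of each remaining non-edge in all n^O(1) possible ways finds a maximum clique.
  All guesses are enumerated and the largest clique found is kept; neither p nor k has to be known.
\<close>

section \<open>A loop language and its compilation to the RAM\<close>

datatype state = State
  (vars: "nat \<Rightarrow> nat") (arrays: "nat \<Rightarrow> nat \<Rightarrow> nat") (input_cells: "nat \<Rightarrow> nat") (output_cells: "nat \<Rightarrow> nat")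

definition set_var :: "nat \<Rightarrow> nat \<Rightarrow> state \<Rightarrow> state" where
  "set_var v x s = State ((vars s)(v := x)) (arrays s) (input_cells s) (output_cells s)"

definition set_array :: "nat \<Rightarrow> (nat \<Rightarrow> nat) \<Rightarrow> state \<Rightarrow> state" where
  "set_array a f s = State (vars s) ((arrays s)(a := f)) (input_cells s) (output_cells s)"

definition set_output :: "(nat \<Rightarrow> nat) \<Rightarrow> state \<Rightarrow> state" where
  "set_output f s = State (vars s) (arrays s) (input_cells s) f"

lemma state_select [simp]:
  "vars (set_var v x s) = (vars s)(v := x)" "arrays (set_var v x s) = arrays s"
  "input_cells (set_var v x s) = input_cells s" "output_cells (set_var v x s) = output_cells s"
  "vars (set_array a f s) = vars s" "arrays (set_array a f s) = (arrays s)(a := f)"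
  "input_cells (set_array a f s) = input_cells s" "output_cells (set_array a f s) = output_cells s"
  "vars (set_output f s) = vars s" "arrays (set_output f s) = arrays s"
  "input_cells (set_output f s) = input_cells s" "output_cells (set_output f s) = f"
  by (simp_all add: set_var_def set_array_def set_output_def)

datatype expr =
    Num nat
  | Var nat
  | Plus expr expr
  | Minus expr expr
  | Elem nat expr
  | Input expr

datatype com =
    Skip
  | Assign nat expr
  | Store nat expr expr
  | Output expr expr
  | Seq com com (infixr \<open>;;\<close> 60)
  | If expr com com
  | For nat nat com

text \<open>Variable 0 holds the number n of vertices. Only the rows of the input with nonzero index can be
  read, because the compiled program keeps its registers in row 0. Indices that are too large are
  replaced by the last one, so that every access of the compiled program is to the intended zone.\<close>

definition readable :: "nat \<Rightarrow> nat \<Rightarrow> nat" where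
  "readable n i = min (n * n) (n + 1 + i)"

definition writable :: "nat \<Rightarrow> nat \<Rightarrow> nat" where
  "writable n i = min (n - 1) i"

primrec eval :: "expr \<Rightarrow> state \<Rightarrow> nat" where
  "eval (Num k) s = k"
| "eval (Var x) s = vars s x"
| "eval (Plus e e') s = eval e s + eval e' s"
| "eval (Minus e e') s = eval e s - eval e' s"
| "eval (Elem a e) s = arrays s a (eval e s)"
| "eval (Input e) s = input_cells s (readable (vars s 0) (eval e s))"

primrec execute :: "com \<Rightarrow> state \<Rightarrow> state" where
  "execute Skip = (\<lambda>s. s)"
| "execute (Assign v e) = (\<lambda>s. set_var v (eval e s) s)"
| "execute (Store a e e') = (\<lambda>s. set_array a ((arrays s a)(eval e s := eval e' s)) s)"
| "execute (Output e e') =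
     (\<lambda>s. set_output ((output_cells s)(writable (vars s 0) (eval e s) := eval e' s)) s)"
| "execute (c ;; c') = (\<lambda>s. execute c' (execute c s))"
| "execute (If e c c') = (\<lambda>s. if eval e s \<noteq> 0 then execute c s else execute c' s)"
| "execute (For v x c) =
     (\<lambda>s. set_var v (vars s x) (fold (\<lambda>i s. execute c (set_var v i s)) [0..<vars s x] s))"

definition iterate_body :: "nat \<Rightarrow> com \<Rightarrow> nat \<Rightarrow> state \<Rightarrow> state" where
  "iterate_body v c i s = fold (\<lambda>i s. execute c (set_var v i s)) [0..<i] s"

lemma iterate_body_simps [simp]:
  "iterate_body v c 0 s = s"
  "iterate_body v c (Suc i) s = execute c (set_var v i (iterate_body v c i s))"
  by (simp_all add: iterate_body_def)

lemma execute_For: "execute (For v x c) s = set_var v (vars s x) (iterate_body v c (vars s x) s)"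
  by (simp add: iterate_body_def)

declare execute.simps(7) [simp del]

datatype location = VarLoc nat | ArrayLoc nat | OutputLoc

primrec written :: "com \<Rightarrow> location set" where
  "written Skip = {}"
| "written (Assign v e) = {VarLoc v}"
| "written (Store a e e') = {ArrayLoc a}"
| "written (Output e e') = {OutputLoc}"
| "written (c ;; c') = written c \<union> written c'"
| "written (If e c c') = written c \<union> written c'"
| "written (For v x c) = insert (VarLoc v) (written c)"

definition agree_off :: "location set \<Rightarrow> state \<Rightarrow> state \<Rightarrow> bool" where
  "agree_off L s s' \<longleftrightarrow> (\<forall>v. VarLoc v \<notin> L \<longrightarrow> vars s' v = vars s v) \<and>
     (\<forall>a. ArrayLoc a \<notin> L \<longrightarrow> arrays s' a = arrays s a) \<and>
       (OutputLoc \<notin> L \<longrightarrow> output_cells s' = output_cells s) \<and>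
     input_cells s' = input_cells s"

lemma agree_off_refl [simp]: "agree_off L s s"
  by (simp add: agree_off_def)

lemma agree_off_trans: "agree_off L s s' \<Longrightarrow> agree_off L s' s'' \<Longrightarrow> agree_off L s s''"
  by (simp add: agree_off_def)

lemma agree_off_mono: "agree_off L s s' \<Longrightarrow> L \<subseteq> L' \<Longrightarrow> agree_off L' s s'"
  unfolding agree_off_def by blast

lemma agree_off_set_var [simp]: "VarLoc v \<in> L \<Longrightarrow> agree_off L s (set_var v x s)"
  by (auto simp: agree_off_def)

lemma agree_off_iterate_body:
  assumes "\<And>s. agree_off (written c) s (execute c s)"
  shows "agree_off (written (For v x c)) s (iterate_body v c i s)"
proof (induction i)
  case (Suc i)
  let ?L = "written (For v x c)" and ?t = "iterate_body v c i s"
  have "agree_off ?L ?t (set_var v i ?t)" by simp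
  moreover have "agree_off ?L (set_var v i ?t) (execute c (set_var v i ?t))"
    using assms by (rule agree_off_mono) auto
  ultimately show ?case using Suc by (simp add: agree_off_def)
qed simp

theorem agree_off_execute: "agree_off (written c) s (execute c s)"
proof (induction c arbitrary: s)
  case (Seq c c')
  let ?L = "written (c ;; c')"
  have "agree_off ?L s (execute c s)" "agree_off ?L (execute c s) (execute c' (execute c s))"
    using Seq by (auto intro: agree_off_mono)
  then show ?case using agree_off_trans by auto
next
  case (If e c c')
  then show ?case by (auto intro: agree_off_mono)
next
  case (For v x c)
  then show ?case
    using agree_off_trans[OF agree_off_iterate_body agree_off_set_var] by (simp add: execute_For)
qed (auto simp: agree_off_def)

lemma agree_off_iterate: "agree_off (written (For v x c)) s (iterate_body v c i s)"
  using agree_off_execute by (rule agree_off_iterate_body)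

lemma execute_unchanged:
  "VarLoc v \<notin> written c \<Longrightarrow> vars (execute c s) v = vars s v"
  "ArrayLoc a \<notin> written c \<Longrightarrow> arrays (execute c s) a = arrays s a"
  "OutputLoc \<notin> written c \<Longrightarrow> output_cells (execute c s) = output_cells s"
  "input_cells (execute c s) = input_cells s"
  using agree_off_execute[of c s] by (simp_all add: agree_off_def)

subsection \<open>Running time\<close>

primrec expr_length :: "expr \<Rightarrow> nat" where
  "expr_length (Num k) = 1"
| "expr_length (Var x) = 1"
| "expr_length (Plus e e') = expr_length e + expr_length e' + 1"
| "expr_length (Minus e e') = expr_length e + expr_length e' + 1"
| "expr_length (Elem a e) = expr_length e + 8"
| "expr_length (Input e) = expr_length e + 5"

primrec com_length :: "com \<Rightarrow> nat" where
  "com_length Skip = 0"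
| "com_length (Assign v e) = expr_length e + 1"
| "com_length (Store a e e') = expr_length e + 7 + expr_length e' + 1"
| "com_length (Output e e') = expr_length e + 4 + expr_length e' + 1"
| "com_length (c ;; c') = com_length c + com_length c'"
| "com_length (If e c c') = expr_length e + com_length c + com_length c' + 2"
| "com_length (For v x c) = com_length c + 7"

primrec steps :: "com \<Rightarrow> state \<Rightarrow> nat" where
  "steps Skip = (\<lambda>s. 0)"
| "steps (Assign v e) = (\<lambda>s. com_length (Assign v e))"
| "steps (Store a e e') = (\<lambda>s. com_length (Store a e e'))"
| "steps (Output e e') = (\<lambda>s. com_length (Output e e'))"
| "steps (c ;; c') = (\<lambda>s. steps c s + steps c' (execute c s))"
| "steps (If e c c') =
     (\<lambda>s. expr_length e + (if eval e s \<noteq> 0 then steps c s + 2 else steps c' s + 1))"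
| "steps (For v x c) = (\<lambda>s. (\<Sum>i<vars s x. steps c (set_var v i (iterate_body v c i s)) + 5) + 5)"

primrec loop_bounds :: "com \<Rightarrow> nat set" where
  "loop_bounds Skip = {}"
| "loop_bounds (Assign v e) = {}"
| "loop_bounds (Store a e e') = {}"
| "loop_bounds (Output e e') = {}"
| "loop_bounds (c ;; c') = loop_bounds c \<union> loop_bounds c'"
| "loop_bounds (If e c c') = loop_bounds c \<union> loop_bounds c'"
| "loop_bounds (For v x c) = insert x (loop_bounds c)"

primrec max_steps :: "com \<Rightarrow> nat \<Rightarrow> nat" where
  "max_steps Skip = (\<lambda>X. 0)"
| "max_steps (Assign v e) = (\<lambda>X. com_length (Assign v e))"
| "max_steps (Store a e e') = (\<lambda>X. com_length (Store a e e'))"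
| "max_steps (Output e e') = (\<lambda>X. com_length (Output e e'))"
| "max_steps (c ;; c') = (\<lambda>X. max_steps c X + max_steps c' X)"
| "max_steps (If e c c') = (\<lambda>X. expr_length e + (max_steps c X + max_steps c' X + 2))"
| "max_steps (For v x c) = (\<lambda>X. X * (max_steps c X + 5) + 5)"

lemma steps_le_max_steps:
  assumes "VarLoc ` loop_bounds c \<inter> written c = {}" "\<And>x. x \<in> loop_bounds c \<Longrightarrow> vars s x \<le> X"
  shows "steps c s \<le> max_steps c X"
  using assms
proof (induction c arbitrary: s)
  case (Seq c c')
  have "vars (execute c s) x \<le> X" if "x \<in> loop_bounds c'" for x
    using that Seq.prems by (subst execute_unchanged) auto
  with Seq.IH[of s] Seq.IH(2)[of "execute c s"] Seq.prems show ?case by (auto intro!: add_mono)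
next
  case (If e c c')
  have "steps c s \<le> max_steps c X" "steps c' s \<le> max_steps c' X"
    using If.prems by (intro If.IH; auto)+
  then show ?case by auto
next
  case (For v x c)
  have "steps c (set_var v i (iterate_body v c i s)) \<le> max_steps c X" for i
  proof (rule For.IH)
    show "VarLoc ` loop_bounds c \<inter> written c = {}" using For.prems(1) by auto
    show "vars (set_var v i (iterate_body v c i s)) y \<le> X" if "y \<in> loop_bounds c" for y
    proof -
      have "VarLoc y \<notin> written (For v x c)" using For.prems(1) that by auto
      then show ?thesis
        using agree_off_iterate[of v x c s i] For.prems(2)[of y] that by (simp add: agree_off_def)
    qed
  qed
  then have "(\<Sum>i<vars s x. steps c (set_var v i (iterate_body v c i s)) + 5)
      \<le> (\<Sum>i<vars s x. max_steps c X + 5)"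
    by (intro sum_mono) simp
  also have "\<dots> \<le> X * (max_steps c X + 5)" using For.prems(2) by simp
  finally show ?case by simp
qed simp_all

definition poly_bounded :: "(nat \<Rightarrow> nat) \<Rightarrow> bool" where
  "poly_bounded f \<longleftrightarrow> (\<exists>C d. \<forall>x. f x \<le> C * (x + 1) ^ d)"

lemma poly_boundedI: "(\<And>x. f x \<le> C * (x + 1) ^ d) \<Longrightarrow> poly_bounded f"
  unfolding poly_bounded_def by blast

lemma poly_bounded_const: "poly_bounded (\<lambda>x. k)"
  by (rule poly_boundedI[of _ k 0]) simp

lemma poly_bounded_ident: "poly_bounded (\<lambda>x. x)"
  by (rule poly_boundedI[of _ 1 1]) simp

lemma poly_bounded_add:
  assumes "poly_bounded f" "poly_bounded g"
  shows "poly_bounded (\<lambda>x. f x + g x)"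
proof -
  obtain C d C' d' where f: "\<And>x. f x \<le> C * (x + 1) ^ d" and g: "\<And>x. g x \<le> C' * (x + 1) ^ d'"
    using assms unfolding poly_bounded_def by blast
  show ?thesis
  proof (rule poly_boundedI)
    fix x :: nat
    have "C * (x + 1) ^ d \<le> C * (x + 1) ^ (d + d')" "C' * (x + 1) ^ d' \<le> C' * (x + 1) ^ (d + d')"
      by (intro mult_left_mono power_increasing; simp)+
    then show "f x + g x \<le> (C + C') * (x + 1) ^ (d + d')"
      using f[of x] g[of x] unfolding distrib_right by linarith
  qed
qed

lemma poly_bounded_mult:
  assumes "poly_bounded f" "poly_bounded g"
  shows "poly_bounded (\<lambda>x. f x * g x)"
proof -
  obtain C d C' d' where "\<And>x. f x \<le> C * (x + 1) ^ d" "\<And>x. g x \<le> C' * (x + 1) ^ d'"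
    using assms unfolding poly_bounded_def by blast
  then have "f x * g x \<le> C * (x + 1) ^ d * (C' * (x + 1) ^ d')" for x by (rule mult_mono) auto
  then show ?thesis by (intro poly_boundedI[of _ "C * C'" "d + d'"]) (simp add: power_add mult_ac)
qed

lemma poly_bounded_power: "poly_bounded f \<Longrightarrow> poly_bounded (\<lambda>x. f x ^ k)"
  by (induction k) (simp_all add: poly_bounded_const poly_bounded_mult)

lemma poly_bounded_compose:
  assumes "poly_bounded f" "poly_bounded g"
  shows "poly_bounded (\<lambda>x. f (g x))"
proof -
  obtain C d where f: "\<And>x. f x \<le> C * (x + 1) ^ d"
    using assms(1) unfolding poly_bounded_def by blast
  have "poly_bounded (\<lambda>x. C * (g x + 1) ^ d)"
    by (intro poly_bounded_mult poly_bounded_power poly_bounded_add poly_bounded_const assms(2))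
  then show ?thesis using f order_trans unfolding poly_bounded_def by meson
qed

lemmas poly_bounded_intros = poly_bounded_const poly_bounded_ident poly_bounded_add poly_bounded_mult
  poly_bounded_power

lemma poly_bounded_max_steps: "poly_bounded (max_steps c)"
  by (induction c) (simp_all only: max_steps.simps poly_bounded_intros)

subsection \<open>Compilation\<close>

text \<open>Cells below N are the variables. Cells N, N+1, N+2 and N+3 hold 0, 1, n^2 and the base n^2+n+1 of
  the array zone, in which sixteen arrays are interleaved, so that none of them needs a size. The
  cells from N+4 on are a stack of temporaries; d is its height.\<close>

abbreviation temp :: "nat \<Rightarrow> nat \<Rightarrow> nat" where
  "temp N d \<equiv> N + 4 + d"

definition array_address :: "nat \<Rightarrow> nat \<Rightarrow> nat \<Rightarrow> instr list" where
  "array_address N a d =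
     [Add (temp N d) (temp N d) (temp N d), Add (temp N d) (temp N d) (temp N d),
      Add (temp N d) (temp N d) (temp N d), Add (temp N d) (temp N d) (temp N d),
      LoadC (temp N (Suc d)) a, Add (temp N d) (temp N d) (temp N (Suc d)),
      Add (temp N d) (temp N d) (N + 3)]"

definition input_address :: "nat \<Rightarrow> nat \<Rightarrow> instr list" where
  "input_address N d =
     [Sub (temp N (Suc d)) (N + 2) 0, Sub (temp N (Suc d)) (temp N (Suc d)) (N + 1),
      Sub (temp N (Suc d)) (temp N (Suc d)) (temp N d), Sub (temp N d) (N + 2) (temp N (Suc d))]"

definition output_address :: "nat \<Rightarrow> nat \<Rightarrow> instr list" where
  "output_address N d =
     [Sub (temp N (Suc d)) 0 (N + 1), Sub (temp N (Suc d)) (temp N (Suc d)) (temp N d),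
      Sub (temp N d) (N + 3) (N + 1), Sub (temp N d) (temp N d) (temp N (Suc d))]"

primrec compile_expr :: "nat \<Rightarrow> expr \<Rightarrow> nat \<Rightarrow> instr list" where
  "compile_expr N (Num k) = (\<lambda>d. [LoadC (temp N d) k])"
| "compile_expr N (Var x) = (\<lambda>d. [Add (temp N d) x N])"
| "compile_expr N (Plus e e') = (\<lambda>d. compile_expr N e d @ compile_expr N e' (Suc d) @
     [Add (temp N d) (temp N d) (temp N (Suc d))])"
| "compile_expr N (Minus e e') = (\<lambda>d. compile_expr N e d @ compile_expr N e' (Suc d) @
     [Sub (temp N d) (temp N d) (temp N (Suc d))])"
| "compile_expr N (Elem a e) = (\<lambda>d. compile_expr N e d @ array_address N a d @
     [LoadI (temp N d) (temp N d)])"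
| "compile_expr N (Input e) = (\<lambda>d. compile_expr N e d @ input_address N d @
     [LoadI (temp N d) (temp N d)])"

text \<open>Jump targets are absolute, hence the argument q for the position of the code.\<close>

primrec compile_com :: "nat \<Rightarrow> com \<Rightarrow> nat \<Rightarrow> nat \<Rightarrow> instr list" where
  "compile_com N Skip = (\<lambda>d q. [])"
| "compile_com N (Assign v e) = (\<lambda>d q. compile_expr N e d @ [Add v (temp N d) N])"
| "compile_com N (Store a e e') = (\<lambda>d q. compile_expr N e d @ array_address N a d @
     compile_expr N e' (Suc d) @ [StoreI (temp N d) (temp N (Suc d))])"
| "compile_com N (Output e e') = (\<lambda>d q. compile_expr N e d @ output_address N d @
     compile_expr N e' (Suc d) @ [StoreI (temp N d) (temp N (Suc d))])"
| "compile_com N (c ;; c') = (\<lambda>d q. compile_com N c d q @ compile_com N c' d (q + com_length c))"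
| "compile_com N (If e c c') = (\<lambda>d q.
     let then_at = q + expr_length e + 1; else_at = then_at + com_length c + 1 in
     compile_expr N e d @ Jz (temp N d) else_at # compile_com N c d then_at @
     Jmp (else_at + com_length c') # compile_com N c' d else_at)"
| "compile_com N (For v x c) = (\<lambda>d q.
     [Add (temp N d) N N, Add (temp N (Suc d)) x N, Add v (temp N d) N,
      Sub (temp N (Suc (Suc d))) (temp N (Suc d)) (temp N d),
      Jz (temp N (Suc (Suc d))) (q + 7 + com_length c)] @
     compile_com N c (Suc (Suc d)) (q + 5) @
     [Add (temp N d) (temp N d) (N + 1), Jmp (q + 2)])"

lemma length_addresses [simp]:
  "length (array_address N a d) = 7" "length (input_address N d) = 4" "length (output_address N d) = 4"
  by (simp_all add: array_address_def input_address_def output_address_def)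

lemma length_compile_expr [simp]: "length (compile_expr N e d) = expr_length e"
  by (induction e arbitrary: d) simp_all

lemma length_compile_com [simp]: "length (compile_com N c d q) = com_length c"
  by (induction c arbitrary: d q) (simp_all add: Let_def)

primrec expr_temps :: "expr \<Rightarrow> nat" where
  "expr_temps (Num k) = 1"
| "expr_temps (Var x) = 1"
| "expr_temps (Plus e e') = max (expr_temps e) (Suc (expr_temps e'))"
| "expr_temps (Minus e e') = max (expr_temps e) (Suc (expr_temps e'))"
| "expr_temps (Elem a e) = max (expr_temps e) 2"
| "expr_temps (Input e) = max (expr_temps e) 2"

primrec com_temps :: "com \<Rightarrow> nat" where
  "com_temps Skip = 0"
| "com_temps (Assign v e) = expr_temps e"
| "com_temps (Store a e e') = max (max 2 (expr_temps e)) (Suc (expr_temps e'))"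
| "com_temps (Output e e') = max (max 2 (expr_temps e)) (Suc (expr_temps e'))"
| "com_temps (c ;; c') = max (com_temps c) (com_temps c')"
| "com_temps (If e c c') = max (expr_temps e) (max (com_temps c) (com_temps c'))"
| "com_temps (For v x c) = Suc (Suc (max 1 (com_temps c)))"

primrec wf_expr :: "nat \<Rightarrow> expr \<Rightarrow> bool" where
  "wf_expr N (Num k) \<longleftrightarrow> True"
| "wf_expr N (Var x) \<longleftrightarrow> x < N"
| "wf_expr N (Plus e e') \<longleftrightarrow> wf_expr N e \<and> wf_expr N e'"
| "wf_expr N (Minus e e') \<longleftrightarrow> wf_expr N e \<and> wf_expr N e'"
| "wf_expr N (Elem a e) \<longleftrightarrow> a < 16 \<and> wf_expr N e"
| "wf_expr N (Input e) \<longleftrightarrow> wf_expr N e"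

primrec wf_com :: "nat \<Rightarrow> com \<Rightarrow> bool" where
  "wf_com N Skip \<longleftrightarrow> True"
| "wf_com N (Assign v e) \<longleftrightarrow> 0 < v \<and> v < N \<and> wf_expr N e"
| "wf_com N (Store a e e') \<longleftrightarrow> a < 16 \<and> wf_expr N e \<and> wf_expr N e'"
| "wf_com N (Output e e') \<longleftrightarrow> wf_expr N e \<and> wf_expr N e'"
| "wf_com N (c ;; c') \<longleftrightarrow> wf_com N c \<and> wf_com N c'"
| "wf_com N (If e c c') \<longleftrightarrow> wf_expr N e \<and> wf_com N c \<and> wf_com N c'"
| "wf_com N (For v x c) \<longleftrightarrow> 0 < v \<and> v < N \<and> x < N \<and> wf_com N c"

definition output_cell :: "nat \<Rightarrow> nat \<Rightarrow> nat" where
  "output_cell n i = n * n + 1 + i"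

definition array_cell :: "nat \<Rightarrow> nat \<Rightarrow> nat \<Rightarrow> nat" where
  "array_cell n a x = n * n + n + 1 + 16 * x + a"

lemma less_output_cell: "n < output_cell n i" "n * n < output_cell n i"
  using le_square[of n] unfolding output_cell_def by linarith+

lemma less_array_cell: "n < array_cell n a x" "n * n < array_cell n a x"
  by (simp_all add: array_cell_def)

lemma output_cell_neq_array_cell: "i < n \<Longrightarrow> output_cell n i \<noteq> array_cell n a x"
  by (simp add: output_cell_def array_cell_def)

lemma output_cell_eq_iff: "output_cell n i = output_cell n i' \<longleftrightarrow> i = i'"
  by (simp add: output_cell_def)

lemma array_cell_eq_iff:
  assumes "a < 16" "b < 16"
  shows "array_cell n a x = array_cell n b y \<longleftrightarrow> a = b \<and> x = y"
proof
  assume "array_cell n a x = array_cell n b y"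
  then have cells_eq: "16 * x + a = 16 * y + b" by (simp add: array_cell_def)
  then have "(16 * x + a) div 16 = (16 * y + b) div 16" by simp
  then have "x = y" using assms by simp
  then show "a = b \<and> x = y" using cells_eq by simp
qed simp

definition represents :: "nat \<Rightarrow> (nat \<Rightarrow> nat) \<Rightarrow> state \<Rightarrow> bool" where
  "represents N m s \<longleftrightarrow> (let n = vars s 0 in
     0 < N \<and> (\<forall>v<N. m v = vars s v) \<and> m N = 0 \<and> m (N + 1) = 1 \<and> m (N + 2) = n * n \<and>
     m (N + 3) = n * n + n + 1 \<and> (\<forall>x. n < x \<and> x \<le> n * n \<longrightarrow> m x = input_cells s x) \<and>
     (\<forall>i<n. m (output_cell n i) = output_cells s i) \<and>
     (\<forall>a<16. \<forall>x. m (array_cell n a x) = arrays s a x))"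

lemma representsD:
  assumes "represents N m s"
  shows "m 0 = vars s 0" "v < N \<Longrightarrow> m v = vars s v" "m N = 0" "m (N + 1) = 1"
    "m (N + 2) = vars s 0 * vars s 0" "m (N + 3) = vars s 0 * vars s 0 + vars s 0 + 1"
    "vars s 0 < x \<Longrightarrow> x \<le> vars s 0 * vars s 0 \<Longrightarrow> m x = input_cells s x"
    "i < vars s 0 \<Longrightarrow> m (output_cell (vars s 0) i) = output_cells s i"
    "a < 16 \<Longrightarrow> m (array_cell (vars s 0) a x) = arrays s a x"
  using assms by (simp_all add: represents_def Let_def)

lemma represents_cong_memory:
  assumes "represents N m s" "\<And>x. x < N + 4 \<or> vars s 0 < x \<Longrightarrow> m' x = m x"
  shows "represents N m' s"
  using assms by (auto simp: represents_def Let_def less_output_cell less_array_cell)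

lemma represents_set_var:
  assumes "represents N m s" "0 < v" "v < N" "N \<le> vars s 0"
  shows "represents N (m(v := x)) (set_var v x s)"
proof -
  have "v < output_cell (vars s 0) i" "v < array_cell (vars s 0) a y" for i a y
    using assms less_output_cell[of "vars s 0"] less_array_cell[of "vars s 0"]
    by (meson order.strict_trans2 less_le_trans order.strict_trans)+
  then have "output_cell (vars s 0) i \<noteq> v" "array_cell (vars s 0) a y \<noteq> v" for i a y
    by (metis less_irrefl)+
  then show ?thesis using assms by (auto simp: represents_def Let_def)
qed

lemma represents_set_array:
  assumes "represents N m s" "N + 4 \<le> vars s 0" "a < 16"
  shows "represents N (m(array_cell (vars s 0) a x := y)) (set_array a ((arrays s a)(x := y)) s)"
proof -
  let ?c = "array_cell (vars s 0) a x"
  have "vars s 0 < ?c" "vars s 0 * vars s 0 < ?c" by (rule less_array_cell)+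
  then show ?thesis using assms
    by (auto simp: represents_def Let_def array_cell_eq_iff output_cell_neq_array_cell)
qed

lemma represents_set_output:
  assumes "represents N m s" "N + 4 \<le> vars s 0" "i < vars s 0"
  shows "represents N (m(output_cell (vars s 0) i := y)) (set_output ((output_cells s)(i := y)) s)"
proof -
  let ?c = "output_cell (vars s 0) i"
  have "vars s 0 < ?c" "vars s 0 * vars s 0 < ?c" by (rule less_output_cell)+
  moreover have "array_cell (vars s 0) a x \<noteq> ?c" for a x
    using output_cell_neq_array_cell[OF assms(3)] by metis
  ultimately show ?thesis using assms
    by (auto simp: represents_def Let_def output_cell_eq_iff)
qed

subsection \<open>Straight-line code\<close>

fun straight :: "instr \<Rightarrow> bool" where
  "straight (Jz a t) \<longleftrightarrow> False"
| "straight (Jmp t) \<longleftrightarrow> False"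
| "straight Halt \<longleftrightarrow> False"
| "straight _ \<longleftrightarrow> True"

definition effect :: "instr \<Rightarrow> (nat \<Rightarrow> nat) \<Rightarrow> nat \<Rightarrow> nat" where
  "effect i m = snd (exec i (0, m))"

lemma effect_simps [simp]:
  "effect (LoadC a v) m = m(a := v)" "effect (Add a b c) m = m(a := m b + m c)"
  "effect (Sub a b c) m = m(a := m b - m c)" "effect (LoadI a b) m = m(a := m (m b))"
  "effect (StoreI a b) m = m(m a := m b)"
  by (simp_all add: effect_def)

definition code_at :: "instr list \<Rightarrow> nat \<Rightarrow> instr list \<Rightarrow> bool" where
  "code_at P q cs \<longleftrightarrow> q + length cs \<le> length P \<and> (\<forall>i<length cs. P ! (q + i) = cs ! i)"

lemma code_at_Cons: "code_at P q (c # cs) \<longleftrightarrow> q < length P \<and> P ! q = c \<and> code_at P (Suc q) cs"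
  by (auto simp: code_at_def All_less_Suc2 less_Suc_eq_0_disj)

lemma code_at_append: "code_at P q (cs @ ds) \<longleftrightarrow> code_at P q cs \<and> code_at P (q + length cs) ds"
  by (induction cs arbitrary: q) (auto simp: code_at_Cons, auto simp: code_at_def)

lemma run_add: "run P (a + b) c = run P b (run P a c)"
  by (simp add: run_def funpow_add add.commute[of a])

lemma run_0 [simp]: "run P 0 c = c"
  by (simp add: run_def)

lemma run_Suc: "run P (Suc t) c = run P t (step P c)"
  by (simp add: run_def funpow_swap1)

lemma step_instr: "q < length P \<Longrightarrow> P ! q = i \<Longrightarrow> i \<noteq> Halt \<Longrightarrow> step P (q, m) = exec i (q, m)"
  by (simp add: step_def halted_def)

lemma run_straight:
  assumes "code_at P q cs" "list_all straight cs"
  shows "run P (length cs) (q, m) = (q + length cs, fold effect cs m)"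
  using assms
proof (induction cs arbitrary: q m)
  case (Cons i cs)
  have "exec i (q, m) = (Suc q, effect i m)" "i \<noteq> Halt" using Cons.prems by (cases i; simp)+
  then show ?case using Cons by (simp add: code_at_Cons run_Suc step_instr)
qed simp

lemma straight_compile_expr: "list_all straight (compile_expr N e d)"
  by (induction e arbitrary: d)
    (simp_all add: array_address_def input_address_def)

definition keeps_below :: "nat \<Rightarrow> nat \<Rightarrow> nat \<Rightarrow> (nat \<Rightarrow> nat) \<Rightarrow> (nat \<Rightarrow> nat) \<Rightarrow> bool" where
  "keeps_below N n d m m' \<longleftrightarrow> (\<forall>x. x < temp N d \<or> n < x \<longrightarrow> m' x = m x)"

lemma keeps_below_trans:
  "keeps_below N n d m m' \<Longrightarrow> keeps_below N n d' m' m'' \<Longrightarrow> d \<le> d' \<Longrightarrow> keeps_below N n d m m''"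
  by (auto simp: keeps_below_def)

lemma keeps_below_refl: "keeps_below N n d m m"
  by (simp add: keeps_below_def)

lemma keeps_below_two_temps:
  assumes "\<And>x. x \<notin> {temp N d, temp N (Suc d)} \<Longrightarrow> m' x = m x" "temp N (Suc d) \<le> n"
  shows "keeps_below N n d m m'"
  unfolding keeps_below_def
proof (intro allI impI)
  fix x assume "x < temp N d \<or> n < x"
  with assms(2) have "x \<notin> {temp N d, temp N (Suc d)}" by auto
  then show "m' x = m x" by (rule assms(1))
qed

lemma effect_array_address:
  fixes a d :: nat
  assumes "represents N m s" "temp N (Suc d) \<le> vars s 0"
  defines "m' \<equiv> fold effect (array_address N a d) m"
  shows "m' (temp N d) = array_cell (vars s 0) a (m (temp N d)) \<and> keeps_below N (vars s 0) d m m'"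
proof
  show "m' (temp N d) = array_cell (vars s 0) a (m (temp N d))"
    using representsD(6)[OF assms(1)] by (simp add: m'_def array_address_def array_cell_def)
  show "keeps_below N (vars s 0) d m m'"
    by (rule keeps_below_two_temps) (use assms(2) in \<open>simp_all add: m'_def array_address_def\<close>)
qed

lemma effect_input_address:
  fixes d :: nat
  assumes "represents N m s" "temp N (Suc d) \<le> vars s 0"
  defines "m' \<equiv> fold effect (input_address N d) m"
  shows "m' (temp N d) = readable (vars s 0) (m (temp N d)) \<and> keeps_below N (vars s 0) d m m'"
proof
  define n where "n = vars s 0"
  have "2 \<le> n" "2 * n \<le> n * n" using assms(2) by (auto simp: n_def)
  then have "n * n - (n * n - n - 1 - m (temp N d)) = readable n (m (temp N d))"
    unfolding readable_def by linarith
  then show "m' (temp N d) = readable (vars s 0) (m (temp N d))"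
    using representsD(1,4,5)[OF assms(1)] by (simp add: m'_def input_address_def n_def)
  show "keeps_below N (vars s 0) d m m'"
    by (rule keeps_below_two_temps) (use assms(2) in \<open>simp_all add: m'_def input_address_def\<close>)
qed

lemma effect_output_address:
  fixes d :: nat
  assumes "represents N m s" "temp N (Suc d) \<le> vars s 0"
  defines "m' \<equiv> fold effect (output_address N d) m"
  shows "m' (temp N d) = output_cell (vars s 0) (writable (vars s 0) (m (temp N d))) \<and>
    keeps_below N (vars s 0) d m m'"
proof
  define n where "n = vars s 0"
  have "n * n + n + 1 - 1 - (n - 1 - m (temp N d)) = output_cell n (writable n (m (temp N d)))"
    using assms(2) unfolding n_def writable_def output_cell_def by linarith
  then show "m' (temp N d) = output_cell (vars s 0) (writable (vars s 0) (m (temp N d)))"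
    using representsD(1,4,6)[OF assms(1)] by (simp add: m'_def output_address_def n_def)
  show "keeps_below N (vars s 0) d m m'"
    by (rule keeps_below_two_temps) (use assms(2) in \<open>simp_all add: m'_def output_address_def\<close>)
qed

lemma represents_keeps_below:
  assumes "represents N m s" "keeps_below N (vars s 0) d m m'"
  shows "represents N m' s"
  using assms(1) by (rule represents_cong_memory) (use assms(2) in \<open>auto simp: keeps_below_def\<close>)

lemma keeps_below_fun_upd: "temp N d \<le> n \<Longrightarrow> keeps_below N n d m (m(temp N d := x))"
  by (auto simp: keeps_below_def)

definition evaluates :: "nat \<Rightarrow> expr \<Rightarrow> bool" where
  "evaluates N e \<longleftrightarrow> (\<forall>m s d. represents N m s \<longrightarrow> wf_expr N e \<longrightarrow>
     temp N (d + expr_temps e) \<le> Suc (vars s 0) \<longrightarrow>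
     fold effect (compile_expr N e d) m (temp N d) = eval e s \<and>
     keeps_below N (vars s 0) d m (fold effect (compile_expr N e d) m))"

lemma evaluatesD:
  assumes "evaluates N e" "represents N m s" "wf_expr N e" "temp N (d + expr_temps e) \<le> Suc (vars s 0)"
  shows "fold effect (compile_expr N e d) m (temp N d) = eval e s"
    "keeps_below N (vars s 0) d m (fold effect (compile_expr N e d) m)"
  using assms unfolding evaluates_def by blast+

lemma evaluatesI:
  assumes "\<And>m s d. \<lbrakk>represents N m s; wf_expr N e; temp N (d + expr_temps e) \<le> Suc (vars s 0)\<rbrakk> \<Longrightarrow>
    \<exists>m'. fold effect (compile_expr N e d) m = m'(temp N d := eval e s) \<and>
      temp N d \<le> vars s 0 \<and> keeps_below N (vars s 0) d m m'"
  shows "evaluates N e"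
  unfolding evaluates_def
proof (intro allI impI)
  fix m s d
  assume "represents N m s" "wf_expr N e" "temp N (d + expr_temps e) \<le> Suc (vars s 0)"
  from assms[OF this] obtain m' where m': "fold effect (compile_expr N e d) m = m'(temp N d := eval e s)"
    "temp N d \<le> vars s 0" "keeps_below N (vars s 0) d m m'" by blast
  from keeps_below_trans[OF m'(3) keeps_below_fun_upd[OF m'(2)] order.refl]
  show "fold effect (compile_expr N e d) m (temp N d) = eval e s \<and>
    keeps_below N (vars s 0) d m (fold effect (compile_expr N e d) m)"
    unfolding m'(1) by (simp only: fun_upd_same simp_thms)
qed

lemma effect_compile_operands:
  assumes "evaluates N e" "evaluates N e'" "represents N m s" "wf_expr N e" "wf_expr N e'"
    "temp N (d + max (expr_temps e) (Suc (expr_temps e'))) \<le> Suc (vars s 0)"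
  defines "m' \<equiv> fold effect (compile_expr N e' (Suc d)) (fold effect (compile_expr N e d) m)"
  shows "m' (temp N d) = eval e s" "m' (temp N (Suc d)) = eval e' s" "keeps_below N (vars s 0) d m m'"
proof -
  let ?m = "fold effect (compile_expr N e d) m"
  have e: "?m (temp N d) = eval e s" "keeps_below N (vars s 0) d m ?m"
    using evaluatesD[OF assms(1,3,4), of d] assms(6) by auto
  have e': "m' (temp N (Suc d)) = eval e' s" "keeps_below N (vars s 0) (Suc d) ?m m'"
    using evaluatesD[OF assms(2) represents_keeps_below[OF assms(3) e(2)] assms(5), of "Suc d"] assms(6)
    by (auto simp: m'_def)
  show "m' (temp N (Suc d)) = eval e' s" by (rule e')
  show "m' (temp N d) = eval e s" using e(1) e'(2) by (simp add: keeps_below_def)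
  show "keeps_below N (vars s 0) d m m'" using e(2) e'(2) by (rule keeps_below_trans) simp
qed

lemma effect_compile_index:
  assumes "evaluates N e" "represents N m s" "wf_expr N e" "temp N (d + expr_temps e) \<le> Suc (vars s 0)"
    and address: "\<And>m. represents N m s \<Longrightarrow>
      fold effect cs m (temp N d) = f (m (temp N d)) \<and> keeps_below N (vars s 0) d m (fold effect cs m)"
  defines "m' \<equiv> fold effect cs (fold effect (compile_expr N e d) m)"
  shows "m' (temp N d) = f (eval e s)" "keeps_below N (vars s 0) d m m'"
proof -
  note e = evaluatesD[OF assms(1-4)]
  note m' = address[OF represents_keeps_below[OF assms(2) e(2)], folded m'_def]
  show "m' (temp N d) = f (eval e s)" using m' e(1) by simp
  show "keeps_below N (vars s 0) d m m'" using e(2) conjunct2[OF m'] by (rule keeps_below_trans) simp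
qed

lemma evaluates_Elem:
  assumes "evaluates N e"
  shows "evaluates N (Elem a e)"
proof (rule evaluatesI)
  fix m s d
  assume prems: "represents N m s" "wf_expr N (Elem a e)"
    "temp N (d + expr_temps (Elem a e)) \<le> Suc (vars s 0)"
  let ?m = "fold effect (array_address N a d) (fold effect (compile_expr N e d) m)"
  have m: "?m (temp N d) = array_cell (vars s 0) a (eval e s)" "keeps_below N (vars s 0) d m ?m"
    using effect_compile_index[OF assms prems(1) _ _ effect_array_address] prems(2,3) by auto
  have "?m (array_cell (vars s 0) a (eval e s)) = arrays s a (eval e s)"
    using representsD(9)[OF represents_keeps_below[OF prems(1) m(2)]] prems(2) by simp
  with m prems(3) show "\<exists>m'. fold effect (compile_expr N (Elem a e) d) m = m'(temp N d := eval (Elem a e) s) \<and>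
    temp N d \<le> vars s 0 \<and> keeps_below N (vars s 0) d m m'" by auto
qed

lemma evaluates_Input:
  assumes "evaluates N e"
  shows "evaluates N (Input e)"
proof (rule evaluatesI)
  fix m s d
  assume prems: "represents N m s" "wf_expr N (Input e)"
    "temp N (d + expr_temps (Input e)) \<le> Suc (vars s 0)"
  let ?n = "vars s 0" and ?m = "fold effect (input_address N d) (fold effect (compile_expr N e d) m)"
  have m: "?m (temp N d) = readable ?n (eval e s)" "keeps_below N ?n d m ?m"
    using effect_compile_index[OF assms prems(1) _ _ effect_input_address] prems(2,3) by auto
  have "2 * ?n \<le> ?n * ?n" "2 \<le> ?n" using prems(3) by auto
  then have "?n < readable ?n (eval e s)" "readable ?n (eval e s) \<le> ?n * ?n"
    unfolding readable_def by linarith+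
  then have "?m (readable ?n (eval e s)) = input_cells s (readable ?n (eval e s))"
    by (rule representsD(7)[OF represents_keeps_below[OF prems(1) m(2)]])
  with m prems(3) show "\<exists>m'. fold effect (compile_expr N (Input e) d) m = m'(temp N d := eval (Input e) s) \<and>
    temp N d \<le> vars s 0 \<and> keeps_below N (vars s 0) d m m'" by auto
qed

theorem evaluates_expr: "evaluates N e"
proof (induction e)
  case (Num k)
  show ?case by (rule evaluatesI) (auto intro: keeps_below_refl)
next
  case (Var x)
  show ?case
  proof (rule evaluatesI)
    fix m s d
    assume "represents N m s" "wf_expr N (Var x)" "temp N (d + expr_temps (Var x)) \<le> Suc (vars s 0)"
    then show "\<exists>m'. fold effect (compile_expr N (Var x) d) m = m'(temp N d := eval (Var x) s) \<and>
      temp N d \<le> vars s 0 \<and> keeps_below N (vars s 0) d m m'"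
      using representsD(2,3)[of N m s] by (auto intro: keeps_below_refl)
  qed
next
  case (Plus e e')
  show ?case
  proof (rule evaluatesI)
    fix m s d
    assume "represents N m s" "wf_expr N (Plus e e')"
      "temp N (d + expr_temps (Plus e e')) \<le> Suc (vars s 0)"
    with effect_compile_operands[OF Plus.IH, of m s d]
    show "\<exists>m'. fold effect (compile_expr N (Plus e e') d) m = m'(temp N d := eval (Plus e e') s) \<and>
      temp N d \<le> vars s 0 \<and> keeps_below N (vars s 0) d m m'" by auto
  qed
next
  case (Minus e e')
  show ?case
  proof (rule evaluatesI)
    fix m s d
    assume "represents N m s" "wf_expr N (Minus e e')"
      "temp N (d + expr_temps (Minus e e')) \<le> Suc (vars s 0)"
    with effect_compile_operands[OF Minus.IH, of m s d]
    show "\<exists>m'. fold effect (compile_expr N (Minus e e') d) m = m'(temp N d := eval (Minus e e') s) \<and>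
      temp N d \<le> vars s 0 \<and> keeps_below N (vars s 0) d m m'" by auto
  qed
qed (simp_all add: evaluates_Elem evaluates_Input)

subsection \<open>Correctness of the compiled program\<close>

definition simulates :: "instr list \<Rightarrow> nat \<Rightarrow> com \<Rightarrow> bool" where
  "simulates P N c \<longleftrightarrow> (\<forall>m s d q. represents N m s \<longrightarrow> wf_com N c \<longrightarrow>
     temp N (d + com_temps c) \<le> Suc (vars s 0) \<longrightarrow> code_at P q (compile_com N c d q) \<longrightarrow>
     (\<exists>m'. run P (steps c s) (q, m) = (q + com_length c, m') \<and> represents N m' (execute c s) \<and>
       (\<forall>i<d. m' (temp N i) = m (temp N i))))"

lemma simulatesD:
  assumes "simulates P N c" "represents N m s" "wf_com N c" "temp N (d + com_temps c) \<le> Suc (vars s 0)"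
    "code_at P q (compile_com N c d q)"
  obtains m' where "run P (steps c s) (q, m) = (q + com_length c, m')" "represents N m' (execute c s)"
    "\<forall>i<d. m' (temp N i) = m (temp N i)"
  using assms unfolding simulates_def by blast

lemma simulatesI:
  assumes "\<And>m s d q. \<lbrakk>represents N m s; wf_com N c; temp N (d + com_temps c) \<le> Suc (vars s 0);
      code_at P q (compile_com N c d q)\<rbrakk> \<Longrightarrow>
    \<exists>m'. run P (steps c s) (q, m) = (q + com_length c, m') \<and> represents N m' (execute c s) \<and>
       (\<forall>i<d. m' (temp N i) = m (temp N i))"
  shows "simulates P N c"
  using assms unfolding simulates_def by blast

lemma simulates_straight:
  assumes straight: "\<And>d q. list_all straight (compile_com N c d q)"
    and steps: "\<And>s. steps c s = com_length c"
    and effect: "\<And>m s d q. \<lbrakk>represents N m s; wf_com N c; temp N (d + com_temps c) \<le> Suc (vars s 0)\<rbrakk> \<Longrightarrow>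
      represents N (fold effect (compile_com N c d q) m) (execute c s) \<and>
      (\<forall>i<d. fold effect (compile_com N c d q) m (temp N i) = m (temp N i))"
  shows "simulates P N c"
proof (rule simulatesI)
  fix m s d q
  assume prems: "represents N m s" "wf_com N c" "temp N (d + com_temps c) \<le> Suc (vars s 0)"
    and code: "code_at P q (compile_com N c d q)"
  show "\<exists>m'. run P (steps c s) (q, m) = (q + com_length c, m') \<and> represents N m' (execute c s) \<and>
      (\<forall>i<d. m' (temp N i) = m (temp N i))"
    using run_straight[OF code straight, of m] effect[OF prems, of q] by (auto simp: steps)
qed

lemma simulates_Assign: "simulates P N (Assign v e)"
proof (rule simulates_straight)
  fix m s d q
  assume prems: "represents N m s" "wf_com N (Assign v e)"
    "temp N (d + com_temps (Assign v e)) \<le> Suc (vars s 0)"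
  let ?m = "fold effect (compile_expr N e d) m"
  have m: "?m (temp N d) = eval e s" "keeps_below N (vars s 0) d m ?m"
    using evaluatesD[OF evaluates_expr prems(1), of e d] prems(2,3) by auto
  note r = represents_keeps_below[OF prems(1) m(2)]
  have "fold effect (compile_com N (Assign v e) d q) m = ?m(v := eval e s)"
    using m(1) representsD(3)[OF r] by simp
  moreover have "N \<le> vars s 0" using prems(2,3) by (cases e) auto
  ultimately show "represents N (fold effect (compile_com N (Assign v e) d q) m) (execute (Assign v e) s) \<and>
      (\<forall>i<d. fold effect (compile_com N (Assign v e) d q) m (temp N i) = m (temp N i))"
    using represents_set_var[OF r] prems(2) m(2) by (auto simp: keeps_below_def)
qed (simp_all add: straight_compile_expr)

lemma straight_addresses:
  "list_all straight (array_address N a d)" "list_all straight (output_address N d)"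
  by (simp_all add: array_address_def output_address_def)

lemma simulates_Store: "simulates P N (Store a e e')"
proof (rule simulates_straight)
  fix m s d q
  assume prems: "represents N m s" "wf_com N (Store a e e')"
    "temp N (d + com_temps (Store a e e')) \<le> Suc (vars s 0)"
  let ?m = "fold effect (array_address N a d) (fold effect (compile_expr N e d) m)"
  let ?m' = "fold effect (compile_expr N e' (Suc d)) ?m"
  have m: "?m (temp N d) = array_cell (vars s 0) a (eval e s)" "keeps_below N (vars s 0) d m ?m"
    using effect_compile_index[OF evaluates_expr prems(1) _ _ effect_array_address] prems(2,3) by auto
  have m': "?m' (temp N (Suc d)) = eval e' s" "keeps_below N (vars s 0) (Suc d) ?m ?m'"
    using evaluatesD[OF evaluates_expr represents_keeps_below[OF prems(1) m(2)], of e' "Suc d"] prems(2,3)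
    by auto
  have k: "keeps_below N (vars s 0) d m ?m'" using keeps_below_trans[OF m(2) m'(2)] by simp
  have "?m' (temp N d) = array_cell (vars s 0) a (eval e s)"
    using m(1) m'(2) by (simp add: keeps_below_def)
  then have final_memory: "fold effect (compile_com N (Store a e e') d q) m
      = ?m'(array_cell (vars s 0) a (eval e s) := eval e' s)"
    using m'(1) by simp
  have "represents N (?m'(array_cell (vars s 0) a (eval e s) := eval e' s)) (execute (Store a e e') s)"
    using represents_set_array[OF represents_keeps_below[OF prems(1) k]] prems(2,3) by simp
  moreover have "temp N i \<noteq> array_cell (vars s 0) a (eval e s)" if "i < d" for i
    using less_array_cell(1)[of "vars s 0" a "eval e s"] that prems(3) by simp
  ultimately show "represents N (fold effect (compile_com N (Store a e e') d q) m) (execute (Store a e e') s) \<and>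
      (\<forall>i<d. fold effect (compile_com N (Store a e e') d q) m (temp N i) = m (temp N i))"
    unfolding final_memory using k by (simp add: keeps_below_def)
qed (simp_all add: straight_compile_expr straight_addresses)

lemma simulates_Output: "simulates P N (Output e e')"
proof (rule simulates_straight)
  fix m s d q
  assume prems: "represents N m s" "wf_com N (Output e e')"
    "temp N (d + com_temps (Output e e')) \<le> Suc (vars s 0)"
  let ?m = "fold effect (output_address N d) (fold effect (compile_expr N e d) m)"
  let ?m' = "fold effect (compile_expr N e' (Suc d)) ?m"
  let ?c = "output_cell (vars s 0) (writable (vars s 0) (eval e s))"
  have m: "?m (temp N d) = ?c" "keeps_below N (vars s 0) d m ?m"
    using effect_compile_index[OF evaluates_expr prems(1) _ _ effect_output_address] prems(2,3) by auto
  have m': "?m' (temp N (Suc d)) = eval e' s" "keeps_below N (vars s 0) (Suc d) ?m ?m'"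
    using evaluatesD[OF evaluates_expr represents_keeps_below[OF prems(1) m(2)], of e' "Suc d"] prems(2,3)
    by auto
  have k: "keeps_below N (vars s 0) d m ?m'" using keeps_below_trans[OF m(2) m'(2)] by simp
  have "?m' (temp N d) = ?c" using m(1) m'(2) by (simp add: keeps_below_def)
  then have final_memory: "fold effect (compile_com N (Output e e') d q) m = ?m'(?c := eval e' s)"
    using m'(1) by simp
  have "writable (vars s 0) (eval e s) < vars s 0" using prems(3) by (simp add: writable_def)
  then have "represents N (?m'(?c := eval e' s)) (execute (Output e e') s)"
    using represents_set_output[OF represents_keeps_below[OF prems(1) k]] prems(3) by simp
  moreover have "temp N i \<noteq> ?c" if "i < d" for i
    using less_output_cell(1)[of "vars s 0" "writable (vars s 0) (eval e s)"] that prems(3) by simp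
  ultimately show "represents N (fold effect (compile_com N (Output e e') d q) m) (execute (Output e e') s) \<and>
      (\<forall>i<d. fold effect (compile_com N (Output e e') d q) m (temp N i) = m (temp N i))"
    unfolding final_memory using k by (simp add: keeps_below_def)
qed (simp_all add: straight_compile_expr straight_addresses)

lemma wf_com_size_notin_written: "wf_com N c \<Longrightarrow> VarLoc 0 \<notin> written c"
  by (induction c) auto

lemma wf_com_size: "wf_com N c \<Longrightarrow> vars (execute c s) 0 = vars s 0"
  by (intro execute_unchanged wf_com_size_notin_written)

lemma simulates_Seq:
  assumes "simulates P N c" "simulates P N c'"
  shows "simulates P N (c ;; c')"
proof (rule simulatesI)
  fix m s d q
  assume prems: "represents N m s" "wf_com N (c ;; c')"
    "temp N (d + com_temps (c ;; c')) \<le> Suc (vars s 0)"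
    and "code_at P q (compile_com N (c ;; c') d q)"
  then have code: "code_at P q (compile_com N c d q)"
    "code_at P (q + com_length c) (compile_com N c' d (q + com_length c))"
    by (simp_all add: code_at_append)
  have wf: "wf_com N c" "wf_com N c'" using prems(2) by simp_all
  have temps: "temp N (d + com_temps c) \<le> Suc (vars s 0)"
    "temp N (d + com_temps c') \<le> Suc (vars (execute c s) 0)"
    using prems(3) wf_com_size[OF wf(1)] by simp_all
  obtain m' where m': "run P (steps c s) (q, m) = (q + com_length c, m')" "represents N m' (execute c s)"
    "\<forall>i<d. m' (temp N i) = m (temp N i)"
    using simulatesD[OF assms(1) prems(1) wf(1) temps(1) code(1)] .
  obtain m'' where "run P (steps c' (execute c s)) (q + com_length c, m')
    = (q + com_length c + com_length c', m'')"
    "represents N m'' (execute c' (execute c s))" "\<forall>i<d. m'' (temp N i) = m' (temp N i)"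
    using simulatesD[OF assms(2) m'(2) wf(2) temps(2) code(2)] .
  with m' show "\<exists>m'. run P (steps (c ;; c') s) (q, m) = (q + com_length (c ;; c'), m') \<and>
      represents N m' (execute (c ;; c') s) \<and> (\<forall>i<d. m' (temp N i) = m (temp N i))"
    by (auto simp: run_add add.assoc)
qed

lemma code_at_compile_If:
  assumes "code_at P q (compile_com N (If e c c') d q)"
  defines "then_at \<equiv> q + expr_length e + 1"
  defines "else_at \<equiv> then_at + com_length c + 1"
  shows "code_at P q (compile_expr N e d)" "code_at P then_at (compile_com N c d then_at)"
    "code_at P else_at (compile_com N c' d else_at)"
    "q + expr_length e < length P" "P ! (q + expr_length e) = Jz (temp N d) else_at"
    "then_at + com_length c < length P" "P ! (then_at + com_length c) = Jmp (else_at + com_length c')"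
  using assms(1) by (simp_all add: Let_def then_at_def else_at_def code_at_append code_at_Cons)

lemma simulates_If:
  assumes "simulates P N c" "simulates P N c'"
  shows "simulates P N (If e c c')"
proof (rule simulatesI)
  fix m s d q
  define then_at else_at where "then_at = q + expr_length e + 1"
    and "else_at = then_at + com_length c + 1"
  assume prems: "represents N m s" "wf_com N (If e c c')"
    "temp N (d + com_temps (If e c c')) \<le> Suc (vars s 0)"
    and code: "code_at P q (compile_com N (If e c c') d q)"
  note code = code_at_compile_If[OF code, folded then_at_def, folded else_at_def]
  let ?m = "fold effect (compile_expr N e d) m"
  have m: "?m (temp N d) = eval e s" "keeps_below N (vars s 0) d m ?m"
    using evaluatesD[OF evaluates_expr prems(1), of e d] prems(2,3) by auto
  note r = represents_keeps_below[OF prems(1) m(2)]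
  have wf: "wf_com N c" "wf_com N c'"
    and temps: "temp N (d + com_temps c) \<le> Suc (vars s 0)" "temp N (d + com_temps c') \<le> Suc (vars s 0)"
    using prems(2,3) by simp_all
  have run_e: "run P (expr_length e) (q, m) = (q + expr_length e, ?m)"
    using run_straight[OF code(1) straight_compile_expr] by simp
  have "\<exists>m'. run P (steps (If e c c') s) (q, m) = (else_at + com_length c', m') \<and>
      represents N m' (execute (If e c c') s) \<and> (\<forall>i<d. m' (temp N i) = ?m (temp N i))"
  proof (cases "eval e s = 0")
    case True
    obtain m' where m': "run P (steps c' s) (else_at, ?m) = (else_at + com_length c', m')"
      "represents N m' (execute c' s)" "\<forall>i<d. m' (temp N i) = ?m (temp N i)"
      using simulatesD[OF assms(2) r wf(2) temps(2) code(3)] .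
    have "run P (expr_length e + (1 + steps c' s)) (q, m) = (else_at + com_length c', m')"
      unfolding run_add run_e using True m(1) code(4-7) m'(1) by (simp add: run_Suc step_instr)
    then show ?thesis using True m' by (auto simp: add_ac)
  next
    case False
    obtain m' where m': "run P (steps c s) (then_at, ?m) = (then_at + com_length c, m')"
      "represents N m' (execute c s)" "\<forall>i<d. m' (temp N i) = ?m (temp N i)"
      using simulatesD[OF assms(1) r wf(1) temps(1) code(2)] .
    have "run P (expr_length e + (1 + (steps c s + 1))) (q, m) = (else_at + com_length c', m')"
      unfolding run_add run_e
      using False m(1) code(4-7) m'(1) by (simp add: run_Suc step_instr then_at_def)
    then show ?thesis using False m' by (auto simp: add_ac)
  qed
  moreover have "?m (temp N i) = m (temp N i)" if "i < d" for i
    using m(2) that by (simp add: keeps_below_def)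
  ultimately show "\<exists>m'. run P (steps (If e c c') s) (q, m) = (q + com_length (If e c c'), m') \<and>
      represents N m' (execute (If e c c') s) \<and> (\<forall>i<d. m' (temp N i) = m (temp N i))"
    by (auto simp: then_at_def else_at_def add_ac)
qed

locale compiled_loop =
  fixes P :: "instr list" and N v x d q :: nat and c :: com and s :: state and m :: "nat \<Rightarrow> nat"
  assumes body: "simulates P N c"
    and initial: "represents N m s"
    and wf: "wf_com N (For v x c)"
    and temps: "temp N (d + com_temps (For v x c)) \<le> Suc (vars s 0)"
    and code: "code_at P q (compile_com N (For v x c) d q)"
begin

abbreviation counter :: nat where "counter \<equiv> temp N d"
abbreviation bound :: nat where "bound \<equiv> temp N (Suc d)"
abbreviation test :: nat where "test \<equiv> temp N (Suc (Suc d))"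

abbreviation after :: "nat \<Rightarrow> state" where
  "after i \<equiv> iterate_body v c i s"

definition at_head :: "nat \<Rightarrow> (nat \<Rightarrow> nat) \<Rightarrow> bool" where
  "at_head i m' \<longleftrightarrow> represents N m' (after i) \<and> m' counter = i \<and> m' bound = vars s x \<and>
     (\<forall>i<d. m' (temp N i) = m (temp N i))"

lemma instructions:
  "q < length P" "P ! q = Add counter N N" "q + 1 < length P" "P ! (q + 1) = Add bound x N"
  "q + 2 < length P" "P ! (q + 2) = Add v counter N" "q + 3 < length P"
  "P ! (q + 3) = Sub test bound counter"
  "q + 4 < length P" "P ! (q + 4) = Jz test (q + 7 + com_length c)"
  "code_at P (q + 5) (compile_com N c (Suc (Suc d)) (q + 5))"
  "q + 5 + com_length c < length P" "P ! (q + 5 + com_length c) = Add counter counter (N + 1)"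
  "q + 6 + com_length c < length P" "P ! (q + 6 + com_length c) = Jmp (q + 2)"
  using code by (auto simp: code_at_append code_at_Cons eval_nat_numeral)

lemma size_unchanged: "vars (after i) 0 = vars s 0"
  using agree_off_iterate[of v x c s i] wf_com_size_notin_written[OF wf] by (simp add: agree_off_def)

lemma body_fits: "wf_com N c" "temp N (Suc (Suc d) + com_temps c) \<le> Suc (vars s 0)"
  "N \<le> vars s 0" "test \<le> vars s 0"
  using wf temps by simp_all

lemma run_entry:
  "run P 2 (q, m) = (q + 2, m(counter := 0, bound := vars s x))"
  "at_head 0 (m(counter := 0, bound := vars s x))"
proof -
  have "m N = 0" "m x = vars s x" using representsD(2,3)[OF initial] wf by simp_all
  then show "run P 2 (q, m) = (q + 2, m(counter := 0, bound := vars s x))"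
    using instructions(1-4) wf by (simp add: numeral_2_eq_2 run_Suc step_instr)
  have "represents N (m(counter := 0, bound := vars s x)) s"
    by (rule represents_cong_memory[OF initial]) (use body_fits in auto)
  then show "at_head 0 (m(counter := 0, bound := vars s x))"
    by (simp add: at_head_def)
qed

lemma run_test:
  assumes "at_head i m'"
  shows "run P 2 (q + 2, m') = (q + 4, m'(v := i, test := vars s x - i))"
    and "represents N (m'(v := i, test := vars s x - i)) (set_var v i (after i))"
proof -
  have m': "represents N m' (after i)" "m' counter = i" "m' bound = vars s x"
    using assms by (simp_all add: at_head_def)
  show "run P 2 (q + 2, m') = (q + 4, m'(v := i, test := vars s x - i))"
    using instructions(5-8) m'(2,3) representsD(3)[OF m'(1)] wf
    by (simp add: numeral_2_eq_2 run_Suc step_instr eval_nat_numeral)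
  have "represents N (m'(v := i)) (set_var v i (after i))"
    using represents_set_var[OF m'(1)] wf body_fits size_unchanged by simp
  then show "represents N (m'(v := i, test := vars s x - i)) (set_var v i (after i))"
    by (rule represents_cong_memory) (use body_fits size_unchanged wf in auto)
qed

lemma run_iteration:
  assumes "at_head i m'" "i < vars s x"
  shows "\<exists>m''. run P (steps c (set_var v i (after i)) + 5) (q + 2, m') = (q + 2, m'') \<and>
      at_head (Suc i) m''"
proof -
  let ?m = "m'(v := i, test := vars s x - i)" and ?t = "steps c (set_var v i (after i))"
  have test_passed: "run P (2 + 1) (q + 2, m') = (q + 5, ?m)"
    unfolding run_add run_test(1)[OF assms(1)] using instructions(9,10) assms(2)
    by (simp add: run_Suc step_instr eval_nat_numeral)
  have "temp N (Suc (Suc d) + com_temps c) \<le> Suc (vars (set_var v i (after i)) 0)"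
    using body_fits(2) size_unchanged wf by simp
  from simulatesD[OF body run_test(2)[OF assms(1)] body_fits(1) this instructions(11)]
  obtain m'' where m'': "run P ?t (q + 5, ?m) = (q + 5 + com_length c, m'')"
    "represents N m'' (after (Suc i))" "\<forall>j<Suc (Suc d). m'' (temp N j) = ?m (temp N j)"
    by (metis iterate_body_simps(2))
  have temps'': "m'' counter = i" "m'' bound = vars s x" "\<forall>j<d. m'' (temp N j) = m (temp N j)"
    using m''(3)[rule_format, of d] m''(3)[rule_format, of "Suc d"] m''(3) assms(1) wf
    by (auto simp: at_head_def)
  have jump_back: "run P 2 (q + 5 + com_length c, m'') = (q + 2, m''(counter := Suc i))"
    using instructions(12-15) temps''(1) representsD(4)[OF m''(2)]
    by (simp add: numeral_2_eq_2 run_Suc step_instr eval_nat_numeral)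
  have "represents N (m''(counter := Suc i)) (after (Suc i))"
    by (rule represents_cong_memory[OF m''(2)])
      (use body_fits size_unchanged in \<open>auto simp del: iterate_body_simps\<close>)
  then have "at_head (Suc i) (m''(counter := Suc i))"
    unfolding at_head_def using temps'' by (simp del: iterate_body_simps)
  moreover have "run P ((2 + 1) + (?t + 2)) (q + 2, m') = (q + 2, m''(counter := Suc i))"
    by (simp only: run_add[of P "2 + 1"] test_passed run_add[of P ?t] m''(1) jump_back)
  ultimately show ?thesis by (intro exI[of _ "m''(counter := Suc i)"]) (simp add: numeral_eq_Suc)
qed

lemma run_iterations:
  "i \<le> vars s x \<Longrightarrow>
    \<exists>m'. run P (2 + (\<Sum>j<i. steps c (set_var v j (after j)) + 5)) (q, m) = (q + 2, m') \<and> at_head i m'"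
proof (induction i)
  case 0
  then show ?case using run_entry by auto
next
  case (Suc i)
  then obtain m' where m': "run P (2 + (\<Sum>j<i. steps c (set_var v j (after j)) + 5)) (q, m) = (q + 2, m')"
    "at_head i m'" by auto
  from run_iteration[OF m'(2)] Suc.prems obtain m'' where
    "run P (steps c (set_var v i (after i)) + 5) (q + 2, m') = (q + 2, m'')" "at_head (Suc i) m''" by auto
  moreover have "run P (2 + (\<Sum>j<Suc i. steps c (set_var v j (after j)) + 5)) (q, m)
      = run P (steps c (set_var v i (after i)) + 5) (q + 2, m')"
    unfolding m'(1)[symmetric] run_add[symmetric] by (simp add: add.assoc)
  ultimately show ?case by (simp del: iterate_body_simps)
qed

lemma run_loop:
  "\<exists>m'. run P (steps (For v x c) s) (q, m) = (q + com_length (For v x c), m') \<and>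
    represents N m' (execute (For v x c) s) \<and> (\<forall>i<d. m' (temp N i) = m (temp N i))"
proof -
  obtain m' where m': "run P (2 + (\<Sum>j<vars s x. steps c (set_var v j (after j)) + 5)) (q, m)
    = (q + 2, m')"
    "at_head (vars s x) m'" using run_iterations by blast
  let ?m = "m'(v := vars s x, test := 0)"
  have steps: "steps (For v x c) s = 2 + (\<Sum>j<vars s x. steps c (set_var v j (after j)) + 5) + (2 + 1)"
    by simp
  have "run P (steps (For v x c) s) (q, m) = (q + 7 + com_length c, ?m)"
    unfolding steps run_add[of P _ "2 + 1"] m'(1) run_add[of P 2 1] run_test(1)[OF m'(2)]
    using instructions(9,10) by (simp add: run_Suc step_instr eval_nat_numeral)
  moreover have "represents N ?m (execute (For v x c) s)"
    using run_test(2)[OF m'(2)] by (simp add: execute_For)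
  moreover have "\<forall>i<d. ?m (temp N i) = m (temp N i)" using m'(2) wf by (auto simp: at_head_def)
  moreover have "q + 7 + com_length c = q + com_length (For v x c)" by simp
  ultimately show ?thesis by metis
qed

end

lemma simulates_For: "simulates P N c \<Longrightarrow> simulates P N (For v x c)"
  by (rule simulatesI, rule compiled_loop.run_loop, rule compiled_loop.intro)

theorem simulates_com: "simulates P N c"
proof (induction c)
  case Skip
  then show ?case by (auto intro: simulatesI)
qed (simp_all add: simulates_Assign simulates_Store simulates_Output simulates_Seq simulates_If simulates_For)

definition boot :: "nat \<Rightarrow> nat \<Rightarrow> instr list" where
  "boot N D = [LoadC 1 (temp N D), Sub 1 1 0, Jz 1 4, Halt, LoadC N 0, LoadC (N + 1) 1, LoadC (N + 2) 0,
     Add (N + 3) 0 N, Jz (N + 3) 12, Add (N + 2) (N + 2) 0, Sub (N + 3) (N + 3) (N + 1), Jmp 8,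
     Add (N + 3) (N + 2) 0, Add (N + 3) (N + 3) (N + 1)]"

definition ram_program :: "nat \<Rightarrow> com \<Rightarrow> instr list" where
  "ram_program N c = boot N (com_temps c) @ compile_com N c 0 14"

definition initial_state :: "nat \<Rightarrow> nat set set \<Rightarrow> state \<Rightarrow> bool" where
  "initial_state n E s \<longleftrightarrow> vars s 0 = n \<and> arrays s = (\<lambda>_ _. 0) \<and> input_cells s = input_mem n E \<and>
     output_cells s = (\<lambda>_. 0)"

definition output_set :: "state \<Rightarrow> nat set" where
  "output_set s = {i. i < vars s 0 \<and> output_cells s i \<noteq> 0}"

lemma length_boot: "length (boot N D) = 14"
  by (simp add: boot_def)

lemma code_at_ram_program:
  "code_at (ram_program N c) 0 (boot N (com_temps c))"
  "code_at (ram_program N c) 14 (compile_com N c 0 14)"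
proof -
  have "code_at (ram_program N c) 0 (boot N (com_temps c) @ compile_com N c 0 14)"
    by (simp add: code_at_def ram_program_def)
  then show "code_at (ram_program N c) 0 (boot N (com_temps c))"
    "code_at (ram_program N c) 14 (compile_com N c 0 14)"
    by (simp_all add: code_at_append length_boot)
qed

lemma run_halted:
  assumes "halted P (run P t c)" "t \<le> t'"
  shows "run P t' c = run P t c"
proof -
  have "run P i d = d" if "halted P d" for i d
    by (induction i) (use that in \<open>auto simp: run_Suc step_def\<close>)
  from this[OF assms(1), of "t' - t"] show ?thesis
    using assms(2) by (simp flip: run_add)
qed

lemma input_mem_size: "input_mem n E 0 = n"
  by (simp add: input_mem_def)

lemma ram_program_halts_small:
  assumes "n < temp N (com_temps c)" "3 \<le> T"
  shows "ram_halts_within (ram_program N c) T n E"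
proof -
  let ?P = "ram_program N c"
  have "halted ?P (run ?P 3 (0, input_mem n E))"
    using code_at_ram_program(1)[of N c] assms(1) input_mem_size[of n E]
    by (simp add: boot_def code_at_Cons eval_nat_numeral run_Suc step_instr halted_def)
  with run_halted[OF this assms(2)] show ?thesis by (simp add: ram_halts_within_def)
qed

lemma run_squaring_loop:
  assumes code: "P ! 8 = Jz (N + 3) 12" "P ! 9 = Add (N + 2) (N + 2) 0"
      "P ! 10 = Sub (N + 3) (N + 3) (N + 1)" "P ! 11 = Jmp 8" "12 \<le> length P"
    and m: "m 0 = n" "m (N + 1) = 1" and N: "0 < N"
  shows "j \<le> n \<Longrightarrow>
    run P (4 * j) (8, m(N + 2 := 0, N + 3 := n)) = (8, m(N + 2 := j * n, N + 3 := n - j))"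
proof (induction j)
  case (Suc j)
  have "run P (4 * Suc j) (8, m(N + 2 := 0, N + 3 := n))
      = run P (Suc (Suc (Suc (Suc 0)))) (run P (4 * j) (8, m(N + 2 := 0, N + 3 := n)))"
    unfolding run_add[symmetric] by (rule arg_cong[where f = "\<lambda>t. run P t _"]) simp
  also have "\<dots> = run P (Suc (Suc (Suc (Suc 0)))) (8, m(N + 2 := j * n, N + 3 := n - j))"
    by (rule arg_cong[OF Suc.IH[OF Suc_leD[OF Suc.prems]]])
  also have "\<dots> = (8, m(N + 2 := Suc j * n, N + 3 := n - Suc j))"
    using code m Suc.prems N by (simp add: run_Suc step_instr fun_upd_twist algebra_simps)
  finally show ?case .
qed simp

lemma run_boot:
  assumes "temp N (com_temps c) \<le> n" "2 \<le> N"
  shows "\<exists>m s. run (ram_program N c) (4 * n + 10) (0, input_mem n E) = (14, m) \<and>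
    represents N m s \<and> initial_state n E s"
proof -
  define P m where "P = ram_program N c" and "m = (input_mem n E)(1 := 0, N := 0, N + 1 := 1)"
  note code = code_at_ram_program(1)[of N c, folded P_def]
  have loop_code: "P ! 8 = Jz (N + 3) 12" "P ! 9 = Add (N + 2) (N + 2) 0"
    "P ! 10 = Sub (N + 3) (N + 3) (N + 1)" "P ! 11 = Jmp 8" "14 \<le> length P"
    "P ! 12 = Add (N + 3) (N + 2) 0" "P ! 13 = Add (N + 3) (N + 3) (N + 1)"
    using code by (simp_all add: boot_def code_at_Cons eval_nat_numeral)
  have m: "m 0 = n" "m (N + 1) = 1" using assms input_mem_size by (simp_all add: m_def)
  have start: "run P 7 (0, input_mem n E) = (8, m(N + 2 := 0, N + 3 := n))"
    using code assms input_mem_size[of n E]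
    by (simp add: m_def boot_def code_at_Cons eval_nat_numeral run_Suc step_instr fun_upd_twist)
  have loop: "run P (4 * n) (8, m(N + 2 := 0, N + 3 := n)) = (8, m(N + 2 := n * n, N + 3 := 0))"
    using run_squaring_loop[of P N m n n] loop_code m assms by simp
  define m' where "m' = m(N + 2 := n * n, N + 3 := n * n + n + 1)"
  have "run P (4 * n + 10) (0, input_mem n E) = run P (7 + (4 * n + 3)) (0, input_mem n E)"
    by (rule arg_cong[where f = "\<lambda>t. run P t _"]) simp
  also have "\<dots> = (14, m')"
    unfolding run_add start loop using loop_code m assms
    by (simp add: m'_def run_Suc step_instr numeral_3_eq_3)
  finally have booted: "run P (4 * n + 10) (0, input_mem n E) = (14, m')" .
  define s where "s = State m' (\<lambda>_ _. 0) (input_mem n E) (\<lambda>_. 0)"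
  have "m' x = input_mem n E x" if "n < x" for x using that assms by (simp add: m'_def m_def)
  moreover have "input_mem n E (output_cell n i) = 0" "input_mem n E (array_cell n a x) = 0" for i a x
    by (simp_all add: input_mem_def output_cell_def array_cell_def)
  moreover have "m' 0 = n" "m' N = 0" "m' (N + 1) = 1" "m' (N + 2) = n * n" "m' (N + 3) = n * n + n + 1"
    using assms m by (simp_all add: m'_def, simp_all add: m_def)
  ultimately have "represents N m' s"
    using assms by (simp add: represents_def s_def less_output_cell less_array_cell)
  moreover have "initial_state n E s" using \<open>m' 0 = n\<close> by (simp add: initial_state_def s_def)
  ultimately show ?thesis using booted unfolding P_def by blast
qed

lemma ram_program_correct:
  assumes "temp N (com_temps c) \<le> n" "2 \<le> N" "wf_com N c"
  shows "\<exists>s. initial_state n E s \<and> (\<forall>T. 4 * n + 10 + steps c s \<le> T \<longrightarrow>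
    ram_halts_within (ram_program N c) T n E \<and>
    ram_output (ram_program N c) T n E = output_set (execute c s))"
proof -
  define P where "P = ram_program N c"
  obtain m s where boot: "run P (4 * n + 10) (0, input_mem n E) = (14, m)"
    and r: "represents N m s" and s: "initial_state n E s"
    using run_boot[OF assms(1,2)] unfolding P_def by blast
  have n: "vars s 0 = n" using s by (simp add: initial_state_def)
  obtain m' where m': "run P (steps c s) (14, m) = (14 + com_length c, m')"
    and r': "represents N m' (execute c s)"
    using simulatesD[OF simulates_com r assms(3) _ code_at_ram_program(2)] assms(1) n
    unfolding P_def by auto
  have run: "run P (4 * n + 10 + steps c s) (0, input_mem n E) = (14 + com_length c, m')"
    unfolding run_add[of P "4 * n + 10"] boot by (rule m')
  have halted: "halted P (14 + com_length c, m')"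
    by (simp add: halted_def P_def ram_program_def boot_def)
  have n': "vars (execute c s) 0 = n" using wf_com_size[OF assms(3), of s] n by simp
  have "ram_halts_within P T n E \<and> ram_output P T n E = output_set (execute c s)"
    if T: "4 * n + 10 + steps c s \<le> T" for T
  proof
    have final: "run P T (0, input_mem n E) = (14 + com_length c, m')"
      using run_halted[OF _ T] halted run by metis
    then show "ram_halts_within P T n E" using halted by (simp add: ram_halts_within_def)
    show "ram_output P T n E = output_set (execute c s)"
      using representsD(8)[OF r'] final n' by (auto simp: ram_output_def output_set_def output_cell_def)
  qed
  with s show ?thesis unfolding P_def by blast
qed

theorem ram_program_poly_time:
  assumes N: "2 \<le> N" and wf: "wf_com N c"
    and time: "\<And>n E s. initial_state n E s \<Longrightarrow> steps c s \<le> B n" "poly_bounded B"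
  shows "\<exists>C d. (\<forall>n E. ram_halts_within (ram_program N c) (C * (n + 1) ^ d) n E) \<and>
    (\<forall>n E. temp N (com_temps c) \<le> n \<longrightarrow>
      (\<exists>s. initial_state n E s \<and> ram_output (ram_program N c) (C * (n + 1) ^ d) n E = output_set (execute c s)))"
proof -
  have "poly_bounded (\<lambda>n. 4 * n + 10 + B n)" by (intro poly_bounded_intros time)
  then obtain C d where T: "\<And>n. 4 * n + 10 + B n \<le> C * (n + 1) ^ d"
    unfolding poly_bounded_def by blast
  have "ram_halts_within (ram_program N c) (C * (n + 1) ^ d) n E" for n E
  proof (cases "temp N (com_temps c) \<le> n")
    case True
    from ram_program_correct[OF True N wf] T time(1) show ?thesis by (meson add_left_mono order_trans)
  next
    case False
    then show ?thesis using T[of n] by (intro ram_program_halts_small) auto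
  qed
  moreover have "\<exists>s. initial_state n E s \<and> ram_output (ram_program N c) (C * (n + 1) ^ d) n E
      = output_set (execute c s)"
    if "temp N (com_temps c) \<le> n" for n E
    using ram_program_correct[OF that N wf] T time(1) by (meson add_left_mono order_trans)
  ultimately show ?thesis by blast
qed

section \<open>The clique search\<close>

definition adj :: "nat set set \<Rightarrow> nat \<Rightarrow> nat \<Rightarrow> bool" where
  "adj E u v \<longleftrightarrow> u \<noteq> v \<and> {u, v} \<in> E"

lemma adj_commute: "adj E u v \<longleftrightarrow> adj E v u"
  by (auto simp: adj_def insert_commute)

lemma adj_irrefl [simp]: "\<not> adj E u u"
  by (simp add: adj_def)

lemma is_clique_adj: "is_clique n E C \<Longrightarrow> u \<in> C \<Longrightarrow> v \<in> C \<Longrightarrow> u \<noteq> v \<Longrightarrow> adj E u v"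
  by (auto simp: is_clique_def adj_def)

definition common_nbrs :: "nat \<Rightarrow> nat set set \<Rightarrow> nat set \<Rightarrow> nat set" where
  "common_nbrs n E Q = {v. v < n \<and> (\<forall>q\<in>Q. adj E v q)}"

text \<open>Column i of the r-th power of the adjacency matrix on V centred at j / n, times n^r.\<close>

primrec scaled_power_column ::
    "nat \<Rightarrow> nat set set \<Rightarrow> nat set \<Rightarrow> nat \<Rightarrow> nat \<Rightarrow> nat \<Rightarrow> nat \<Rightarrow> int" where
  "scaled_power_column n E V j i 0 = (\<lambda>u. of_bool (u = i))"
| "scaled_power_column n E V j i (Suc r) =
     (\<lambda>u. \<Sum>v\<in>V. (int n * of_bool (adj E u v) - int j) * scaled_power_column n E V j i r v)"

definition level_set :: "nat \<Rightarrow> nat set set \<Rightarrow> nat set \<Rightarrow> nat \<Rightarrow> nat \<Rightarrow> nat \<Rightarrow> nat set" where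
  "level_set n E V j i l =
     {v \<in> V. scaled_power_column n E V j i n l \<le> scaled_power_column n E V j i n v}"

definition nearly_complete_to :: "nat \<Rightarrow> nat set set \<Rightarrow> nat \<Rightarrow> nat set \<Rightarrow> nat set" where
  "nearly_complete_to n E h T = {v. v < n \<and> h * card {x \<in> T. x \<noteq> v \<and> \<not> adj E v x} \<le> card T}"

text \<open>The bits of the code y say which endpoint of the next non-edge is deleted.\<close>

definition delete_endpoint :: "nat set set \<Rightarrow> nat \<times> nat \<Rightarrow> nat \<times> nat set \<Rightarrow> nat \<times> nat set" where
  "delete_endpoint E = (\<lambda>(u, v) (y, F). if u \<in> F \<and> v \<in> F \<and> u \<noteq> v \<and> \<not> adj E u v
     then (y div 2, F - {if odd y then v else u}) else (y, F))"

definition resolve :: "nat \<Rightarrow> nat set set \<Rightarrow> nat \<Rightarrow> nat set \<Rightarrow> nat set" where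
  "resolve n E y F = snd (fold (delete_endpoint E) (List.product [0..<n] [0..<n]) (y, F))"

text \<open>A guess g consists of t vertices of the planted clique, an approximation g t / n of the edge
  probability, a column, and the vertex at whose entry the column is cut.\<close>

definition candidate :: "nat \<Rightarrow> nat set set \<Rightarrow> nat \<Rightarrow> nat \<Rightarrow> (nat \<Rightarrow> nat) \<Rightarrow> nat set" where
  "candidate n E t h g = nearly_complete_to n E h
     (level_set n E (common_nbrs n E (g ` {..<t})) (g t) (g (t + 1)) (g (t + 2)))"

definition guessed_clique :: "nat \<Rightarrow> nat set set \<Rightarrow> nat \<Rightarrow> nat \<Rightarrow> (nat \<Rightarrow> nat) \<Rightarrow> nat \<Rightarrow> nat set" where
  "guessed_clique n E t h g y = resolve n E y (candidate n E t h g)"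

definition some_guess_optimal :: "nat \<Rightarrow> nat set set \<Rightarrow> nat \<Rightarrow> nat \<Rightarrow> nat \<Rightarrow> bool" where
  "some_guess_optimal n E t h Y \<longleftrightarrow> (\<exists>g y C. (\<forall>i<t + 3. g i < n) \<and> y < Y \<and>
     is_max_clique n E C \<and> card C \<le> card (guessed_clique n E t h g y))"

lemma delete_endpoint_subset: "snd (delete_endpoint E p yF) \<subseteq> snd yF"
  by (auto simp: delete_endpoint_def split: prod.splits)

lemma fold_delete_endpoint_subset: "snd (fold (delete_endpoint E) ps yF) \<subseteq> snd yF"
proof (induction ps arbitrary: yF)
  case (Cons p ps)
  then show ?case using delete_endpoint_subset[of E p yF] by fastforce
qed simp

lemma fold_delete_endpoint_adj:
  assumes "(u, v) \<in> set ps" "u \<in> snd (fold (delete_endpoint E) ps yF)"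
    "v \<in> snd (fold (delete_endpoint E) ps yF)" "u \<noteq> v"
  shows "adj E u v"
  using assms
proof (induction ps arbitrary: yF)
  case (Cons p ps)
  show ?case
  proof (cases "(u, v) \<in> set ps")
    case True
    then show ?thesis using Cons by auto
  next
    case False
    then have "p = (u, v)" using Cons.prems by auto
    then show ?thesis
      using Cons.prems fold_delete_endpoint_subset[of E ps "delete_endpoint E p yF"]
      by (cases yF) (auto simp: delete_endpoint_def split: if_splits)
  qed
qed simp

lemma resolve_subset: "resolve n E y F \<subseteq> F"
  using fold_delete_endpoint_subset[of E _ "(y, F)"] by (simp add: resolve_def)

lemma is_clique_resolve:
  assumes "F \<subseteq> {..<n}"
  shows "is_clique n E (resolve n E y F)"
  unfolding is_clique_def
proof (intro conjI ballI impI)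
  show "resolve n E y F \<subseteq> {..<n}" using resolve_subset assms by blast
  fix i j assume ij: "i \<in> resolve n E y F" "j \<in> resolve n E y F" "i \<noteq> j"
  then have "i < n" "j < n" using resolve_subset assms by blast+
  then have "adj E i j" using ij unfolding resolve_def by (intro fold_delete_endpoint_adj) auto
  then show "{i, j} \<in> E" by (simp add: adj_def)
qed

lemma fold_delete_endpoint_superset:
  assumes "is_clique n E C" "C \<subseteq> F" "finite F" "card (F - C) \<le> r"
  shows "\<exists>y<2 ^ r. C \<subseteq> snd (fold (delete_endpoint E) ps (y, F))"
  using assms(2-4)
proof (induction ps arbitrary: F r)
  case Nil
  then show ?case by (auto intro: exI[of _ 0])
next
  case (Cons p ps)
  obtain u v where p: "p = (u, v)" by (cases p)
  show ?case
  proof (cases "u \<in> F \<and> v \<in> F \<and> u \<noteq> v \<and> \<not> adj E u v")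
    case False
    then have "delete_endpoint E p (y, F) = (y, F)" for y by (auto simp: delete_endpoint_def p)
    then show ?thesis using Cons.IH[OF Cons.prems] by simp
  next
    case True
    define b where "b = (of_bool (u \<in> C) :: nat)"
    define z where "z = (if odd b then v else u)"
    have z: "z \<in> F" "z \<notin> C" using True is_clique_adj[OF assms(1)] by (auto simp: z_def b_def)
    have "card (F - {z} - C) < card (F - C)"
      using z Cons.prems(2) by (intro psubset_card_mono) auto
    then obtain r' where r': "r = Suc r'" "card (F - {z} - C) \<le> r'"
      using Cons.prems(3) by (cases r) auto
    obtain y where y: "y < 2 ^ r'" "C \<subseteq> snd (fold (delete_endpoint E) ps (y, F - {z}))"
      using Cons.IH[of "F - {z}" r'] r' z Cons.prems(1,2) by auto
    have "delete_endpoint E p (2 * y + b, F) = (y, F - {z})"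
      using True by (auto simp: delete_endpoint_def p z_def b_def)
    then show ?thesis using y r' by (intro exI[of _ "2 * y + b"]) (auto simp: b_def)
  qed
qed

lemma resolve_superset:
  "is_clique n E C \<Longrightarrow> C \<subseteq> F \<Longrightarrow> finite F \<Longrightarrow> card (F - C) \<le> r \<Longrightarrow> \<exists>y<2 ^ r. C \<subseteq> resolve n E y F"
  unfolding resolve_def by (rule fold_delete_endpoint_superset)

lemma is_max_clique_if_card_le:
  assumes "is_clique n E R" "is_max_clique n E C" "card C \<le> card R"
  shows "is_max_clique n E R"
  using assms by (auto simp: is_max_clique_def intro: order.trans)

section \<open>The program\<close>

definition Neg :: "expr \<Rightarrow> expr" where "Neg e = Minus (Num 1) e"
definition Conj :: "expr \<Rightarrow> expr \<Rightarrow> expr" where "Conj e e' = Neg (Plus (Neg e) (Neg e'))"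
definition Leq :: "expr \<Rightarrow> expr \<Rightarrow> expr" where "Leq e e' = Neg (Minus e e')"
definition Eql :: "expr \<Rightarrow> expr \<Rightarrow> expr" where "Eql e e' = Conj (Leq e e') (Leq e' e)"

lemma eval_tests [simp]:
  "eval (Neg e) s = of_bool (eval e s = 0)"
  "eval (Conj e e') s = of_bool (eval e s \<noteq> 0 \<and> eval e' s \<noteq> 0)"
  "eval (Leq e e') s = of_bool (eval e s \<le> eval e' s)"
  "eval (Eql e e') s = of_bool (eval e s = eval e' s)"
  by (auto simp: Neg_def Conj_def Leq_def Eql_def)

primrec Multiple :: "nat \<Rightarrow> expr \<Rightarrow> expr" where
  "Multiple 0 e = Num 0"
| "Multiple (Suc k) e = Plus e (Multiple k e)"

lemma eval_Multiple [simp]: "eval (Multiple k e) s = k * eval e s"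
  by (induction k) simp_all

lemma For_invariant:
  assumes "I 0 s"
    and "\<And>i s'. \<lbrakk>i < vars s x; agree_off (written (For v x c)) s s'; I i s'\<rbrakk> \<Longrightarrow>
      I (Suc i) (execute c (set_var v i s'))"
  shows "I (vars s x) (iterate_body v c (vars s x) s)"
proof -
  have "I i (iterate_body v c i s)" if "i \<le> vars s x" for i
    using that by (induction i) (use assms agree_off_iterate in auto)
  then show ?thesis by simp
qed

lemma state_eqI:
  "\<lbrakk>vars s = vars s'; arrays s = arrays s'; input_cells s = input_cells s';
    output_cells s = output_cells s'\<rbrakk> \<Longrightarrow> s = s'"
  by (rule state.expand) simp

lemma set_var_overwrite [simp]: "set_var v x (set_var v y s) = set_var v x s"
  by (rule state_eqI) simp_all

lemma execute_fill:
  assumes "\<And>i f. i < vars s x \<Longrightarrow> eval e (set_array a f (set_var v i s)) = g i"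
  shows "execute (For v x (Store a (Var v) e)) s =
    set_array a (\<lambda>i. if i < vars s x then g i else arrays s a i) (set_var v (vars s x) s)"
proof -
  let ?S = "\<lambda>i. iterate_body v (Store a (Var v) e) i s"
  have "set_var v j (?S i) = set_array a (\<lambda>i'. if i' < i then g i' else arrays s a i') (set_var v j s)"
    if "i \<le> vars s x" for i j
    using that
  proof (induction i arbitrary: j)
    case 0
    show ?case by (rule state_eqI) simp_all
  next
    case (Suc i)
    then show ?case using assms[of i] by (intro state_eqI) (auto simp: Suc.IH less_Suc_eq fun_eq_iff)
  qed
  then show ?thesis by (simp add: execute_For)
qed

lemma execute_sum:
  assumes "y \<noteq> v" "\<And>i z. i < vars s x \<Longrightarrow> eval e (set_var y z (set_var v i s)) = g i"
  shows "execute (For v x (Assign y (Plus (Var y) e))) s =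
    set_var y (vars s y + (\<Sum>i<vars s x. g i)) (set_var v (vars s x) s)"
proof -
  let ?S = "\<lambda>i. iterate_body v (Assign y (Plus (Var y) e)) i s"
  have "set_var v j (?S i) = set_var y (vars s y + (\<Sum>i'<i. g i')) (set_var v j s)"
    if "i \<le> vars s x" for i j
    using that
  proof (induction i arbitrary: j)
    case 0
    show ?case using assms(1) by (intro state_eqI) (auto simp: fun_eq_iff)
  next
    case (Suc i)
    then show ?case using assms by (intro state_eqI) (auto simp: Suc.IH)
  qed
  then show ?thesis by (simp add: execute_For)
qed

abbreviation (input) size_var :: nat where "size_var \<equiv> 0"
abbreviation (input) codes_var :: nat where "codes_var \<equiv> 2"
abbreviation (input) best_var :: nat where "best_var \<equiv> 3"
abbreviation (input) guess_var :: nat where "guess_var \<equiv> 4"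
abbreviation (input) code_var :: nat where "code_var \<equiv> 5"
abbreviation (input) rest_var :: nat where "rest_var \<equiv> 6"
abbreviation (input) round_var :: nat where "round_var \<equiv> 7"
abbreviation (input) u_var :: nat where "u_var \<equiv> 8"
abbreviation (input) v_var :: nat where "v_var \<equiv> 9"
abbreviation (input) repeat_var :: nat where "repeat_var \<equiv> 10"
abbreviation (input) acc_var :: nat where "acc_var \<equiv> 11"
abbreviation (input) count_var :: nat where "count_var \<equiv> 12"

abbreviation (input) offset_arr :: nat where "offset_arr \<equiv> 0"
abbreviation (input) half_arr :: nat where "half_arr \<equiv> 2"
abbreviation (input) parity_arr :: nat where "parity_arr \<equiv> 3"
abbreviation (input) guess_arr :: nat where "guess_arr \<equiv> 4"
abbreviation (input) common_arr :: nat where "common_arr \<equiv> 5"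
abbreviation (input) pos_arr :: nat where "pos_arr \<equiv> 6"
abbreviation (input) neg_arr :: nat where "neg_arr \<equiv> 7"
abbreviation (input) next_pos_arr :: nat where "next_pos_arr \<equiv> 8"
abbreviation (input) next_neg_arr :: nat where "next_neg_arr \<equiv> 9"
abbreviation (input) level_arr :: nat where "level_arr \<equiv> 10"
abbreviation (input) near_arr :: nat where "near_arr \<equiv> 11"
abbreviation (input) branch_arr :: nat where "branch_arr \<equiv> 12"

text \<open>The adjacency of u and v is read from the row of the larger one, which is not row 0. The offset
  of row u is (u - 1) n, since the readable part of the input begins with row 1.\<close>

definition Edge :: "expr \<Rightarrow> expr \<Rightarrow> expr" where
  "Edge e e' = Conj (Neg (Eql e e'))
     (Input (Plus (Elem offset_arr (Plus e (Minus e' e))) (Minus e (Minus e e'))))"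

primrec Common_nbr :: "nat \<Rightarrow> expr" where
  "Common_nbr 0 = Num 1"
| "Common_nbr (Suc i) = Conj (Edge (Var v_var) (Elem guess_arr (Num i))) (Common_nbr i)"

definition common_com :: "nat \<Rightarrow> com" where
  "common_com t = For v_var size_var (Store common_arr (Var v_var) (Common_nbr t))"

text \<open>The iterated vector is the difference of two arrays of natural numbers.\<close>

definition unit_vector_com :: "nat \<Rightarrow> com" where
  "unit_vector_com t =
     For v_var size_var (Store pos_arr (Var v_var) (Eql (Var v_var) (Elem guess_arr (Num (t + 1)))));;
     For v_var size_var (Store neg_arr (Var v_var) (Num 0))"

definition add_products_com :: "nat \<Rightarrow> nat \<Rightarrow> nat \<Rightarrow> com" where
  "add_products_com t a b = For repeat_var size_var (
     If (Edge (Var u_var) (Var v_var)) (Assign acc_var (Plus (Var acc_var) (Elem a (Var v_var)))) Skip;;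
     If (Leq (Elem guess_arr (Num t)) (Var repeat_var)) Skip
       (Assign acc_var (Plus (Var acc_var) (Elem b (Var v_var)))))"

definition row_product_com :: "nat \<Rightarrow> nat \<Rightarrow> nat \<Rightarrow> com" where
  "row_product_com t a b = Assign acc_var (Num 0);;
     For v_var size_var (If (Elem common_arr (Var v_var)) (add_products_com t a b) Skip)"

definition copy_com :: "nat \<Rightarrow> nat \<Rightarrow> com" where
  "copy_com a b = For v_var size_var (Store b (Var v_var) (Elem a (Var v_var)))"

definition products_com :: "nat \<Rightarrow> com" where
  "products_com t = For u_var size_var (
     row_product_com t pos_arr neg_arr;; Store next_pos_arr (Var u_var) (Var acc_var);;
     row_product_com t neg_arr pos_arr;; Store next_neg_arr (Var u_var) (Var acc_var))"

definition power_com :: "nat \<Rightarrow> com" where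
  "power_com t = For round_var size_var
     (products_com t;; copy_com next_pos_arr pos_arr;; copy_com next_neg_arr neg_arr)"

definition level_com :: "nat \<Rightarrow> com" where
  "level_com t = (let l = Elem guess_arr (Num (t + 2)) in For v_var size_var (Store level_arr (Var v_var)
     (Conj (Elem common_arr (Var v_var))
       (Leq (Plus (Elem pos_arr l) (Elem neg_arr (Var v_var))) (Plus (Elem pos_arr (Var v_var)) (Elem neg_arr l))))))"

definition count_com :: "nat \<Rightarrow> com" where
  "count_com a = Assign count_var (Num 0);;
     For v_var size_var (Assign count_var (Plus (Var count_var) (Elem a (Var v_var))))"

definition near_com :: "nat \<Rightarrow> com" where
  "near_com h = count_com level_arr;;
     For u_var size_var (Assign acc_var (Num 0);;
       For v_var size_var (Assign acc_var (Plus (Var acc_var) (Conj (Elem level_arr (Var v_var))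
         (Conj (Neg (Eql (Var v_var) (Var u_var))) (Neg (Edge (Var u_var) (Var v_var)))))));;
       Store near_arr (Var u_var) (Leq (Multiple h (Var acc_var)) (Var count_var)))"

definition delete_com :: com where
  "delete_com = If (Conj (Elem branch_arr (Var u_var)) (Conj (Elem branch_arr (Var v_var))
       (Conj (Neg (Eql (Var u_var) (Var v_var))) (Neg (Edge (Var u_var) (Var v_var))))))
     (If (Elem parity_arr (Var rest_var)) (Store branch_arr (Var v_var) (Num 0))
         (Store branch_arr (Var u_var) (Num 0));;
      Assign rest_var (Elem half_arr (Var rest_var))) Skip"

definition resolve_com :: com where
  "resolve_com = Assign rest_var (Var code_var);; copy_com near_arr branch_arr;;
     For u_var size_var (For v_var size_var delete_com)"

definition record_com :: com where
  "record_com = count_com branch_arr;; If (Leq (Var count_var) (Var best_var)) Skip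
     (Assign best_var (Var count_var);; For v_var size_var (Output (Var v_var) (Elem branch_arr (Var v_var))))"

definition candidate_com :: "nat \<Rightarrow> nat \<Rightarrow> com" where
  "candidate_com t h = common_com t;; unit_vector_com t;; power_com t;; level_com t;; near_com h"

definition try_guess_com :: "nat \<Rightarrow> nat \<Rightarrow> com" where
  "try_guess_com t h = candidate_com t h;; For code_var codes_var (resolve_com;; record_com)"

primrec guess_loops :: "nat \<Rightarrow> com \<Rightarrow> com" where
  "guess_loops 0 c = c"
| "guess_loops (Suc m) c =
     For guess_var size_var (Store guess_arr (Num m) (Var guess_var);; guess_loops m c)"

primrec size_power_com :: "nat \<Rightarrow> com" where
  "size_power_com 0 = Assign codes_var (Num 1)"
| "size_power_com (Suc a) = size_power_com a;; Assign acc_var (Num 0);;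
     For v_var size_var (Assign acc_var (Plus (Var acc_var) (Var codes_var)));; Assign codes_var (Var acc_var)"

definition offsets_com :: com where
  "offsets_com = Assign acc_var (Num 0);;
     For u_var size_var (Store offset_arr (Var u_var) (Minus (Var acc_var) (Var size_var));;
       Assign acc_var (Plus (Var acc_var) (Var size_var)))"

definition halves_com :: com where
  "halves_com = For u_var codes_var (
     Store half_arr (Plus (Var u_var) (Num 1))
       (Plus (Elem half_arr (Var u_var)) (Elem parity_arr (Var u_var)));;
     Store parity_arr (Plus (Var u_var) (Num 1)) (Neg (Elem parity_arr (Var u_var))))"

definition prepare_com :: "nat \<Rightarrow> com" where
  "prepare_com a = Assign best_var (Num 0);; offsets_com;; size_power_com a"

definition search_com :: "nat \<Rightarrow> nat \<Rightarrow> com" where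
  "search_com t h = halves_com;; guess_loops (t + 3) (try_guess_com t h)"

lemma written_coms:
  "written (common_com t) = {VarLoc v_var, ArrayLoc common_arr}"
  "written (unit_vector_com t) = {VarLoc v_var, ArrayLoc pos_arr, ArrayLoc neg_arr}"
  "written (add_products_com t a b) = {VarLoc repeat_var, VarLoc acc_var}"
  "written (row_product_com t a b) = {VarLoc v_var, VarLoc repeat_var, VarLoc acc_var}"
  "written (copy_com a b) = {VarLoc v_var, ArrayLoc b}"
  "written (products_com t) = {VarLoc u_var, VarLoc v_var, VarLoc repeat_var, VarLoc acc_var,
     ArrayLoc next_pos_arr, ArrayLoc next_neg_arr}"
  "written (power_com t) = {VarLoc round_var, VarLoc u_var, VarLoc v_var, VarLoc repeat_var, VarLoc acc_var,
     ArrayLoc next_pos_arr, ArrayLoc next_neg_arr, ArrayLoc pos_arr, ArrayLoc neg_arr}"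
  "written (level_com t) = {VarLoc v_var, ArrayLoc level_arr}"
  "written (count_com a) = {VarLoc v_var, VarLoc count_var}"
  "written (near_com h) = {VarLoc u_var, VarLoc v_var, VarLoc acc_var, VarLoc count_var, ArrayLoc near_arr}"
  "written delete_com = {VarLoc rest_var, ArrayLoc branch_arr}"
  "written resolve_com = {VarLoc u_var, VarLoc v_var, VarLoc rest_var, ArrayLoc branch_arr}"
  "written record_com = {VarLoc v_var, VarLoc count_var, VarLoc best_var, OutputLoc}"
  "written (candidate_com t h) = {VarLoc round_var, VarLoc u_var, VarLoc v_var, VarLoc repeat_var, VarLoc acc_var,
     VarLoc count_var, ArrayLoc common_arr, ArrayLoc pos_arr, ArrayLoc neg_arr, ArrayLoc next_pos_arr,
     ArrayLoc next_neg_arr, ArrayLoc level_arr, ArrayLoc near_arr}"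
  "written (try_guess_com t h) = {VarLoc code_var, VarLoc round_var, VarLoc u_var, VarLoc v_var,
     VarLoc repeat_var, VarLoc acc_var, VarLoc count_var, VarLoc rest_var, VarLoc best_var, OutputLoc,
     ArrayLoc common_arr, ArrayLoc pos_arr, ArrayLoc neg_arr, ArrayLoc next_pos_arr,
     ArrayLoc next_neg_arr, ArrayLoc level_arr, ArrayLoc near_arr, ArrayLoc branch_arr}"
  by (auto simp: common_com_def unit_vector_com_def add_products_com_def row_product_com_def copy_com_def
      products_com_def power_com_def level_com_def Let_def count_com_def near_com_def delete_com_def
      resolve_com_def record_com_def candidate_com_def try_guess_com_def)

definition program_env :: "nat \<Rightarrow> nat set set \<Rightarrow> nat \<Rightarrow> state \<Rightarrow> bool" where
  "program_env n E Y s \<longleftrightarrow> vars s size_var = n \<and> vars s codes_var = Y \<and>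
     (\<forall>u<n. arrays s offset_arr u = (u - 1) * n) \<and>
     (\<forall>y\<le>Y. arrays s half_arr y = y div 2 \<and> arrays s parity_arr y = y mod 2) \<and> input_cells s = input_mem n E"

definition env_locations :: "location set" where
  "env_locations = {VarLoc size_var, VarLoc codes_var, ArrayLoc offset_arr, ArrayLoc half_arr, ArrayLoc parity_arr}"

lemma program_env_agree:
  "agree_off L s s' \<Longrightarrow> L \<inter> env_locations = {} \<Longrightarrow> program_env n E Y s' \<longleftrightarrow> program_env n E Y s"
  by (auto simp: program_env_def env_locations_def agree_off_def)

lemma program_env_execute:
  "written c \<inter> env_locations = {} \<Longrightarrow> program_env n E Y (execute c s) \<longleftrightarrow> program_env n E Y s"
  using agree_off_execute by (rule program_env_agree)

lemma program_env_updates [simp]: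
  "v \<notin> {size_var, codes_var} \<Longrightarrow> program_env n E Y (set_var v x s) \<longleftrightarrow> program_env n E Y s"
  "a \<notin> {offset_arr, half_arr, parity_arr} \<Longrightarrow> program_env n E Y (set_array a f s) \<longleftrightarrow> program_env n E Y s"
  by (simp_all add: program_env_def)

lemma program_env_size [simp]: "program_env n E Y s \<Longrightarrow> vars s 0 = n"
  by (simp add: program_env_def)

definition encodes :: "nat \<Rightarrow> (nat \<Rightarrow> nat) \<Rightarrow> nat set \<Rightarrow> bool" where
  "encodes n f A \<longleftrightarrow> (\<forall>v<n. f v = of_bool (v \<in> A))"

lemma encodesD: "encodes n f A \<Longrightarrow> v < n \<Longrightarrow> f v = of_bool (v \<in> A)"
  by (simp add: encodes_def)

lemma input_mem_entry:
  assumes "u < n" "v < n"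
  shows "input_mem n E (u * n + v + 1) = of_bool (adj E u v)"
proof -
  have "u * n + v < Suc u * n" using assms by simp
  also have "\<dots> \<le> n * n" using assms by (intro mult_le_mono1) simp
  finally have "u * n + v < n * n" .
  moreover have "(u * n + v) div n = u" "(u * n + v) mod n = v" using assms by auto
  ultimately show ?thesis by (auto simp: input_mem_def adj_def)
qed

lemma eval_Edge [simp]:
  assumes env: "program_env n E Y s" and u: "eval e s < n" and v: "eval e' s < n"
  shows "eval (Edge e e') s = of_bool (adj E (eval e s) (eval e' s))"
proof (cases "eval e s = eval e' s")
  case True
  then show ?thesis by (simp add: Edge_def)
next
  case False
  define x y where "x = max (eval e s) (eval e' s)" and "y = min (eval e s) (eval e' s)"
  have xy: "x < n" "y < n" "0 < x" using False u v by (auto simp: x_def y_def)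
  have "x * n = (x - 1) * n + n" using xy(3) by (cases x) auto
  moreover have "x * n + n \<le> n * n" using mult_le_mono1[of "Suc x" n n] xy(1) by simp
  ultimately have "readable n ((x - 1) * n + y) = x * n + y + 1"
    using xy(2) unfolding readable_def by linarith
  moreover have "arrays s offset_arr x = (x - 1) * n" "vars s 0 = n" "input_cells s = input_mem n E"
    using env xy(1) unfolding program_env_def by blast+
  ultimately have "input_cells s (readable (vars s 0) (arrays s offset_arr x + y)) = of_bool (adj E x y)"
    using input_mem_entry[OF xy(1,2)] by simp
  moreover have "adj E x y = adj E (eval e s) (eval e' s)"
    by (auto simp: x_def y_def max_def min_def adj_commute)
  moreover have "eval e s + (eval e' s - eval e s) = x" "eval e s - (eval e s - eval e' s) = y"
    by (simp_all add: x_def y_def max_def min_def)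
  ultimately show ?thesis using False by (simp add: Edge_def)
qed

lemma eval_Common_nbr:
  assumes "program_env n E Y s" "vars s v_var < n" "\<And>i. i < t \<Longrightarrow> arrays s guess_arr i < n"
  shows "eval (Common_nbr t) s = of_bool (\<forall>i<t. adj E (vars s v_var) (arrays s guess_arr i))"
  using assms(3) by (induction t) (auto simp: eval_Edge[OF assms(1)] assms(2) less_Suc_eq)

lemma execute_common_com:
  assumes "program_env n E Y s" "\<And>i. i < t \<Longrightarrow> arrays s guess_arr i < n"
  shows "encodes n (arrays (execute (common_com t) s) common_arr)
      (common_nbrs n E (arrays s guess_arr ` {..<t}))"
proof -
  have "eval (Common_nbr t) (set_array common_arr f (set_var v_var v s))
      = of_bool (\<forall>i<t. adj E v (arrays s guess_arr i))" if "v < n" for v f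
    using eval_Common_nbr[of n E Y "set_array common_arr f (set_var v_var v s)" t] assms that by simp
  then have "execute (common_com t) s = set_array common_arr
      (\<lambda>v. if v < vars s size_var then of_bool (\<forall>i<t. adj E v (arrays s guess_arr i)) else arrays s common_arr v)
      (set_var v_var (vars s size_var) s)"
    unfolding common_com_def using assms(1) by (intro execute_fill) simp
  then show ?thesis using assms(1) by (auto simp: encodes_def common_nbrs_def)
qed

lemma execute_unit_vector_com:
  fixes t :: nat
  assumes "program_env n E Y s" "v < n"
  defines "s' \<equiv> execute (unit_vector_com t) s"
  shows "int (arrays s' pos_arr v) - int (arrays s' neg_arr v) = of_bool (v = arrays s guess_arr (t + 1))"
proof -
  let ?c = "For v_var size_var (Store pos_arr (Var v_var) (Eql (Var v_var) (Elem guess_arr (Num (t + 1)))))"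
  have "execute ?c s = set_array pos_arr
      (\<lambda>v. if v < vars s size_var then of_bool (v = arrays s guess_arr (t + 1)) else arrays s pos_arr v)
      (set_var v_var (vars s size_var) s)"
    by (rule execute_fill) simp
  moreover have "execute (For v_var size_var (Store neg_arr (Var v_var) (Num 0))) s1 = set_array neg_arr
      (\<lambda>v. if v < vars s1 size_var then 0 else arrays s1 neg_arr v) (set_var v_var (vars s1 size_var) s1)" for s1
    by (rule execute_fill) simp
  ultimately show ?thesis using assms(1,2) by (simp add: s'_def unit_vector_com_def)
qed

lemma vars_execute_add_products_com:
  assumes env: "program_env n E Y s" and "vars s u_var < n" "vars s v_var < n" "arrays s guess_arr t \<le> n"
  shows "vars (execute (add_products_com t a b) s) acc_var = vars s acc_var +
    (n * of_bool (adj E (vars s u_var) (vars s v_var)) * arrays s a (vars s v_var) +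
     arrays s guess_arr t * arrays s b (vars s v_var))"
proof -
  let ?e = "of_bool (adj E (vars s u_var) (vars s v_var)) :: nat" and ?j = "arrays s guess_arr t"
  define I where "I i s' \<longleftrightarrow> vars s' acc_var = vars s acc_var +
    (i * ?e * arrays s a (vars s v_var) + min i ?j * arrays s b (vars s v_var))" for i s'
  let ?c = "If (Edge (Var u_var) (Var v_var)) (Assign acc_var (Plus (Var acc_var) (Elem a (Var v_var)))) Skip;;
     If (Leq (Elem guess_arr (Num t)) (Var repeat_var)) Skip
       (Assign acc_var (Plus (Var acc_var) (Elem b (Var v_var))))"
  have "I (vars s size_var) (iterate_body repeat_var ?c (vars s size_var) s)"
  proof (rule For_invariant)
    fix i s'
    assume agree: "agree_off (written (For repeat_var size_var ?c)) s s'" and I: "I i s'"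
    let ?s = "set_var repeat_var i s'"
    have env': "program_env n E Y ?s"
      using program_env_agree[OF agree] env by (simp add: env_locations_def)
    have same: "vars s' u_var = vars s u_var" "vars s' v_var = vars s v_var" "arrays s' = arrays s"
      using agree by (auto simp: agree_off_def)
    have "eval (Edge (Var u_var) (Var v_var)) ?s = ?e"
      using eval_Edge[OF env', of "Var u_var" "Var v_var"] assms(2,3) same by simp
    then show "I (Suc i) (execute ?c ?s)"
      using I same by (auto simp: I_def min_def Suc_le_eq not_less_eq_eq)
  qed (simp add: I_def)
  then show ?thesis using env assms(4) by (simp add: add_products_com_def execute_For I_def)
qed

definition row_product :: "nat \<Rightarrow> nat set set \<Rightarrow> nat set \<Rightarrow> nat \<Rightarrow> (nat \<Rightarrow> nat) \<Rightarrow> (nat \<Rightarrow> nat) \<Rightarrow> nat \<Rightarrow> nat" where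
  "row_product n E V j f g u = (\<Sum>v\<in>V. n * of_bool (adj E u v) * f v + j * g v)"

lemma vars_execute_row_product_com:
  assumes env: "program_env n E Y s" and u: "vars s u_var < n" and j: "arrays s guess_arr t \<le> n"
    and V: "encodes n (arrays s common_arr) V" "V \<subseteq> {..<n}"
  shows "vars (execute (row_product_com t a b) s) acc_var =
    row_product n E V (arrays s guess_arr t) (arrays s a) (arrays s b) (vars s u_var)"
proof -
  let ?s = "set_var acc_var 0 s" and ?c = "If (Elem common_arr (Var v_var)) (add_products_com t a b) Skip"
  define p where "p v = n * of_bool (adj E (vars s u_var) v) * arrays s a v + arrays s guess_arr t * arrays s b v" for v
  define I where "I i s' \<longleftrightarrow> vars s' acc_var = (\<Sum>v\<in>V \<inter> {..<i}. p v)" for i s'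
  have "I (vars ?s size_var) (iterate_body v_var ?c (vars ?s size_var) ?s)"
  proof (rule For_invariant)
    fix i s'
    assume i: "i < vars ?s size_var" and agree: "agree_off (written (For v_var size_var ?c)) ?s s'"
      and I: "I i s'"
    let ?s' = "set_var v_var i s'"
    have "program_env n E Y s'"
      using program_env_agree[OF agree] env by (simp add: env_locations_def written_coms)
    then have env': "program_env n E Y ?s'" by simp
    have same: "vars s' u_var = vars s u_var" "arrays s' = arrays s"
      using agree by (auto simp: agree_off_def written_coms)
    have "V \<inter> {..<Suc i} = (if i \<in> V then insert i (V \<inter> {..<i}) else V \<inter> {..<i})"
      by (auto simp: less_Suc_eq)
    then have step: "(\<Sum>v\<in>V \<inter> {..<Suc i}. p v) = of_bool (i \<in> V) * p i + (\<Sum>v\<in>V \<inter> {..<i}. p v)"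
      by simp
    show "I (Suc i) (execute ?c ?s')"
      using I i env same u j encodesD[OF V(1), of i] vars_execute_add_products_com[OF env']
      unfolding I_def step by (simp add: p_def)
  qed (simp add: I_def)
  moreover have "V \<inter> {..<n} = V" using V(2) by blast
  ultimately show ?thesis
    using env by (simp add: row_product_com_def execute_For I_def row_product_def p_def)
qed

lemma execute_copy_com:
  "execute (copy_com a b) s = set_array b (\<lambda>i. if i < vars s size_var then arrays s a i else arrays s b i)
    (set_var v_var (vars s size_var) s)" if "a \<noteq> b"
  unfolding copy_com_def by (rule execute_fill) (use that in simp)

lemma execute_products_com:
  fixes t :: nat
  assumes env: "program_env n E Y s" and j: "arrays s guess_arr t \<le> n"
    and V: "encodes n (arrays s common_arr) V" "V \<subseteq> {..<n}"
  defines "s' \<equiv> execute (products_com t) s"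
  shows "\<forall>u<n. arrays s' next_pos_arr u = row_product n E V (arrays s guess_arr t) (arrays s pos_arr) (arrays s neg_arr) u \<and>
    arrays s' next_neg_arr u = row_product n E V (arrays s guess_arr t) (arrays s neg_arr) (arrays s pos_arr) u"
proof -
  define p where "p f g = row_product n E V (arrays s guess_arr t) f g" for f g
  define I where "I i s' \<longleftrightarrow> (\<forall>u<i. arrays s' next_pos_arr u = p (arrays s pos_arr) (arrays s neg_arr) u \<and>
    arrays s' next_neg_arr u = p (arrays s neg_arr) (arrays s pos_arr) u)" for i s'
  let ?r = "row_product_com t pos_arr neg_arr" and ?r' = "row_product_com t neg_arr pos_arr"
  let ?c = "?r;; Store next_pos_arr (Var u_var) (Var acc_var);; ?r';; Store next_neg_arr (Var u_var) (Var acc_var)"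
  have "I (vars s size_var) (iterate_body u_var ?c (vars s size_var) s)"
  proof (rule For_invariant)
    fix i s'
    assume i: "i < vars s size_var" and agree: "agree_off (written (For u_var size_var ?c)) s s'"
      and I: "I i s'"
    define s1 where "s1 = set_var u_var i s'"
    define s2 where "s2 = execute (Store next_pos_arr (Var u_var) (Var acc_var)) (execute ?r s1)"
    have "program_env n E Y s'"
      using program_env_agree[OF agree] env by (simp add: env_locations_def written_coms)
    then have env1: "program_env n E Y s1" by (simp add: s1_def)
    then have env2: "program_env n E Y s2"
      by (simp add: s2_def program_env_execute env_locations_def written_coms)
    have same: "arrays s1 a = arrays s a" if "a \<notin> {next_pos_arr, next_neg_arr}" for a
      using agree that by (auto simp: s1_def agree_off_def written_coms)
    have r: "vars (execute ?r s1) acc_var = p (arrays s pos_arr) (arrays s neg_arr) i"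
      using vars_execute_row_product_com[OF env1, of t V pos_arr neg_arr] i env j V same
      by (simp add: s1_def p_def)
    have arrays2: "arrays s2 = (arrays s1)(next_pos_arr := (arrays s1 next_pos_arr)(i := p (arrays s pos_arr) (arrays s neg_arr) i))"
      using r by (simp add: s2_def execute_unchanged written_coms s1_def fun_eq_iff)
    have u2: "vars s2 u_var = i" by (simp add: s2_def execute_unchanged written_coms s1_def)
    have r': "vars (execute ?r' s2) acc_var = p (arrays s neg_arr) (arrays s pos_arr) i"
      using vars_execute_row_product_com[OF env2, of t V neg_arr pos_arr] i env j V same u2 arrays2
      by (simp add: p_def)
    have body_eq: "execute ?c s1 = execute (Store next_neg_arr (Var u_var) (Var acc_var)) (execute ?r' s2)"
      by (simp add: s2_def)
    have "arrays (execute ?c s1) = (arrays s2)(next_neg_arr := (arrays s2 next_neg_arr)(i := p (arrays s neg_arr) (arrays s pos_arr) i))"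
      unfolding body_eq using r' u2 by (simp add: execute_unchanged written_coms fun_eq_iff)
    then show "I (Suc i) (execute ?c (set_var u_var i s'))"
      using I arrays2 unfolding s1_def[symmetric] I_def by (simp add: less_Suc_eq) (simp add: s1_def)
  qed (simp add: I_def)
  then show ?thesis using env by (simp add: s'_def products_com_def execute_For I_def p_def)
qed

lemma row_product_diff:
  "int (row_product n E V j f g u) - int (row_product n E V j g f u) =
    (\<Sum>v\<in>V. (int n * of_bool (adj E u v) - int j) * (int (f v) - int (g v)))"
  by (simp add: row_product_def sum_subtractf[symmetric] algebra_simps del: sum_subtractf)

lemma execute_power_com:
  assumes env: "program_env n E Y s" and j: "arrays s guess_arr t \<le> n"
    and V: "encodes n (arrays s common_arr) V" "V \<subseteq> {..<n}"
    and init: "\<And>v. v < n \<Longrightarrow> int (arrays s pos_arr v) - int (arrays s neg_arr v) = of_bool (v = i)"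
      and u: "u < n"
  shows "int (arrays (execute (power_com t) s) pos_arr u) - int (arrays (execute (power_com t) s) neg_arr u) =
    scaled_power_column n E V (arrays s guess_arr t) i n u"
proof -
  define I where "I r s' \<longleftrightarrow> (\<forall>u<n. int (arrays s' pos_arr u) - int (arrays s' neg_arr u) =
    scaled_power_column n E V (arrays s guess_arr t) i r u)" for r s'
  let ?c = "products_com t;; copy_com next_pos_arr pos_arr;; copy_com next_neg_arr neg_arr"
  have "I (vars s size_var) (iterate_body round_var ?c (vars s size_var) s)"
  proof (rule For_invariant)
    show "I 0 s" using init by (simp add: I_def)
  next
    fix r s'
    assume agree: "agree_off (written (For round_var size_var ?c)) s s'" and I: "I r s'"
    define s1 where "s1 = set_var round_var r s'"
    have "program_env n E Y s'"
      using program_env_agree[OF agree] env by (simp add: env_locations_def written_coms)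
    then have env1: "program_env n E Y s1" by (simp add: s1_def)
    have same: "arrays s1 guess_arr = arrays s guess_arr" "arrays s1 common_arr = arrays s common_arr"
      using agree by (auto simp: s1_def agree_off_def written_coms)
    define s2 where "s2 = execute (products_com t) s1"
    have n2: "vars s2 0 = n" using env1 by (simp add: s2_def execute_unchanged written_coms)
    have next_vectors: "arrays s2 next_pos_arr u
        = row_product n E V (arrays s guess_arr t) (arrays s1 pos_arr) (arrays s1 neg_arr) u"
      "arrays s2 next_neg_arr u = row_product n E V (arrays s guess_arr t) (arrays s1 neg_arr)
          (arrays s1 pos_arr) u"
      if "u < n" for u
      using execute_products_com[OF env1, of t V] j V that unfolding same s2_def by simp_all
    have "int (arrays (execute ?c s1) pos_arr u) - int (arrays (execute ?c s1) neg_arr u) =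
        scaled_power_column n E V (arrays s guess_arr t) i (Suc r) u" if u: "u < n" for u
    proof -
      have "int (arrays (execute ?c s1) pos_arr u) - int (arrays (execute ?c s1) neg_arr u) =
        (\<Sum>v\<in>V. (int n * of_bool (adj E u v) - int (arrays s guess_arr t)) *
          (int (arrays s1 pos_arr v) - int (arrays s1 neg_arr v)))"
        using u n2 by (simp add: s2_def[symmetric] execute_copy_com next_vectors row_product_diff)
      also have "\<dots> = scaled_power_column n E V (arrays s guess_arr t) i (Suc r) u"
        using I V(2) by (auto simp: I_def s1_def intro!: sum.cong)
      finally show ?thesis .
    qed
    then show "I (Suc r) (execute ?c (set_var round_var r s'))"
      unfolding I_def s1_def by blast
  qed
  then show ?thesis using env u by (simp add: power_com_def execute_For I_def)
qed

lemma execute_level_com: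
  assumes env: "program_env n E Y s" and V: "encodes n (arrays s common_arr) V" "V \<subseteq> {..<n}"
    and l: "arrays s guess_arr (t + 2) < n"
    and f: "\<And>v. v < n \<Longrightarrow> int (arrays s pos_arr v) - int (arrays s neg_arr v) = f v"
  shows "encodes n (arrays (execute (level_com t) s) level_arr)
      {v \<in> V. f (arrays s guess_arr (t + 2)) \<le> f v}"
proof -
  let ?l = "arrays s guess_arr (t + 2)"
  have "arrays s pos_arr ?l + arrays s neg_arr v \<le> arrays s pos_arr v + arrays s neg_arr ?l \<longleftrightarrow> f ?l \<le> f v"
    if "v < n" for v
    using f[OF l] f[OF that] by linarith
  then have "execute (level_com t) s = set_array level_arr
      (\<lambda>v. if v < vars s size_var then of_bool (v \<in> V \<and> f ?l \<le> f v) else arrays s level_arr v)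
      (set_var v_var (vars s size_var) s)"
    unfolding level_com_def Let_def using env encodesD[OF V(1)] by (intro execute_fill) auto
  then show ?thesis using env by (simp add: encodes_def)
qed

lemma execute_count_com:
  assumes "program_env n E Y s" "encodes n (arrays s a) A" "A \<subseteq> {..<n}"
  shows "execute (count_com a) s = set_var count_var (card A) (set_var v_var n s)"
proof -
  have "execute (For v_var size_var (Assign count_var (Plus (Var count_var) (Elem a (Var v_var))))) (set_var count_var 0 s)
      = set_var count_var (\<Sum>v<n. of_bool (v \<in> A)) (set_var v_var n (set_var count_var 0 s))"
    using assms(1) encodesD[OF assms(2)] by (subst execute_sum[where g = "\<lambda>v. of_bool (v \<in> A)"]) auto
  then show ?thesis
    using assms(3) by (intro state_eqI) (auto simp: count_com_def fun_eq_iff Int_absorb1)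
qed

lemma execute_near_com:
  assumes env: "program_env n E Y s" and T: "encodes n (arrays s level_arr) T" "T \<subseteq> {..<n}"
  shows "encodes n (arrays (execute (near_com h) s) near_arr) (nearly_complete_to n E h T)"
proof -
  define non where "non u = {x \<in> T. x \<noteq> u \<and> \<not> adj E u x}" for u
  define I where "I i s' \<longleftrightarrow> (\<forall>u<i. arrays s' near_arr u = of_bool (h * card (non u) \<le> card T))" for i s'
  let ?e = "Conj (Elem level_arr (Var v_var)) (Conj (Neg (Eql (Var v_var) (Var u_var)))
      (Neg (Edge (Var u_var) (Var v_var))))"
  let ?count = "For v_var size_var (Assign acc_var (Plus (Var acc_var) ?e))"
  let ?c = "Assign acc_var (Num 0);; ?count;; Store near_arr (Var u_var)
      (Leq (Multiple h (Var acc_var)) (Var count_var))"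
  let ?s = "execute (count_com level_arr) s"
  have count: "?s = set_var count_var (card T) (set_var v_var n s)" using execute_count_com[OF env T] .
  then have env0: "program_env n E Y ?s" using env by simp
  have "I (vars ?s size_var) (iterate_body u_var ?c (vars ?s size_var) ?s)"
  proof (rule For_invariant)
    fix i s'
    assume i: "i < vars ?s size_var" and agree: "agree_off (written (For u_var size_var ?c)) ?s s'"
      and I: "I i s'"
    define s1 where "s1 = set_var acc_var 0 (set_var u_var i s')"
    have "program_env n E Y s'" using program_env_agree[OF agree] env0 by (simp add: env_locations_def)
    then have env1: "program_env n E Y s1" by (simp add: s1_def)
    have i': "i < n" using i env0 by simp
    have same: "arrays s1 level_arr = arrays s level_arr" "vars s1 count_var = card T" "vars s1 u_var = i"
      using agree count by (auto simp: s1_def agree_off_def)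
    have "eval ?e (set_var acc_var z (set_var v_var v s1)) = of_bool (v \<in> non i)" if "v < n" for v z
      using eval_Edge[of n E Y "set_var acc_var z (set_var v_var v s1)" "Var u_var" "Var v_var"] env1
        same i' that encodesD[OF T(1)] by (auto simp: non_def)
    then have "execute ?count s1 = set_var acc_var (vars s1 acc_var + (\<Sum>v<n. of_bool (v \<in> non i)))
        (set_var v_var n s1)"
      using env1 by (subst execute_sum[where g = "\<lambda>v. of_bool (v \<in> non i)"]) auto
    also have "(\<Sum>v<n. of_bool (v \<in> non i)) = card (non i)"
    proof -
      have "non i \<subseteq> {..<n}" using T(2) by (auto simp: non_def)
      then show ?thesis by (simp add: Int_absorb1)
    qed
    finally have "execute ?count s1 = set_var acc_var (card (non i)) (set_var v_var n s1)"
      by (simp add: s1_def)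
    then have "execute ?c (set_var u_var i s') =
        set_array near_arr ((arrays s' near_arr)(i := of_bool (h * card (non i) \<le> card T)))
        (set_var acc_var (card (non i)) (set_var v_var n s1))"
      using same by (simp add: s1_def[symmetric]) (simp add: s1_def)
    then show "I (Suc i) (execute ?c (set_var u_var i s'))" using I by (simp add: I_def less_Suc_eq)
  qed (simp add: I_def)
  then show ?thesis using env0
    by (simp add: near_com_def execute_For I_def encodes_def nearly_complete_to_def non_def)
qed

definition resolving :: "nat \<Rightarrow> nat \<Rightarrow> state \<Rightarrow> nat \<times> nat set \<Rightarrow> bool" where
  "resolving n Y s = (\<lambda>(y, F). vars s rest_var = y \<and> y \<le> Y \<and> encodes n (arrays s branch_arr) F)"

lemma execute_delete_com:
  assumes env: "program_env n E Y s" and uv: "vars s u_var < n" "vars s v_var < n"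
    and R: "resolving n Y s yF"
  shows "resolving n Y (execute delete_com s) (delete_endpoint E (vars s u_var, vars s v_var) yF)"
proof -
  obtain y F where yF: "yF = (y, F)" by (cases yF)
  have s: "vars s rest_var = y" "y \<le> Y" "\<And>v. v < n \<Longrightarrow> arrays s branch_arr v = of_bool (v \<in> F)"
    using R by (auto simp: resolving_def yF encodes_def)
  have tables: "arrays s half_arr y = y div 2" "arrays s parity_arr y = y mod 2"
    using env s(2) unfolding program_env_def by blast+
  have half_le: "y div 2 \<le> Y" using s(2) by linarith
  let ?u = "vars s u_var" and ?v = "vars s v_var"
  have edge: "eval (Edge (Var u_var) (Var v_var)) s = of_bool (adj E ?u ?v)"
    using eval_Edge[OF env, of "Var u_var" "Var v_var"] uv by simp
  show ?thesis
  proof (cases "?u \<in> F \<and> ?v \<in> F \<and> ?u \<noteq> ?v \<and> \<not> adj E ?u ?v")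
    case False
    then have "execute delete_com s = s" using s(3) uv edge by (auto simp: delete_com_def)
    with False R show ?thesis by (auto simp: delete_endpoint_def yF)
  next
    case True
    define z where "z = (if odd y then ?v else ?u)"
    have "execute delete_com s = set_var rest_var (y div 2) (set_array branch_arr ((arrays s branch_arr)(z := 0)) s)"
      using True s uv edge tables by (simp add: delete_com_def z_def odd_iff_mod_2_eq_one)
    with True s(3) half_le show ?thesis
      by (simp add: resolving_def delete_endpoint_def yF encodes_def z_def)
  qed
qed

lemma product_upt_Suc: "List.product [0..<Suc i] ys = List.product [0..<i] ys @ map (Pair i) ys"
  by (simp add: product_concat_map)

lemma execute_delete_row:
  assumes env: "program_env n E Y s" and u: "vars s u_var = u" "u < n" and R: "resolving n Y s yF"
  shows "resolving n Y (execute (For v_var size_var delete_com) s)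
    (fold (delete_endpoint E) (map (Pair u) [0..<n]) yF)"
proof -
  define I where "I i s' \<longleftrightarrow> resolving n Y s' (fold (delete_endpoint E) (map (Pair u) [0..<i]) yF)" for i s'
  have "I (vars s size_var) (iterate_body v_var delete_com (vars s size_var) s)"
  proof (rule For_invariant)
    fix i s'
    assume i: "i < vars s size_var"
      and agree: "agree_off (written (For v_var size_var delete_com)) s s'" and I: "I i s'"
    let ?s = "set_var v_var i s'"
    have "program_env n E Y s'"
      using program_env_agree[OF agree] env by (simp add: env_locations_def written_coms)
    then have env': "program_env n E Y ?s" by simp
    have "vars s' u_var = u" using agree u by (simp add: agree_off_def written_coms)
    moreover have "resolving n Y ?s (fold (delete_endpoint E) (map (Pair u) [0..<i]) yF)"
      using I by (simp add: I_def resolving_def)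
    ultimately show "I (Suc i) (execute delete_com ?s)"
      using execute_delete_com[OF env'] u(2) i env by (simp add: I_def)
  qed (use R in \<open>simp add: I_def\<close>)
  then show ?thesis using env by (simp add: execute_For I_def resolving_def)
qed

lemma execute_resolve_com:
  assumes env: "program_env n E Y s" and F: "encodes n (arrays s near_arr) F" and y: "vars s code_var \<le> Y"
  shows "encodes n (arrays (execute resolve_com s) branch_arr) (resolve n E (vars s code_var) F)"
proof -
  let ?y = "vars s code_var" and ?c = "For v_var size_var delete_com"
  define I where "I i s' \<longleftrightarrow> resolving n Y s' (fold (delete_endpoint E)
      (List.product [0..<i] [0..<n]) (?y, F))" for i s'
  define s0 where "s0 = execute (copy_com near_arr branch_arr) (set_var rest_var ?y s)"
  have env0: "program_env n E Y s0"
    using env by (simp add: s0_def program_env_execute env_locations_def written_coms)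
  have "I (vars s0 size_var) (iterate_body u_var ?c (vars s0 size_var) s0)"
  proof (rule For_invariant)
    show "I 0 s0" using env F y by (simp add: I_def resolving_def s0_def execute_copy_com encodes_def)
  next
    fix i s'
    assume i: "i < vars s0 size_var" and agree: "agree_off (written (For u_var size_var ?c)) s0 s'"
      and I: "I i s'"
    let ?s = "set_var u_var i s'"
    have "program_env n E Y s'"
      using program_env_agree[OF agree] env0 by (simp add: env_locations_def written_coms)
    then have env': "program_env n E Y ?s" by simp
    have "resolving n Y ?s (fold (delete_endpoint E) (List.product [0..<i] [0..<n]) (?y, F))"
      using I by (simp add: I_def resolving_def)
    from execute_delete_row[OF env' _ _ this, of i] show "I (Suc i) (execute ?c ?s)"
      using i env0 by (simp add: I_def product_upt_Suc del: upt_Suc)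
  qed
  then have "I n (iterate_body u_var ?c n s0)" using env0 by simp
  moreover have "execute resolve_com s = set_var u_var n (iterate_body u_var ?c n s0)"
    using env0 by (simp add: resolve_com_def s0_def[symmetric] execute_For)
  ultimately show ?thesis by (auto simp: I_def resolving_def resolve_def split: prod.splits)
qed

definition clique_inv :: "nat \<Rightarrow> nat set set \<Rightarrow> nat \<Rightarrow> state \<Rightarrow> bool" where
  "clique_inv n E Y s \<longleftrightarrow> program_env n E Y s \<and> is_clique n E (output_set s) \<and> vars s best_var
    = card (output_set s)"

lemma clique_inv_agree:
  assumes "agree_off L s s'" "L \<inter> insert (VarLoc best_var) (insert OutputLoc env_locations) = {}"
  shows "clique_inv n E Y s' \<longleftrightarrow> clique_inv n E Y s"
  using assms program_env_agree[OF assms(1), of n E Y]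
  by (auto simp: clique_inv_def agree_off_def output_set_def env_locations_def)

lemma execute_record_com:
  assumes inv: "clique_inv n E Y s" and F: "encodes n (arrays s branch_arr) F" "is_clique n E F"
  shows "clique_inv n E Y (execute record_com s)"
    and "vars (execute record_com s) best_var = max (vars s best_var) (card F)"
proof -
  have env: "program_env n E Y s" using inv by (simp add: clique_inv_def)
  have Fn: "F \<subseteq> {..<n}" using F(2) by (simp add: is_clique_def)
  let ?loop = "For v_var size_var (Output (Var v_var) (Elem branch_arr (Var v_var)))"
  define s1 where "s1 = set_var count_var (card F) (set_var v_var n s)"
  define s2 where "s2 = set_var best_var (card F) s1"
  define I where "I i s' \<longleftrightarrow> (\<forall>v<i. output_cells s' v = of_bool (v \<in> F))" for i s'
  have "I (vars s2 size_var) (iterate_body v_var (Output (Var v_var) (Elem branch_arr (Var v_var))) (vars s2 size_var) s2)"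
  proof (rule For_invariant)
    fix i s'
    assume i: "i < vars s2 size_var" and I: "I i s'"
      and agree: "agree_off (written ?loop) s2 s'"
    have "vars s' 0 = n" "arrays s' = arrays s" "i < n"
      using agree i env by (auto simp: agree_off_def s2_def s1_def)
    then show "I (Suc i) (execute (Output (Var v_var) (Elem branch_arr (Var v_var))) (set_var v_var i s'))"
      using I encodesD[OF F(1)] by (simp add: I_def writable_def min_def less_Suc_eq)
  qed (simp add: I_def)
  then have written_out: "output_cells (execute ?loop s2) v = of_bool (v \<in> F)" if "v < n" for v
    using that env by (simp add: I_def execute_For s2_def s1_def)
  have kept: "vars (execute ?loop s2) best_var = card F" "vars (execute ?loop s2) 0 = n"
    using env by (simp_all add: execute_unchanged s2_def s1_def)
  have env2: "program_env n E Y (execute ?loop s2)"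
    using env by (simp add: program_env_execute env_locations_def s2_def s1_def)
  have out: "output_set (execute ?loop s2) = F"
    using written_out kept(2) Fn by (auto simp: output_set_def)
  have record_eq: "execute record_com s = (if card F \<le> vars s best_var then s1 else execute ?loop s2)"
  proof -
    have "execute record_com s = execute (If (Leq (Var count_var) (Var best_var)) Skip
        (Assign best_var (Var count_var);; ?loop)) s1"
      by (simp only: record_com_def execute.simps(5) execute_count_com[OF env F(1) Fn] s1_def)
    moreover have "vars s1 count_var = card F" "vars s1 best_var = vars s best_var"
      by (simp_all add: s1_def)
    ultimately show ?thesis by (simp add: s2_def)
  qed
  have "clique_inv n E Y s1" using inv env by (simp add: clique_inv_def s1_def output_set_def)
  moreover have "clique_inv n E Y (execute ?loop s2)"
    using env2 out kept F(2) by (simp add: clique_inv_def)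
  ultimately show "clique_inv n E Y (execute record_com s)" by (simp add: record_eq)
  show "vars (execute record_com s) best_var = max (vars s best_var) (card F)"
    using kept by (simp add: record_eq s1_def)
qed

lemma clique_inv_updates [simp]:
  "v \<notin> {size_var, codes_var, best_var} \<Longrightarrow> clique_inv n E Y (set_var v x s) \<longleftrightarrow> clique_inv n E Y s"
  "a \<notin> {offset_arr, half_arr, parity_arr} \<Longrightarrow> clique_inv n E Y (set_array a f s) \<longleftrightarrow> clique_inv n E Y s"
  by (simp_all add: clique_inv_def output_set_def)

lemma clique_inv_sizes: "clique_inv n E Y s \<Longrightarrow> vars s size_var = n"
  "clique_inv n E Y s \<Longrightarrow> vars s codes_var = Y"
  unfolding clique_inv_def program_env_def by blast+

lemma execute_candidate_com:
  assumes env: "program_env n E Y s" and g: "\<And>i. i < t + 3 \<Longrightarrow> arrays s guess_arr i < n"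
  shows "encodes n (arrays (execute (candidate_com t h) s) near_arr)
      (candidate n E t h (arrays s guess_arr))"
proof -
  define g where "g = arrays s guess_arr"
  define V where "V = common_nbrs n E (g ` {..<t})"
  have V: "V \<subseteq> {..<n}" by (auto simp: V_def common_nbrs_def)
  define s1 where "s1 = execute (common_com t) s"
  define s2 where "s2 = execute (unit_vector_com t) s1"
  define s3 where "s3 = execute (power_com t) s2"
  define s4 where "s4 = execute (level_com t) s3"
  note states = s1_def s2_def s3_def s4_def
  have envs: "program_env n E Y s1" "program_env n E Y s2" "program_env n E Y s3" "program_env n E Y s4"
    using env by (simp_all add: states program_env_execute env_locations_def written_coms)
  have guess: "arrays s1 guess_arr = g" "arrays s2 guess_arr = g" "arrays s3 guess_arr = g"
    by (simp_all add: states execute_unchanged written_coms g_def)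
  have bounds: "g t < n" "g (t + 1) < n" "g (t + 2) < n" using g by (simp_all add: g_def)
  have "encodes n (arrays s1 common_arr) V"
    unfolding s1_def V_def g_def using g by (intro execute_common_com[OF env]) auto
  then have common: "encodes n (arrays s2 common_arr) V" "encodes n (arrays s3 common_arr) V"
    by (simp_all add: s2_def s3_def execute_unchanged written_coms)
  have unit: "int (arrays s2 pos_arr v) - int (arrays s2 neg_arr v) = of_bool (v = g (t + 1))"
    if "v < n" for v
    using execute_unit_vector_com[OF envs(1) that, of t] guess(1) by (simp add: s2_def)
  have power: "int (arrays s3 pos_arr v) - int (arrays s3 neg_arr v)
      = scaled_power_column n E V (g t) (g (t + 1)) n v"
    if "v < n" for v
    using execute_power_com[OF envs(2) _ common(1) V unit that] bounds(1) guess(2) by (simp add: s3_def)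
  have "encodes n (arrays s4 level_arr) (level_set n E V (g t) (g (t + 1)) (g (t + 2)))"
    using execute_level_com[OF envs(3) common(2) V _ power] bounds(3) guess(3)
    by (simp add: s4_def level_set_def)
  moreover have "level_set n E V (g t) (g (t + 1)) (g (t + 2)) \<subseteq> {..<n}"
    using V by (auto simp: level_set_def)
  ultimately have "encodes n (arrays (execute (near_com h) s4) near_arr) (candidate n E t h g)"
    unfolding candidate_def V_def by (rule execute_near_com[OF envs(4)])
  then show ?thesis by (simp add: candidate_com_def states g_def)
qed

lemma execute_resolve_record_com:
  assumes inv: "clique_inv n E Y s" and F: "encodes n (arrays s near_arr) F" "F \<subseteq> {..<n}"
    and code: "vars s code_var \<le> Y"
  defines "s' \<equiv> execute (resolve_com;; record_com) s"
  shows "clique_inv n E Y s'" "vars s best_var \<le> vars s' best_var"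
    "card (resolve n E (vars s code_var) F) \<le> vars s' best_var"
proof -
  define s1 where "s1 = execute resolve_com s"
  have env: "program_env n E Y s" using inv by (simp add: clique_inv_def)
  have inv1: "clique_inv n E Y s1"
    using clique_inv_agree[OF agree_off_execute, of resolve_com] inv
    by (simp add: s1_def written_coms env_locations_def)
  have "encodes n (arrays s1 branch_arr) (resolve n E (vars s code_var) F)"
    unfolding s1_def by (rule execute_resolve_com[OF env F(1) code])
  note recorded = execute_record_com[OF inv1 this is_clique_resolve[OF F(2)]]
  have "vars s1 best_var = vars s best_var" by (simp add: s1_def execute_unchanged written_coms)
  with recorded show "clique_inv n E Y s'" "vars s best_var \<le> vars s' best_var"
    "card (resolve n E (vars s code_var) F) \<le> vars s' best_var"
    by (simp_all add: s'_def s1_def)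
qed

lemma execute_try_guess_com:
  fixes t h :: nat
  assumes inv: "clique_inv n E Y s" and g: "\<And>i. i < t + 3 \<Longrightarrow> arrays s guess_arr i < n"
  defines "s' \<equiv> execute (try_guess_com t h) s"
  shows "clique_inv n E Y s' \<and> vars s best_var \<le> vars s' best_var \<and>
    (\<forall>y<Y. card (guessed_clique n E t h (arrays s guess_arr) y) \<le> vars s' best_var)"
proof -
  define F where "F = candidate n E t h (arrays s guess_arr)"
  define s1 where "s1 = execute (candidate_com t h) s"
  have env: "program_env n E Y s" using inv by (simp add: clique_inv_def)
  have F: "encodes n (arrays s1 near_arr) F" "F \<subseteq> {..<n}"
    using execute_candidate_com[OF env g]
    by (auto simp: F_def s1_def candidate_def nearly_complete_to_def)
  have best1: "vars s1 best_var = vars s best_var" by (simp add: s1_def execute_unchanged written_coms)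
  have inv1: "clique_inv n E Y s1"
    using clique_inv_agree[OF agree_off_execute, of "candidate_com t h"] inv
    by (simp add: s1_def written_coms env_locations_def)
  define I where "I i s' \<longleftrightarrow> clique_inv n E Y s' \<and> vars s best_var \<le> vars s' best_var \<and>
    (\<forall>y<i. card (resolve n E y F) \<le> vars s' best_var)" for i s'
  let ?c = "resolve_com;; record_com"
  have "I (vars s1 codes_var) (iterate_body code_var ?c (vars s1 codes_var) s1)"
  proof (rule For_invariant)
    show "I 0 s1" using inv1 best1 by (simp add: I_def)
  next
    fix i s2
    assume i: "i < vars s1 codes_var"
      and agree: "agree_off (written (For code_var codes_var ?c)) s1 s2" and I: "I i s2"
    let ?s = "set_var code_var i s2"
    have "arrays ?s near_arr = arrays s1 near_arr" using agree by (simp add: agree_off_def written_coms)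
    then have "encodes n (arrays ?s near_arr) F" using F(1) by simp
    moreover have "clique_inv n E Y ?s" "vars ?s code_var \<le> Y"
      using I i clique_inv_sizes(2)[OF inv1] by (simp_all add: I_def)
    ultimately show "I (Suc i) (execute ?c ?s)"
      using execute_resolve_record_com[of n E Y ?s F] F(2) I
      unfolding I_def by (fastforce simp: less_Suc_eq)
  qed
  moreover have "s' = set_var code_var Y (iterate_body code_var ?c Y s1)"
    using clique_inv_sizes(2)[OF inv1] by (simp add: s'_def try_guess_com_def execute_For s1_def)
  ultimately show ?thesis using clique_inv_sizes(2)[OF inv1] by (simp add: I_def F_def guessed_clique_def)
qed

lemma guess_loops_sets:
  "written (guess_loops m c) \<subseteq> {VarLoc guess_var, ArrayLoc guess_arr} \<union> written c"
  "loop_bounds (guess_loops m c) \<subseteq> {size_var} \<union> loop_bounds c"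
  "wf_com N c \<Longrightarrow> guess_var < N \<Longrightarrow> wf_com N (guess_loops m c)"
  by (induction m) auto

lemma guess_loops_keeps_guess:
  assumes "ArrayLoc guess_arr \<notin> written c" "m \<le> i"
  shows "arrays (execute (guess_loops m c) s) guess_arr i = arrays s guess_arr i"
  using assms(2)
proof (induction m arbitrary: s)
  case 0
  then show ?case using assms(1) by (simp add: execute_unchanged)
next
  case (Suc m)
  let ?c = "Store guess_arr (Num m) (Var guess_var);; guess_loops m c"
  have "arrays (iterate_body guess_var ?c (vars s size_var) s) guess_arr i = arrays s guess_arr i"
    by (rule For_invariant[where I = "\<lambda>_ s'. arrays s' guess_arr i = arrays s guess_arr i"])
      (use Suc in simp_all)
  then show ?case by (simp add: execute_For)
qed

lemma guessed_clique_cong: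
  assumes "\<And>i. i < t + 3 \<Longrightarrow> g i = g' i"
  shows "guessed_clique n E t h g = guessed_clique n E t h g'"
proof -
  have "g ` {..<t} = g' ` {..<t}" using assms by (intro image_cong) auto
  then show ?thesis using assms by (simp add: guessed_clique_def candidate_def fun_eq_iff)
qed

definition guesses_bounded ::
    "nat \<Rightarrow> nat set set \<Rightarrow> nat \<Rightarrow> nat \<Rightarrow> nat \<Rightarrow> nat \<Rightarrow> (nat \<Rightarrow> nat) \<Rightarrow> nat \<Rightarrow> bool" where
  "guesses_bounded n E Y t h m g b \<longleftrightarrow> (\<forall>g' y. (\<forall>i<m. g' i < n) \<longrightarrow> (\<forall>i. m \<le> i \<longrightarrow> i < t + 3 \<longrightarrow> g' i = g i) \<longrightarrow>
     y < Y \<longrightarrow> card (guessed_clique n E t h g' y) \<le> b)"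

lemma guesses_bounded_mono: "guesses_bounded n E Y t h m g b \<Longrightarrow> b \<le> b' \<Longrightarrow> guesses_bounded n E Y t h m g b'"
  unfolding guesses_bounded_def using order.trans by blast

lemma guesses_bounded_0:
  assumes "\<forall>y<Y. card (guessed_clique n E t h g y) \<le> b"
  shows "guesses_bounded n E Y t h 0 g b"
  unfolding guesses_bounded_def
proof (intro allI impI)
  fix g' y assume "\<forall>i. 0 \<le> i \<longrightarrow> i < t + 3 \<longrightarrow> g' i = g i" "y < Y"
  moreover from this have "guessed_clique n E t h g' = guessed_clique n E t h g"
    by (intro guessed_clique_cong) simp
  ultimately show "card (guessed_clique n E t h g' y) \<le> b" using assms by simp
qed

lemma guesses_bounded_Suc:
  assumes "\<forall>j<n. guesses_bounded n E Y t h m (g(m := j)) b"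
  shows "guesses_bounded n E Y t h (Suc m) g b"
  unfolding guesses_bounded_def
proof (intro allI impI)
  fix g' y assume g': "\<forall>i<Suc m. g' i < n" "\<forall>i. Suc m \<le> i \<longrightarrow> i < t + 3 \<longrightarrow> g' i = g i" "y < Y"
  then have "guesses_bounded n E Y t h m (g(m := g' m)) b" using assms by simp
  from this[unfolded guesses_bounded_def, THEN spec[of _ g'], THEN spec[of _ y]]
  show "card (guessed_clique n E t h g' y) \<le> b" using g' by auto
qed

lemma execute_guess_loops:
  fixes m t h :: nat
  assumes "clique_inv n E Y s" "m \<le> t + 3" "\<And>i. m \<le> i \<Longrightarrow> i < t + 3 \<Longrightarrow> arrays s guess_arr i < n"
  defines "s' \<equiv> execute (guess_loops m (try_guess_com t h)) s"
  shows "clique_inv n E Y s' \<and> vars s best_var \<le> vars s' best_var \<and>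
    guesses_bounded n E Y t h m (arrays s guess_arr) (vars s' best_var)"
  using assms(1-3) unfolding s'_def
proof (induction m arbitrary: s)
  case 0
  have "arrays s guess_arr i < n" if "i < t + 3" for i using 0(3)[of i] that by blast
  then show ?case using execute_try_guess_com[OF 0(1), of t h] guesses_bounded_0 by simp
next
  case (Suc m)
  let ?loops = "guess_loops m (try_guess_com t h)"
  let ?c = "Store guess_arr (Num m) (Var guess_var);; ?loops"
  define g where "g = arrays s guess_arr"
  define I where "I j s' \<longleftrightarrow> clique_inv n E Y s' \<and> vars s best_var \<le> vars s' best_var \<and>
    (\<forall>i\<ge>Suc m. arrays s' guess_arr i = g i) \<and>
    (\<forall>j'<j. guesses_bounded n E Y t h m (g(m := j')) (vars s' best_var))" for j s'
  note n = clique_inv_sizes(1)[OF Suc.prems(1)]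
  have "I (vars s size_var) (iterate_body guess_var ?c (vars s size_var) s)"
  proof (rule For_invariant)
    show "I 0 s" using Suc.prems by (simp add: I_def g_def)
  next
    fix j s2
    assume j: "j < vars s size_var" and I: "I j s2"
    define s3 where "s3 = execute (Store guess_arr (Num m) (Var guess_var)) (set_var guess_var j s2)"
    define s4 where "s4 = execute ?loops s3"
    have inv3: "clique_inv n E Y s3" and best3: "vars s3 best_var = vars s2 best_var"
      using I by (simp_all add: I_def s3_def)
    have guess3: "arrays s3 guess_arr i = (g(m := j)) i" if "m \<le> i" for i
      using that I by (auto simp: s3_def I_def)
    then have "arrays s3 guess_arr i < n" if "m \<le> i" "i < t + 3" for i
      using that Suc.prems(3)[of i] j n by (auto simp: g_def)
    with inv3 have loops: "clique_inv n E Y s4" "vars s3 best_var \<le> vars s4 best_var"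
      "guesses_bounded n E Y t h m (arrays s3 guess_arr) (vars s4 best_var)"
      using Suc.IH[of s3] Suc.prems(2) unfolding s4_def by auto
    have "guesses_bounded n E Y t h m (g(m := j)) (vars s4 best_var)"
      using loops(3) guess3 by (simp add: guesses_bounded_def)
    then have "\<forall>j'<Suc j. guesses_bounded n E Y t h m (g(m := j')) (vars s4 best_var)"
      using I loops(2) best3 guesses_bounded_mono by (auto simp: I_def less_Suc_eq)
    moreover have "arrays s4 guess_arr i = g i" if "Suc m \<le> i" for i
      using that guess3 guess_loops_keeps_guess[of "try_guess_com t h" m i s3]
      by (simp add: s4_def written_coms)
    ultimately have "I (Suc j) s4" using loops(1,2) I best3 by (simp add: I_def)
    then show "I (Suc j) (execute ?c (set_var guess_var j s2))" by (simp add: s4_def s3_def)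
  qed
  then show ?case using n guesses_bounded_Suc[of n E Y t h m g] by (simp add: execute_For I_def g_def)
qed

lemma execute_size_power_com:
  "vars (execute (size_power_com a) s) codes_var = vars s size_var ^ a"
proof (induction a)
  case (Suc a)
  define s1 where "s1 = set_var acc_var 0 (execute (size_power_com a) s)"
  have "execute (For v_var size_var (Assign acc_var (Plus (Var acc_var) (Var codes_var)))) s1 =
      set_var acc_var (vars s1 acc_var + (\<Sum>i<vars s1 size_var. vars s1 codes_var)) (set_var v_var (vars s1 size_var) s1)"
    by (rule execute_sum) simp_all
  moreover have "VarLoc 0 \<notin> written (size_power_com a)" by (induction a) auto
  ultimately show ?case using Suc by (simp add: s1_def execute_unchanged)
qed simp

lemma execute_offsets_com:
  assumes "u < vars s size_var"
  shows "arrays (execute offsets_com s) offset_arr u = (u - 1) * vars s size_var"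
proof -
  let ?s = "set_var acc_var 0 s" and ?n = "vars s size_var"
  let ?c = "Store offset_arr (Var u_var) (Minus (Var acc_var) (Var size_var));;
       Assign acc_var (Plus (Var acc_var) (Var size_var))"
  define I where "I i s' \<longleftrightarrow> vars s' acc_var = i * ?n \<and>
    (\<forall>u<i. arrays s' offset_arr u = (u - 1) * ?n)" for i s'
  have "I (vars ?s size_var) (iterate_body u_var ?c (vars ?s size_var) ?s)"
  proof (rule For_invariant)
    fix i s'
    assume agree: "agree_off (written (For u_var size_var ?c)) ?s s'" and I: "I i s'"
    have "vars s' 0 = ?n" using agree by (simp add: agree_off_def)
    then show "I (Suc i) (execute ?c (set_var u_var i s'))"
      using I by (auto simp: I_def less_Suc_eq diff_mult_distrib)
  qed (simp add: I_def)
  then show ?thesis using assms by (simp add: offsets_com_def execute_For I_def)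
qed

lemma execute_halves_com:
  assumes "arrays s half_arr 0 = 0" "arrays s parity_arr 0 = 0" "y \<le> vars s codes_var"
  shows "arrays (execute halves_com s) half_arr y = y div 2 \<and>
      arrays (execute halves_com s) parity_arr y = y mod 2"
proof -
  let ?c = "Store half_arr (Plus (Var u_var) (Num 1)) (Plus (Elem half_arr (Var u_var)) (Elem parity_arr (Var u_var)));;
     Store parity_arr (Plus (Var u_var) (Num 1)) (Neg (Elem parity_arr (Var u_var)))"
  define I where "I i s' \<longleftrightarrow> (\<forall>y\<le>i. arrays s' half_arr y = y div 2 \<and> arrays s' parity_arr y = y mod 2)" for i s'
  have "I (vars s codes_var) (iterate_body u_var ?c (vars s codes_var) s)"
  proof (rule For_invariant)
    fix i s'
    assume I: "I i s'"
    have "Suc i div 2 = i div 2 + i mod 2" "Suc i mod 2 = of_bool (i mod 2 = 0)"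
      by (auto simp: mod_2_eq_odd odd_Suc_div_two even_Suc_div_two)
    then show "I (Suc i) (execute ?c (set_var u_var i s'))" using I by (auto simp: I_def le_Suc_eq)
  qed (use assms in \<open>simp add: I_def\<close>)
  then show ?thesis using assms(3) by (simp add: halves_com_def execute_For I_def)
qed

definition clique_com :: "nat \<Rightarrow> nat \<Rightarrow> nat \<Rightarrow> com" where
  "clique_com t h a = prepare_com a;; search_com t h"

lemma written_preparation:
  "written offsets_com = {VarLoc u_var, VarLoc acc_var, ArrayLoc offset_arr}"
  "written halves_com = {VarLoc u_var, ArrayLoc half_arr, ArrayLoc parity_arr}"
  "v \<notin> {v_var, acc_var, codes_var} \<Longrightarrow> VarLoc v \<notin> written (size_power_com a)"
  "ArrayLoc x \<notin> written (size_power_com a)" "OutputLoc \<notin> written (size_power_com a)"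
  by (auto simp: offsets_com_def halves_com_def) (induction a; auto)+

lemma prepared_vars:
  "vars (execute (prepare_com a) s) size_var = vars s size_var"
  "vars (execute (prepare_com a) s) codes_var = vars s size_var ^ a"
  by (simp_all add: prepare_com_def execute_size_power_com execute_unchanged written_preparation)

lemma clique_inv_prepared:
  assumes s: "initial_state n E s"
  shows "clique_inv n E (n ^ a) (execute halves_com (execute (prepare_com a) s))"
proof -
  define s1 where "s1 = execute offsets_com (set_var best_var 0 s)"
  define s2 where "s2 = execute (size_power_com a) s1"
  define s3 where "s3 = execute halves_com s2"
  note states = s1_def s2_def s3_def
  have n: "vars s size_var = n" and arrays: "arrays s = (\<lambda>_ _. 0)"
    and input: "input_cells s = input_mem n E"
    and out: "output_cells s = (\<lambda>_. 0)"
    using s by (simp_all add: initial_state_def)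
  have vars3: "vars s3 size_var = n" "vars s3 codes_var = n ^ a" "vars s3 best_var = 0"
    using prepared_vars[of a s] n
    by (simp_all add: states execute_unchanged written_preparation prepare_com_def)
  have "arrays s3 offset_arr u = (u - 1) * n" if "u < n" for u
    using execute_offsets_com[of u "set_var best_var 0 s"] that n
    by (simp add: states execute_unchanged written_preparation)
  moreover have "arrays s3 half_arr y = y div 2 \<and> arrays s3 parity_arr y = y mod 2" if "y \<le> n ^ a" for y
  proof -
    have "arrays s2 half_arr 0 = 0" "arrays s2 parity_arr 0 = 0"
      by (simp_all add: s1_def s2_def execute_unchanged written_preparation arrays)
    moreover have "vars s2 codes_var = n ^ a"
      using vars3(2) by (simp add: s3_def execute_unchanged written_preparation)
    ultimately show ?thesis unfolding s3_def using that by (intro execute_halves_com) simp_all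
  qed
  moreover have "input_cells s3 = input_mem n E" using input by (simp add: states execute_unchanged)
  ultimately have "program_env n E (n ^ a) s3" using vars3 unfolding program_env_def by blast
  moreover have "output_set s3 = {}"
    using out by (simp add: output_set_def states execute_unchanged written_preparation)
  ultimately have "clique_inv n E (n ^ a) s3" using vars3(3) by (simp add: clique_inv_def is_clique_def)
  then show ?thesis by (simp add: prepare_com_def states)
qed

lemma wf_clique_com: "wf_com 13 (clique_com t h a)"
proof -
  have edge: "wf_expr 13 e \<Longrightarrow> wf_expr 13 e' \<Longrightarrow> wf_expr 13 (Edge e e')" for e e'
    by (simp add: Edge_def Neg_def Conj_def Leq_def Eql_def)
  have "wf_expr 13 (Common_nbr t)" by (induction t) (simp_all add: edge Neg_def Conj_def)
  moreover have "wf_expr 13 e \<Longrightarrow> wf_expr 13 (Multiple h e)" for e by (induction h) simp_all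
  moreover have "wf_com 13 (size_power_com a)" by (induction a) simp_all
  ultimately show ?thesis
    by (auto intro!: guess_loops_sets(3) simp: clique_com_def prepare_com_def search_com_def offsets_com_def
        halves_com_def try_guess_com_def candidate_com_def common_com_def unit_vector_com_def
          power_com_def
        products_com_def row_product_com_def add_products_com_def copy_com_def level_com_def Let_def
          near_com_def
        count_com_def resolve_com_def delete_com_def record_com_def edge Neg_def Conj_def Leq_def Eql_def)
qed

lemma loop_bounds_coms:
  "loop_bounds (prepare_com a) = {size_var}" "loop_bounds (search_com t h) \<subseteq> {size_var, codes_var}"
proof -
  have "loop_bounds (size_power_com a) \<subseteq> {size_var}" by (induction a) auto
  then show "loop_bounds (prepare_com a) = {size_var}" by (auto simp: prepare_com_def offsets_com_def)
  have "loop_bounds (try_guess_com t h) = {size_var, codes_var}"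
    by (auto simp: try_guess_com_def candidate_com_def common_com_def unit_vector_com_def power_com_def
        products_com_def row_product_com_def add_products_com_def copy_com_def level_com_def Let_def
          near_com_def
        count_com_def resolve_com_def delete_com_def record_com_def)
  then show "loop_bounds (search_com t h) \<subseteq> {size_var, codes_var}"
    using guess_loops_sets(2)[of "t + 3" "try_guess_com t h"]
    by (auto simp: search_com_def halves_com_def)
qed

lemma steps_clique_com:
  assumes "vars s size_var = n"
  shows "steps (clique_com t h a) s
      \<le> max_steps (prepare_com a) n + max_steps (search_com t h) (n + n ^ a)"
proof -
  have "written (search_com t h) \<inter> {VarLoc size_var, VarLoc codes_var} = {}"
    using guess_loops_sets(1)[of "t + 3" "try_guess_com t h"]
    by (auto simp: search_com_def written_preparation written_coms)
  then have "steps (search_com t h) (execute (prepare_com a) s) \<le> max_steps (search_com t h) (n + n ^ a)"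
    using prepared_vars[of a s] assms loop_bounds_coms(2)[of t h] by (intro steps_le_max_steps) auto
  moreover have "written (prepare_com a) \<inter> {VarLoc size_var} = {}"
    by (simp add: prepare_com_def written_preparation)
  then have "steps (prepare_com a) s \<le> max_steps (prepare_com a) n"
    using assms by (intro steps_le_max_steps) (auto simp: loop_bounds_coms)
  ultimately show ?thesis by (simp add: clique_com_def)
qed

lemma output_clique_com:
  assumes s: "initial_state n E s" and optimal: "some_guess_optimal n E t h (n ^ a)"
  shows "is_max_clique n E (output_set (execute (clique_com t h a) s))"
proof -
  define s1 where "s1 = execute halves_com (execute (prepare_com a) s)"
  define s2 where "s2 = execute (guess_loops (t + 3) (try_guess_com t h)) s1"
  have final_state: "execute (clique_com t h a) s = s2"
    by (simp add: clique_com_def search_com_def s1_def s2_def)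
  have "clique_inv n E (n ^ a) s1" using clique_inv_prepared[OF s] by (simp add: s1_def)
  from execute_guess_loops[OF this order.refl]
  have inv: "clique_inv n E (n ^ a) s2"
    and best: "card (guessed_clique n E t h g y) \<le> vars s2 best_var"
      if "\<forall>i<t + 3. g i < n" "y < n ^ a" for g y
    using that by (auto simp: s2_def guesses_bounded_def)
  from optimal obtain g y C where "\<forall>i<t + 3. g i < n" "y < n ^ a" "is_max_clique n E C"
    "card C \<le> card (guessed_clique n E t h g y)"
    unfolding some_guess_optimal_def by blast
  with inv best[of g y] show ?thesis
    unfolding final_state clique_inv_def by (auto intro: is_max_clique_if_card_le)
qed

theorem ram_finds_max_clique_if_some_guess_optimal:
  "\<exists>P C d N. (\<forall>n E. ram_halts_within P (C * (n + 1) ^ d) n E) \<and>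
    (\<forall>n E. N \<le> n \<longrightarrow> some_guess_optimal n E t h (n ^ a) \<longrightarrow> is_max_clique n E (ram_output P (C * (n + 1) ^ d) n E))"
proof -
  let ?B = "\<lambda>n. max_steps (prepare_com a) n + max_steps (search_com t h) (n + n ^ a)"
  have "poly_bounded (\<lambda>n. max_steps (search_com t h) (n + n ^ a))"
    by (rule poly_bounded_compose[OF poly_bounded_max_steps]) (intro poly_bounded_intros)
  then have "poly_bounded ?B" by (rule poly_bounded_add[OF poly_bounded_max_steps])
  moreover have "steps (clique_com t h a) s \<le> ?B n" if "initial_state n E s" for n E s
    using that by (intro steps_clique_com) (simp add: initial_state_def)
  ultimately obtain C d
    where "\<forall>n E. ram_halts_within (ram_program 13 (clique_com t h a)) (C * (n + 1) ^ d) n E"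
    "\<forall>n E. temp 13 (com_temps (clique_com t h a)) \<le> n \<longrightarrow> (\<exists>s. initial_state n E s \<and>
      ram_output (ram_program 13 (clique_com t h a)) (C * (n + 1) ^ d) n E = output_set (execute (clique_com t h a) s))"
    using ram_program_poly_time[OF _ wf_clique_com, of t h a ?B] by auto
  then show ?thesis using output_clique_com by metis
qed

section \<open>Bilinear forms on finite sets\<close>

definition mat_vec :: "'a set \<Rightarrow> ('a \<Rightarrow> 'a \<Rightarrow> real) \<Rightarrow> ('a \<Rightarrow> real) \<Rightarrow> 'a \<Rightarrow> real" where
  "mat_vec V M x = (\<lambda>u. \<Sum>v\<in>V. M u v * x v)"

definition inner_on :: "'a set \<Rightarrow> ('a \<Rightarrow> real) \<Rightarrow> ('a \<Rightarrow> real) \<Rightarrow> real" where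
  "inner_on V x y = (\<Sum>v\<in>V. x v * y v)"

lemma L2_set_power2: "(L2_set x V)\<^sup>2 = (\<Sum>v\<in>V. (x v)\<^sup>2)"
  by (simp add: L2_set_def sum_nonneg)

lemma inner_on_self: "inner_on V x x = (L2_set x V)\<^sup>2"
  unfolding inner_on_def L2_set_power2 by (simp only: power2_eq_square)

lemma abs_inner_on_le: "\<bar>inner_on V x y\<bar> \<le> L2_set x V * L2_set y V"
proof -
  have "\<bar>inner_on V x y\<bar> \<le> (\<Sum>v\<in>V. \<bar>x v\<bar> * \<bar>y v\<bar>)"
    unfolding inner_on_def abs_mult[symmetric] by (rule sum_abs)
  also have "\<dots> \<le> L2_set x V * L2_set y V" by (rule L2_set_mult_ineq)
  finally show ?thesis .
qed

lemma sum_abs_le_sqrt_card_L2_set: "(\<Sum>v\<in>V. \<bar>x v\<bar>) \<le> sqrt (card V) * L2_set x V"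
  using L2_set_mult_ineq[of "\<lambda>_. 1" x V] by (simp add: L2_set_constant)

lemma L2_set_subset: "finite V \<Longrightarrow> K \<subseteq> V \<Longrightarrow> L2_set x K \<le> L2_set x V"
  unfolding L2_set_def by (intro real_sqrt_le_mono sum_mono2) auto

lemma inner_on_mat_vec: "inner_on V x (mat_vec V M y) = (\<Sum>u\<in>V. \<Sum>v\<in>V. M u v * (x u * y v))"
  by (simp add: inner_on_def mat_vec_def sum_distrib_left mult_ac)

lemma inner_on_mat_vec_symmetric:
  assumes "\<And>u v. u \<in> V \<Longrightarrow> v \<in> V \<Longrightarrow> M u v = M v u"
  shows "inner_on V x (mat_vec V M y) = inner_on V (mat_vec V M x) y"
proof -
  have "inner_on V x (mat_vec V M y) = (\<Sum>v\<in>V. \<Sum>u\<in>V. M u v * (x u * y v))"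
    unfolding inner_on_mat_vec by (rule sum.swap)
  also have "\<dots> = inner_on V (mat_vec V M x) y"
    unfolding inner_on_def mat_vec_def sum_distrib_right using assms by (intro sum.cong refl) simp
  finally show ?thesis .
qed

lemma inner_on_mat_vec_funpow_symmetric:
  assumes "\<And>u v. u \<in> V \<Longrightarrow> v \<in> V \<Longrightarrow> M u v = M v u"
  shows "inner_on V x ((mat_vec V M ^^ s) y) = inner_on V ((mat_vec V M ^^ s) x) y"
proof (induction s arbitrary: x)
  case (Suc s)
  have "inner_on V x ((mat_vec V M ^^ Suc s) y) = inner_on V (mat_vec V M x) ((mat_vec V M ^^ s) y)"
    by (simp add: inner_on_mat_vec_symmetric[OF assms])
  also have "\<dots> = inner_on V ((mat_vec V M ^^ s) (mat_vec V M x)) y" by (rule Suc)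
  finally show ?case by (simp add: funpow_swap1)
qed simp

lemma L2_set_power2_decompose:
  assumes "L2_set u V = 1"
  shows "(L2_set y V)\<^sup>2 = (inner_on V u y)\<^sup>2 + (L2_set (\<lambda>v. y v - inner_on V u y * u v) V)\<^sup>2"
proof -
  let ?a = "inner_on V u y"
  have "(L2_set (\<lambda>v. y v - ?a * u v) V)\<^sup>2 = (\<Sum>v\<in>V. (y v)\<^sup>2 - 2 * ?a * (u v * y v) + ?a\<^sup>2 * (u v)\<^sup>2)"
    unfolding L2_set_power2 by (intro sum.cong refl) (simp add: power2_eq_square algebra_simps)
  also have "\<dots> = (L2_set y V)\<^sup>2 - 2 * ?a * ?a + ?a\<^sup>2 * (L2_set u V)\<^sup>2"
    by (simp add: sum.distrib sum_subtractf L2_set_power2 sum_distrib_left[symmetric] inner_on_def[symmetric])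
  finally show ?thesis using assms by (simp add: power2_eq_square)
qed

definition form_bounded :: "'a set \<Rightarrow> ('a \<Rightarrow> 'a \<Rightarrow> real) \<Rightarrow> real \<Rightarrow> bool" where
  "form_bounded V M \<rho> \<longleftrightarrow> (\<forall>x y. inner_on V x (mat_vec V M y) \<le> \<rho> * (L2_set x V * L2_set y V))"

lemma form_boundedD: "form_bounded V M \<rho> \<Longrightarrow> inner_on V x (mat_vec V M y) \<le> \<rho> * (L2_set x V * L2_set y V)"
  by (simp add: form_bounded_def)

lemma form_bounded_mono:
  assumes "form_bounded V M \<rho>" "\<rho> \<le> \<rho>'"
  shows "form_bounded V M \<rho>'"
  unfolding form_bounded_def
  using form_boundedD[OF assms(1)] mult_right_mono[OF assms(2)]
  by (metis L2_set_nonneg mult_nonneg_nonneg order.trans)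

lemma form_bounded_cong:
  assumes "form_bounded V M \<rho>" "\<And>u v. u \<in> V \<Longrightarrow> v \<in> V \<Longrightarrow> M' u v = M u v"
  shows "form_bounded V M' \<rho>"
proof -
  have "inner_on V x (mat_vec V M' y) = inner_on V x (mat_vec V M y)" for x y
    unfolding inner_on_mat_vec using assms(2) by (intro sum.cong refl) simp
  then show ?thesis using assms(1) by (simp add: form_bounded_def)
qed

lemma form_bounded_add:
  assumes "form_bounded V M \<rho>" "form_bounded V M' \<rho>'"
  shows "form_bounded V (\<lambda>u v. M u v + M' u v) (\<rho> + \<rho>')"
  unfolding form_bounded_def
proof (intro allI)
  fix x y
  have "inner_on V x (mat_vec V (\<lambda>u v. M u v + M' u v) y)
      = inner_on V x (mat_vec V M y) + inner_on V x (mat_vec V M' y)"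
    unfolding inner_on_mat_vec by (simp add: distrib_right sum.distrib)
  then show "inner_on V x (mat_vec V (\<lambda>u v. M u v + M' u v) y) \<le> (\<rho> + \<rho>') * (L2_set x V * L2_set y V)"
    using form_boundedD[OF assms(1), of x y] form_boundedD[OF assms(2), of x y]
    by (simp add: distrib_right)
qed

lemma form_bounded_uminus:
  assumes "form_bounded V M \<rho>"
  shows "form_bounded V (\<lambda>u v. - M u v) \<rho>"
  unfolding form_bounded_def
proof (intro allI)
  fix x y
  have "inner_on V x (mat_vec V (\<lambda>u v. - M u v) y) = inner_on V (\<lambda>v. - x v) (mat_vec V M y)"
    unfolding inner_on_mat_vec by simp
  also have "\<dots> \<le> \<rho> * (L2_set (\<lambda>v. - x v) V * L2_set y V)" using assms by (rule form_boundedD)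
  also have "L2_set (\<lambda>v. - x v) V = L2_set x V" by (simp add: L2_set_def)
  finally show "inner_on V x (mat_vec V (\<lambda>u v. - M u v) y) \<le> \<rho> * (L2_set x V * L2_set y V)" .
qed

lemma form_bounded_diff:
  assumes "form_bounded V M \<rho>" "form_bounded V M' \<rho>'"
  shows "form_bounded V (\<lambda>u v. M u v - M' u v) (\<rho> + \<rho>')"
  using form_bounded_add[OF assms(1) form_bounded_uminus[OF assms(2)]] by simp

lemma form_bounded_entries:
  assumes "\<And>u v. u \<in> V \<Longrightarrow> v \<in> V \<Longrightarrow> \<bar>M u v\<bar> \<le> c" "0 \<le> c"
  shows "form_bounded V M (c * card V)"
  unfolding form_bounded_def
proof (intro allI)
  fix x y
  have "inner_on V x (mat_vec V M y) \<le> (\<Sum>u\<in>V. \<Sum>v\<in>V. c * (\<bar>x u\<bar> * \<bar>y v\<bar>))"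
    unfolding inner_on_mat_vec
  proof (intro sum_mono)
    fix u v assume "u \<in> V" "v \<in> V"
    then have "\<bar>M u v\<bar> * (\<bar>x u\<bar> * \<bar>y v\<bar>) \<le> c * (\<bar>x u\<bar> * \<bar>y v\<bar>)"
      using assms(1) by (intro mult_right_mono) auto
    then show "M u v * (x u * y v) \<le> c * (\<bar>x u\<bar> * \<bar>y v\<bar>)"
      using abs_ge_self[of "M u v * (x u * y v)"] by (simp add: abs_mult)
  qed
  also have "\<dots> = c * ((\<Sum>u\<in>V. \<bar>x u\<bar>) * (\<Sum>v\<in>V. \<bar>y v\<bar>))"
    unfolding sum_product unfolding sum_distrib_left ..
  also have "\<dots> \<le> c * ((sqrt (card V) * L2_set x V) * (sqrt (card V) * L2_set y V))"
    using assms(2)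
    by (intro mult_left_mono mult_mono sum_abs_le_sqrt_card_L2_set) (auto intro: sum_nonneg)
  also have "\<dots> = c * (sqrt (card V) * sqrt (card V)) * (L2_set x V * L2_set y V)" by (simp only: mult_ac)
  finally show "inner_on V x (mat_vec V M y) \<le> c * card V * (L2_set x V * L2_set y V)" by simp
qed

lemma form_bounded_diagonal:
  assumes "finite V" "\<And>u. u \<in> V \<Longrightarrow> \<bar>d u\<bar> \<le> c"
  shows "form_bounded V (\<lambda>u v. if u = v then d u else 0) c"
  unfolding form_bounded_def
proof (intro allI)
  fix x y
  have "inner_on V x (mat_vec V (\<lambda>u v. if u = v then d u else 0) y) = (\<Sum>u\<in>V. d u * (x u * y u))"
    unfolding inner_on_mat_vec
    using assms(1) by (intro sum.cong refl) (simp add: if_distrib[of "\<lambda>z. z * _"] cong: if_cong)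
  also have "\<dots> \<le> (\<Sum>u\<in>V. c * (\<bar>x u\<bar> * \<bar>y u\<bar>))"
  proof (rule sum_mono)
    fix u assume "u \<in> V"
    then have "\<bar>d u\<bar> * (\<bar>x u\<bar> * \<bar>y u\<bar>) \<le> c * (\<bar>x u\<bar> * \<bar>y u\<bar>)"
      using assms(2) by (intro mult_right_mono) auto
    then show "d u * (x u * y u) \<le> c * (\<bar>x u\<bar> * \<bar>y u\<bar>)"
      using abs_ge_self[of "d u * (x u * y u)"] by (simp add: abs_mult)
  qed
  also have "\<dots> = c * (\<Sum>u\<in>V. \<bar>x u\<bar> * \<bar>y u\<bar>)" by (simp add: sum_distrib_left)
  also have "\<dots> \<le> c * (L2_set x V * L2_set y V)"
  proof (cases "V = {}")
    case False
    then obtain u where "u \<in> V" by blast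
    then have "0 \<le> c" using assms(2)[of u] by linarith
    then show ?thesis by (intro mult_left_mono L2_set_mult_ineq)
  qed simp
  finally show "inner_on V x (mat_vec V (\<lambda>u v. if u = v then d u else 0) y)
      \<le> c * (L2_set x V * L2_set y V)" .
qed

lemma form_bounded_restrict:
  assumes "finite V" "K \<subseteq> V" "form_bounded K M \<rho>" "0 \<le> \<rho>"
  shows "form_bounded V (\<lambda>u v. if u \<in> K \<and> v \<in> K then M u v else 0) \<rho>"
  unfolding form_bounded_def
proof (intro allI)
  fix x y
  have row: "(\<Sum>v\<in>V. (if u \<in> K \<and> v \<in> K then M u v else 0) * (x u * y v)) =
      (if u \<in> K then \<Sum>v\<in>K. M u v * (x u * y v) else 0)" for u
  proof (cases "u \<in> K")
    case True
    then show ?thesis using assms(1,2) by (simp, intro sum.mono_neutral_cong_right) auto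
  qed simp
  have "inner_on V x (mat_vec V (\<lambda>u v. if u \<in> K \<and> v \<in> K then M u v else 0) y)
      = inner_on K x (mat_vec K M y)"
    unfolding inner_on_mat_vec row using assms(1,2) by (intro sum.mono_neutral_cong_right) auto
  also have "\<dots> \<le> \<rho> * (L2_set x K * L2_set y K)" by (rule form_boundedD[OF assms(3)])
  also have "\<dots> \<le> \<rho> * (L2_set x V * L2_set y V)"
    using assms by (intro mult_left_mono mult_mono L2_set_subset) auto
  finally show "inner_on V x (mat_vec V (\<lambda>u v. if u \<in> K \<and> v \<in> K then M u v else 0) y)
      \<le> \<rho> * (L2_set x V * L2_set y V)" .
qed

lemma L2_set_mat_vec_le:
  assumes "form_bounded V M \<rho>" "0 \<le> \<rho>"
  shows "L2_set (mat_vec V M y) V \<le> \<rho> * L2_set y V"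
proof (cases "L2_set (mat_vec V M y) V = 0")
  case False
  then have pos: "0 < L2_set (mat_vec V M y) V" using L2_set_nonneg[of "mat_vec V M y" V] by linarith
  have "L2_set (mat_vec V M y) V * L2_set (mat_vec V M y) V \<le> L2_set (mat_vec V M y) V * (\<rho> * L2_set y V)"
    using form_boundedD[OF assms(1), of "mat_vec V M y" y]
    by (simp add: inner_on_self power2_eq_square mult_ac)
  with pos show ?thesis by simp
qed (use assms(2) in simp)

section \<open>Rank-one matrices with noise\<close>

text \<open>The planted direction is u. The columns of a high power of M are compared in Frobenius norm: their
  components orthogonal to u are damped by R in every step, while those along u add up to the squared
  norm of the iterated planted direction.\<close>

locale rank_one_noise =
  fixes V :: "'a set" and M R :: "'a \<Rightarrow> 'a \<Rightarrow> real" and u :: "'a \<Rightarrow> real" and \<kappa> \<rho> \<epsilon> :: real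
  assumes finite_V: "finite V"
    and symmetric: "\<And>x y. x \<in> V \<Longrightarrow> y \<in> V \<Longrightarrow> M x y = M y x"
    and rank_one_plus_noise: "\<And>x y. x \<in> V \<Longrightarrow> y \<in> V \<Longrightarrow> M x y = \<kappa> * u x * u y + R x y"
    and noise: "form_bounded V R \<rho>" "0 \<le> \<rho>" "\<rho> \<le> \<epsilon> * \<kappa>"
    and unit: "L2_set u V = 1" and nonneg: "\<And>v. v \<in> V \<Longrightarrow> 0 \<le> u v"
    and signal: "0 < \<kappa>" and small: "0 < \<epsilon>" "\<epsilon> \<le> 1 / 10"
begin

abbreviation norm_V :: "('a \<Rightarrow> real) \<Rightarrow> real" where
  "norm_V y \<equiv> L2_set y V"

abbreviation along :: "('a \<Rightarrow> real) \<Rightarrow> real" where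
  "along y \<equiv> inner_on V u y"

definition orth :: "('a \<Rightarrow> real) \<Rightarrow> 'a \<Rightarrow> real" where
  "orth y = (\<lambda>v. y v - along y * u v)"

abbreviation iterate :: "nat \<Rightarrow> 'a \<Rightarrow> real" where
  "iterate s \<equiv> (mat_vec V M ^^ s) u"

abbreviation column :: "nat \<Rightarrow> 'a \<Rightarrow> 'a \<Rightarrow> real" where
  "column s i \<equiv> (mat_vec V M ^^ s) (\<lambda>v. of_bool (v = i))"

lemma norm_power2: "(norm_V y)\<^sup>2 = (along y)\<^sup>2 + (norm_V (orth y))\<^sup>2"
  unfolding orth_def by (rule L2_set_power2_decompose[OF unit])

lemma norm_orth_le: "norm_V (orth y) \<le> norm_V y"
proof (rule power2_le_imp_le)
  show "(norm_V (orth y))\<^sup>2 \<le> (norm_V y)\<^sup>2" unfolding norm_power2[of y] by simp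
qed simp

lemma along_le_norm: "\<bar>along y\<bar> \<le> norm_V y"
  using abs_inner_on_le[of V u y] unit by simp

lemma norm_noise_le: "norm_V (mat_vec V R y) \<le> \<rho> * norm_V y"
  using noise(1,2) by (rule L2_set_mat_vec_le)

lemma mat_vec_split:
  assumes "v \<in> V"
  shows "mat_vec V M y v = \<kappa> * along y * u v + mat_vec V R y v"
proof -
  have "mat_vec V M y v = (\<Sum>w\<in>V. \<kappa> * u v * (u w * y w) + R v w * y w)"
    unfolding mat_vec_def
    using assms by (intro sum.cong refl) (simp add: rank_one_plus_noise algebra_simps)
  also have "\<dots> = \<kappa> * u v * along y + mat_vec V R y v"
    by (simp add: sum.distrib sum_distrib_left inner_on_def mat_vec_def)
  finally show ?thesis by (simp add: mult_ac)
qed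

lemma along_mat_vec: "along (mat_vec V M y) = \<kappa> * along y + along (mat_vec V R y)"
proof -
  have "along (mat_vec V M y) = (\<Sum>v\<in>V. \<kappa> * along y * (u v)\<^sup>2 + u v * mat_vec V R y v)"
    unfolding inner_on_def[of V u "mat_vec V M y"]
    by (intro sum.cong refl) (simp add: mat_vec_split power2_eq_square algebra_simps)
  also have "\<dots> = \<kappa> * along y * (norm_V u)\<^sup>2 + along (mat_vec V R y)"
    by (simp add: sum.distrib L2_set_power2 sum_distrib_left inner_on_def)
  finally show ?thesis by (simp add: unit)
qed

lemma norm_orth_mat_vec: "norm_V (orth (mat_vec V M y)) \<le> \<rho> * norm_V y"
proof -
  have "norm_V (orth (mat_vec V M y)) = norm_V (orth (mat_vec V R y))"
    by (intro L2_set_cong refl) (simp add: orth_def mat_vec_split along_mat_vec algebra_simps)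
  also have "\<dots> \<le> \<rho> * norm_V y" using norm_orth_le norm_noise_le by (rule order.trans)
  finally show ?thesis .
qed

definition in_cone :: "('a \<Rightarrow> real) \<Rightarrow> bool" where
  "in_cone y \<longleftrightarrow> 0 < along y \<and> norm_V (orth y) \<le> 2 * \<epsilon> * along y"

lemma in_cone_norm_le:
  assumes "in_cone y"
  shows "norm_V y \<le> 11/10 * along y"
proof (rule power2_le_imp_le)
  have "norm_V (orth y) \<le> 1/5 * along y"
  proof -
    have "2 * \<epsilon> * along y \<le> 1/5 * along y"
      using assms small by (intro mult_right_mono) (auto simp: in_cone_def)
    then show ?thesis using assms unfolding in_cone_def by linarith
  qed
  then have "(norm_V (orth y))\<^sup>2 \<le> (1/5 * along y)\<^sup>2" by (intro power_mono) auto
  then have "(norm_V (orth y))\<^sup>2 \<le> 1/25 * (along y)\<^sup>2" by (simp add: power_mult_distrib power_divide)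
  then have "(norm_V y)\<^sup>2 \<le> 121/100 * (along y)\<^sup>2"
    using norm_power2[of y] zero_le_power2[of "along y"] by linarith
  then show "(norm_V y)\<^sup>2 \<le> (11/10 * along y)\<^sup>2" by (simp add: power_mult_distrib power_divide)
qed (use assms in \<open>simp add: in_cone_def\<close>)

lemma in_cone_noise_le:
  assumes "in_cone y"
  shows "\<rho> * norm_V y \<le> \<epsilon> * (11/10 * (\<kappa> * along y))"
proof -
  have "\<rho> * norm_V y \<le> \<epsilon> * \<kappa> * (11/10 * along y)"
    using noise assms in_cone_norm_le by (intro mult_mono) (auto simp: in_cone_def)
  then show ?thesis by (simp add: mult_ac)
qed

lemma in_cone_along_mat_vec:
  assumes "in_cone y"
  shows "89/100 * (\<kappa> * along y) \<le> along (mat_vec V M y)"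
proof -
  have "\<epsilon> * (11/10 * (\<kappa> * along y)) \<le> 1/10 * (11/10 * (\<kappa> * along y))"
    using assms small signal by (intro mult_right_mono) (auto simp: in_cone_def)
  moreover have "\<bar>along (mat_vec V R y)\<bar> \<le> \<rho> * norm_V y"
    using along_le_norm norm_noise_le by (rule order.trans)
  ultimately show ?thesis using in_cone_noise_le[OF assms] unfolding along_mat_vec by linarith
qed

lemma in_cone_mat_vec:
  assumes "in_cone y"
  shows "in_cone (mat_vec V M y)"
proof -
  have pos: "0 < \<kappa> * along y" using assms signal by (simp add: in_cone_def)
  have "norm_V (orth (mat_vec V M y)) \<le> \<epsilon> * (11/10 * (\<kappa> * along y))"
    using norm_orth_mat_vec in_cone_noise_le[OF assms] by (rule order.trans)
  also have "\<dots> \<le> \<epsilon> * (2 * along (mat_vec V M y))"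
    using in_cone_along_mat_vec[OF assms] small pos by (intro mult_left_mono) auto
  finally show ?thesis using in_cone_along_mat_vec[OF assms] pos by (simp add: in_cone_def)
qed

lemma in_cone_norm_mat_vec_ge:
  assumes "in_cone y"
  shows "\<kappa> / 2 * norm_V y \<le> norm_V (mat_vec V M y)"
proof -
  have pos: "0 < \<kappa> * along y" using assms signal by (simp add: in_cone_def)
  have "\<kappa> / 2 * norm_V y \<le> \<kappa> / 2 * (11/10 * along y)"
    using in_cone_norm_le[OF assms] signal by (intro mult_left_mono) auto
  also have "\<dots> \<le> along (mat_vec V M y)" using in_cone_along_mat_vec[OF assms] pos by simp
  also have "\<dots> \<le> norm_V (mat_vec V M y)" using along_le_norm[of "mat_vec V M y"] by linarith
  finally show ?thesis .
qed

lemma in_cone_iterate: "in_cone (iterate s)"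
proof (induction s)
  case 0
  have "orth u = (\<lambda>v. 0)" using unit by (simp add: orth_def inner_on_self)
  then show ?case using unit by (simp add: in_cone_def inner_on_self L2_set_def small less_imp_le)
next
  case (Suc s)
  then show ?case using in_cone_mat_vec by simp
qed

lemma norm_iterate_ge: "(\<kappa> / 2) ^ s \<le> norm_V (iterate s)"
proof (induction s)
  case (Suc s)
  have "(\<kappa> / 2) ^ Suc s \<le> \<kappa> / 2 * norm_V (iterate s)" using Suc signal by (simp add: mult_left_mono)
  also have "\<dots> \<le> norm_V (iterate (Suc s))" using in_cone_norm_mat_vec_ge[OF in_cone_iterate] by simp
  finally show ?case .
qed (simp add: unit)

lemma along_column: "i \<in> V \<Longrightarrow> along (column s i) = iterate s i"
  by (subst inner_on_mat_vec_funpow_symmetric[OF symmetric])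
    (simp_all add: inner_on_def finite_V of_bool_def if_distrib cong: if_cong)

definition deviation :: "nat \<Rightarrow> real" where
  "deviation s = (\<Sum>i\<in>V. (norm_V (orth (column s i)))\<^sup>2)"

lemma deviation_0: "deviation 0 \<le> card V"
proof -
  have "deviation 0 \<le> (\<Sum>i\<in>V. 1)"
    unfolding deviation_def
  proof (rule sum_mono)
    fix i assume "i \<in> V"
    then have "(norm_V (column 0 i))\<^sup>2 = 1"
      using finite_V by (simp add: L2_set_power2 of_bool_def if_distrib[of "\<lambda>x. x\<^sup>2"] cong: if_cong)
    then show "(norm_V (orth (column 0 i)))\<^sup>2 \<le> 1"
      using norm_power2[of "column 0 i"] zero_le_power2[of "along (column 0 i)"] by linarith
  qed
  then show ?thesis by simp
qed

lemma deviation_Suc: "deviation (Suc s) \<le> \<rho>\<^sup>2 * ((norm_V (iterate s))\<^sup>2 + deviation s)"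
proof -
  have "deviation (Suc s) \<le> (\<Sum>i\<in>V. \<rho>\<^sup>2 * (norm_V (column s i))\<^sup>2)"
    unfolding deviation_def power_mult_distrib[symmetric] using norm_orth_mat_vec
    by (intro sum_mono power_mono) auto
  also have "\<dots> = \<rho>\<^sup>2 * (\<Sum>i\<in>V. (iterate s i)\<^sup>2 + (norm_V (orth (column s i)))\<^sup>2)"
    unfolding sum_distrib_left
    by (intro sum.cong refl) (simp only: norm_power2[of "column _ _"] along_column)
  also have "\<dots> = \<rho>\<^sup>2 * ((norm_V (iterate s))\<^sup>2 + deviation s)"
    by (simp add: sum.distrib deviation_def L2_set_power2)
  finally show ?thesis .
qed

lemma noise_power2_norm_iterate:
  "\<rho>\<^sup>2 * (norm_V (iterate s))\<^sup>2 \<le> 4 * \<epsilon>\<^sup>2 * (norm_V (iterate (Suc s)))\<^sup>2"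
proof -
  have "\<rho> * norm_V (iterate s) \<le> \<epsilon> * \<kappa> * norm_V (iterate s)" using noise by (intro mult_right_mono) auto
  also have "\<dots> = 2 * \<epsilon> * (\<kappa> / 2 * norm_V (iterate s))" by simp
  also have "\<dots> \<le> 2 * \<epsilon> * norm_V (iterate (Suc s))"
    using in_cone_norm_mat_vec_ge[OF in_cone_iterate] small by (intro mult_left_mono) auto
  finally have "(\<rho> * norm_V (iterate s))\<^sup>2 \<le> (2 * \<epsilon> * norm_V (iterate (Suc s)))\<^sup>2"
    using noise by (intro power_mono) auto
  then show ?thesis by (simp add: power_mult_distrib)
qed

lemma deviation_le: "deviation s \<le> 8 * \<epsilon>\<^sup>2 * (norm_V (iterate s))\<^sup>2 + card V * \<rho> ^ (2 * s)"
proof (induction s)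
  case 0
  have "0 \<le> 8 * \<epsilon>\<^sup>2" by simp
  then have "deviation 0 \<le> 8 * \<epsilon>\<^sup>2 + real (card V)" using deviation_0 by linarith
  then show ?case using unit by simp
next
  case (Suc s)
  let ?z = "(norm_V (iterate s))\<^sup>2" and ?z' = "(norm_V (iterate (Suc s)))\<^sup>2"
  have "8 * \<epsilon>\<^sup>2 \<le> 1" using power_mono[OF small(2), of 2] small(1) by (simp add: power2_eq_square)
  then have "8 * \<epsilon>\<^sup>2 * (\<rho>\<^sup>2 * ?z) \<le> 1 * (4 * \<epsilon>\<^sup>2 * ?z')"
    by (intro mult_mono[OF _ noise_power2_norm_iterate]) auto
  moreover have "deviation (Suc s) \<le> \<rho>\<^sup>2 * (?z + (8 * \<epsilon>\<^sup>2 * ?z + card V * \<rho> ^ (2 * s)))"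
    using Suc by (intro order.trans[OF deviation_Suc] mult_left_mono add_left_mono) auto
  moreover have "\<rho>\<^sup>2 * (?z + (8 * \<epsilon>\<^sup>2 * ?z + card V * \<rho> ^ (2 * s))) =
      \<rho>\<^sup>2 * ?z + 8 * \<epsilon>\<^sup>2 * (\<rho>\<^sup>2 * ?z) + card V * \<rho> ^ (2 * Suc s)"
    by (simp add: algebra_simps power2_eq_square)
  ultimately show ?case using noise_power2_norm_iterate[of s] by linarith
qed

lemma deviation_le_norm_iterate:
  assumes "card V * (2 * \<epsilon>) ^ (2 * s) \<le> \<epsilon>\<^sup>2"
  shows "deviation s \<le> 9 * \<epsilon>\<^sup>2 * (norm_V (iterate s))\<^sup>2"
proof -
  let ?z = "(norm_V (iterate s))\<^sup>2"
  have "\<rho> ^ (2 * s) \<le> (\<epsilon> * \<kappa>) ^ (2 * s)" using noise by (intro power_mono) auto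
  also have "\<dots> = (2 * \<epsilon>) ^ (2 * s) * ((\<kappa> / 2) ^ s)\<^sup>2"
    unfolding power_even_eq[of "\<kappa> / 2", symmetric] power_mult_distrib[symmetric] by simp
  also have "\<dots> \<le> (2 * \<epsilon>) ^ (2 * s) * ?z"
    using norm_iterate_ge small signal by (intro mult_left_mono power_mono) auto
  finally have "card V * \<rho> ^ (2 * s) \<le> card V * ((2 * \<epsilon>) ^ (2 * s) * ?z)" by (intro mult_left_mono) auto
  also have "\<dots> \<le> \<epsilon>\<^sup>2 * ?z" using mult_right_mono[OF assms, of ?z] by (simp add: mult.assoc)
  finally show ?thesis using deviation_le[of s] by simp
qed

lemma positive_part_iterate:
  "(norm_V (iterate s))\<^sup>2 \<le> 2 * (\<Sum>i\<in>{i \<in> V. 0 < iterate s i}. (iterate s i)\<^sup>2)"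
proof -
  define A B where "A = {i \<in> V. 0 < iterate s i}" and "B = {i \<in> V. iterate s i \<le> 0}"
  let ?z = "(norm_V (iterate s))\<^sup>2" and ?a = "along (iterate s)"
  have cone: "0 < ?a" "norm_V (orth (iterate s)) \<le> 2 * \<epsilon> * ?a"
    using in_cone_iterate[of s] by (simp_all add: in_cone_def)
  have sign_parts: "V = A \<union> B" "A \<inter> B = {}" "finite A" "finite B"
    using finite_V by (auto simp: A_def B_def)
  have "(\<Sum>i\<in>B. (iterate s i)\<^sup>2) \<le> (\<Sum>i\<in>B. (orth (iterate s) i)\<^sup>2)"
  proof (rule sum_mono)
    fix i assume i: "i \<in> B"
    have "0 \<le> ?a * u i" using cone nonneg[of i] i by (simp add: B_def)
    then have "\<bar>iterate s i\<bar> \<le> \<bar>orth (iterate s) i\<bar>" using i by (simp add: B_def orth_def)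
    then show "(iterate s i)\<^sup>2 \<le> (orth (iterate s) i)\<^sup>2" by (simp only: abs_le_square_iff)
  qed
  also have "\<dots> \<le> (norm_V (orth (iterate s)))\<^sup>2"
    unfolding L2_set_power2 using sign_parts finite_V by (intro sum_mono2) auto
  also have "\<dots> \<le> (1/2 * ?a)\<^sup>2"
  proof (rule power_mono)
    have "2 * \<epsilon> * ?a \<le> 1/2 * ?a" using cone small by (intro mult_right_mono) auto
    then show "norm_V (orth (iterate s)) \<le> 1/2 * ?a" using cone by linarith
  qed simp
  also have "\<dots> \<le> 1/2 * ?z"
    using norm_power2[of "iterate s"] by (simp add: power_mult_distrib power_divide)
  finally have "(\<Sum>i\<in>B. (iterate s i)\<^sup>2) \<le> 1/2 * ?z" .
  moreover have "?z = (\<Sum>i\<in>A. (iterate s i)\<^sup>2) + (\<Sum>i\<in>B. (iterate s i)\<^sup>2)"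
    unfolding L2_set_power2 using sign_parts by (metis sum.union_disjoint)
  ultimately show ?thesis unfolding A_def by linarith
qed

theorem column_along_planted_direction:
  assumes "card V * (2 * \<epsilon>) ^ (2 * s) \<le> \<epsilon>\<^sup>2"
  obtains i where "i \<in> V" "0 < iterate s i"
    "(norm_V (\<lambda>v. column s i v - iterate s i * u v))\<^sup>2 \<le> 20 * \<epsilon>\<^sup>2 * (iterate s i)\<^sup>2"
proof -
  let ?A = "{i \<in> V. 0 < iterate s i}" and ?z = "(norm_V (iterate s))\<^sup>2"
  have "0 < (\<kappa> / 2) ^ s" using signal by simp
  then have z: "0 < ?z" using norm_iterate_ge[of s] by simp
  have "\<exists>i\<in>?A. (norm_V (orth (column s i)))\<^sup>2 \<le> 20 * \<epsilon>\<^sup>2 * (iterate s i)\<^sup>2"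
  proof (rule ccontr)
    assume "\<not> ?thesis"
    then have "(\<Sum>i\<in>?A. 20 * \<epsilon>\<^sup>2 * (iterate s i)\<^sup>2) \<le> (\<Sum>i\<in>?A. (norm_V (orth (column s i)))\<^sup>2)"
      by (intro sum_mono) auto
    also have "\<dots> \<le> deviation s" unfolding deviation_def using finite_V by (intro sum_mono2) auto
    also have "\<dots> \<le> 9 * \<epsilon>\<^sup>2 * ?z" using assms by (rule deviation_le_norm_iterate)
    finally have "\<epsilon>\<^sup>2 * (20 * (\<Sum>i\<in>?A. (iterate s i)\<^sup>2)) \<le> \<epsilon>\<^sup>2 * (9 * ?z)"
      by (simp add: sum_distrib_left mult_ac)
    then have "20 * (\<Sum>i\<in>?A. (iterate s i)\<^sup>2) \<le> 9 * ?z" using small(1) by simp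
    then show False using z positive_part_iterate[of s] by linarith
  qed
  then obtain i where "i \<in> ?A" "(norm_V (orth (column s i)))\<^sup>2 \<le> 20 * \<epsilon>\<^sup>2 * (iterate s i)\<^sup>2" by blast
  then show thesis using that[of i] by (simp add: orth_def along_column)
qed

end

definition unit_indicator :: "'a set \<Rightarrow> 'a \<Rightarrow> real" where
  "unit_indicator K v = of_bool (v \<in> K) / sqrt (card K)"

lemma unit_indicator_mult: "unit_indicator K u * unit_indicator K v = of_bool (u \<in> K \<and> v \<in> K) / card K"
  by (auto simp: unit_indicator_def)

lemma L2_set_unit_indicator:
  assumes "finite V" "K \<subseteq> V" "K \<noteq> {}"
  shows "L2_set (unit_indicator K) V = 1"
proof -
  have "finite K" using assms finite_subset by blast
  then have "0 < card K" using assms(3) by (simp add: card_gt_0_iff)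
  have "(L2_set (unit_indicator K) V)\<^sup>2 = (\<Sum>v\<in>K. 1 / card K)"
    unfolding L2_set_power2 using assms
    by (intro sum.mono_neutral_cong_right) (auto simp: unit_indicator_def power_divide)
  also have "\<dots> = 1\<^sup>2" using \<open>0 < card K\<close> by simp
  finally show ?thesis by (rule power2_eq_imp_eq) simp_all
qed

lemma level_set_approximates:
  fixes x :: "'a \<Rightarrow> real" and a \<eta> :: real
  assumes V: "finite V" "K \<subseteq> V" "K \<noteq> {}" and a: "0 < a" and \<eta>: "4 * \<eta> < 1"
    and close: "(L2_set (\<lambda>v. x v - a * unit_indicator K v) V)\<^sup>2 \<le> \<eta> * a\<^sup>2"
  shows "\<exists>l\<in>V. card (sym_diff {v \<in> V. x l \<le> x v} K) \<le> 4 * \<eta> * card K"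
proof -
  define k \<theta> T where "k = real (card K)" and "\<theta> = a / (2 * sqrt k)" and "T = {v \<in> V. \<theta> \<le> x v}"
  have finite: "finite K" "finite T" "finite (sym_diff T K)"
    using V finite_subset by (auto simp: T_def)
  have k: "0 < k" using V(3) finite(1) by (simp add: k_def card_gt_0_iff)
  have \<theta>: "0 < \<theta>" "\<theta>\<^sup>2 = a\<^sup>2 / (4 * k)" "a * unit_indicator K v = of_bool (v \<in> K) * (2 * \<theta>)" for v
    using a k by (auto simp: \<theta>_def power_divide power_mult_distrib unit_indicator_def k_def)
  have "card (sym_diff T K) * \<theta>\<^sup>2 = (\<Sum>v\<in>sym_diff T K. \<theta>\<^sup>2)" by simp
  also have "\<dots> \<le> (\<Sum>v\<in>sym_diff T K. (x v - a * unit_indicator K v)\<^sup>2)"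
  proof (rule sum_mono)
    fix v assume "v \<in> sym_diff T K"
    then have "\<theta> \<le> \<bar>x v - a * unit_indicator K v\<bar>" using V(2) by (auto simp: \<theta>(3) T_def)
    then show "\<theta>\<^sup>2 \<le> (x v - a * unit_indicator K v)\<^sup>2"
      using \<theta>(1) abs_le_square_iff[of \<theta>] by simp
  qed
  also have "\<dots> \<le> (L2_set (\<lambda>v. x v - a * unit_indicator K v) V)\<^sup>2"
    unfolding L2_set_power2 using V by (intro sum_mono2) (auto simp: T_def)
  also have "\<dots> \<le> \<eta> * a\<^sup>2" by (rule close)
  finally have "card (sym_diff T K) * a\<^sup>2 \<le> (4 * \<eta> * k) * a\<^sup>2" using k by (simp add: \<theta>(2) field_simps)
  then have bound: "card (sym_diff T K) \<le> 4 * \<eta> * k" using a by simp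
  have "T \<noteq> {}"
  proof
    assume "T = {}"
    then have "k \<le> 4 * \<eta> * k" using bound by (simp add: k_def)
    then show False using k \<eta> by simp
  qed
  then have "Min (x ` T) \<in> x ` T" using finite by (intro Min_in) auto
  then obtain l where "l \<in> T" "x l = Min (x ` T)" by auto
  then have "l \<in> T" "\<And>v. v \<in> T \<Longrightarrow> x l \<le> x v" using finite by auto
  then have "{v \<in> V. x l \<le> x v} = T" "l \<in> V" by (auto simp: T_def)
  then show ?thesis using bound by (auto simp: k_def)
qed

section \<open>Bounding a form on integer points\<close>

definition integer_points :: "'a set \<Rightarrow> real \<Rightarrow> ('a \<Rightarrow> int) set" where
  "integer_points V X = {z \<in> extensional V. (\<Sum>v\<in>V. (real_of_int (z v))\<^sup>2) \<le> X}"

lemma int_abs_le_power2: "\<bar>i\<bar> \<le> (i::int)\<^sup>2"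
proof (cases "i = 0")
  case False
  then have "\<bar>i\<bar> * 1 \<le> \<bar>i\<bar> * \<bar>i\<bar>" by (intro mult_left_mono) auto
  then show ?thesis by (simp add: power2_eq_square)
qed simp

lemma sum_exp_neg_power2_le: "(\<Sum>i\<in>{- int r..int r}. exp (- (real_of_int i)\<^sup>2)) \<le> exp 2"
proof -
  have half: "exp (- 1) \<le> (1/2 :: real)"
    using exp_ge_add_one_self[of "1::real"] by (simp add: exp_minus divide_simps)
  have "exp (- (real_of_int i)\<^sup>2) \<le> (1/2) ^ nat \<bar>i\<bar>" for i :: int
  proof -
    have "real_of_int \<bar>i\<bar> \<le> (real_of_int i)\<^sup>2"
      using int_abs_le_power2[of i] by (metis of_int_le_iff of_int_power)
    then have "exp (- (real_of_int i)\<^sup>2) \<le> exp (real (nat \<bar>i\<bar>) * (- 1))" by simp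
    also have "\<dots> = exp (- 1) ^ nat \<bar>i\<bar>" by (rule exp_of_nat_mult)
    also have "\<dots> \<le> (1/2) ^ nat \<bar>i\<bar>" using half by (intro power_mono) auto
    finally show ?thesis .
  qed
  then have "(\<Sum>i\<in>{- int r..int r}. exp (- (real_of_int i)\<^sup>2))
      \<le> (\<Sum>i\<in>{- int r..int r}. (1/2 :: real) ^ nat \<bar>i\<bar>)"
    by (rule sum_mono)
  also have "\<dots> = 3 - 2 * (1/2) ^ r"
  proof (induction r)
    case (Suc r)
    have "{- int (Suc r)..int (Suc r)} = insert (int (Suc r)) (insert (- int (Suc r)) {- int r..int r})"
      by auto
    moreover have "nat (1 + int r) = Suc r" "nat (int r + 1) = Suc r" by auto
    ultimately show ?case using Suc by simp
  qed simp
  also have "\<dots> \<le> exp (2::real)"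
    using exp_ge_add_one_self[of "2::real"] zero_le_power[of "1/2::real" r] by linarith
  finally show ?thesis .
qed

lemma integer_points_subset_box:
  assumes "finite V"
  shows "integer_points V X \<subseteq> PiE V (\<lambda>_. {- int (nat \<lfloor>X\<rfloor>)..int (nat \<lfloor>X\<rfloor>)})"
proof
  fix z assume z: "z \<in> integer_points V X"
  have "z v \<in> {- int (nat \<lfloor>X\<rfloor>)..int (nat \<lfloor>X\<rfloor>)}" if "v \<in> V" for v
  proof -
    have "(real_of_int (z v))\<^sup>2 \<le> (\<Sum>v\<in>V. (real_of_int (z v))\<^sup>2)"
      using assms that by (intro member_le_sum) auto
    also have "\<dots> \<le> X" using z by (simp add: integer_points_def)
    finally have "(z v)\<^sup>2 \<le> \<lfloor>X\<rfloor>" by (simp add: le_floor_iff)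
    then have "\<bar>z v\<bar> \<le> int (nat \<lfloor>X\<rfloor>)" using int_abs_le_power2[of "z v"] by linarith
    then show ?thesis by auto
  qed
  then show "z \<in> PiE V (\<lambda>_. {- int (nat \<lfloor>X\<rfloor>)..int (nat \<lfloor>X\<rfloor>)})"
    using z by (auto simp: integer_points_def PiE_def)
qed

lemma finite_integer_points: "finite V \<Longrightarrow> finite (integer_points V X)"
  by (rule finite_subset[OF integer_points_subset_box]) (auto intro: finite_PiE)

lemma card_integer_points_le:
  assumes "finite V"
  shows "card (integer_points V X) \<le> exp (X + 2 * real (card V))"
proof -
  define r where "r = nat \<lfloor>X\<rfloor>"
  let ?P = "PiE V (\<lambda>_. {- int r..int r})"
  have box: "finite ?P" "integer_points V X \<subseteq> ?P"
    using assms integer_points_subset_box[OF assms] by (auto simp: r_def intro: finite_PiE)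
  have "real (card (integer_points V X)) = (\<Sum>z\<in>integer_points V X. 1)" by simp
  also have "\<dots> \<le> (\<Sum>z\<in>integer_points V X. exp (X - (\<Sum>v\<in>V. (real_of_int (z v))\<^sup>2)))"
    by (intro sum_mono) (simp add: integer_points_def)
  also have "\<dots> \<le> (\<Sum>z\<in>?P. exp (X - (\<Sum>v\<in>V. (real_of_int (z v))\<^sup>2)))"
    using box by (intro sum_mono2) auto
  also have "\<dots> = exp X * (\<Sum>z\<in>?P. \<Prod>v\<in>V. exp (- (real_of_int (z v))\<^sup>2))"
    unfolding sum_distrib_left exp_sum[OF assms, symmetric] exp_add[symmetric] by (simp add: sum_negf)
  also have "\<dots> = exp X * (\<Prod>v\<in>V. \<Sum>i\<in>{- int r..int r}. exp (- (real_of_int i)\<^sup>2))"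
    using assms by (subst prod_sum_PiE) auto
  also have "\<dots> \<le> exp X * (\<Prod>v\<in>V. exp 2)"
    by (intro mult_left_mono prod_mono conjI sum_nonneg sum_exp_neg_power2_le) auto
  also have "\<dots> = exp (X + 2 * real (card V))"
    unfolding exp_add prod_constant exp_of_nat2_mult by simp
  finally show ?thesis .
qed

lemma linear_form_le_at_integer_point:
  fixes x c :: "'a \<Rightarrow> real" and L :: real
  assumes "(L2_set x V)\<^sup>2 \<le> L" "card V \<le> L"
  shows "\<exists>z\<in>integer_points V (4 * L). inner_on V x c \<le> inner_on V (\<lambda>v. real_of_int (z v)) c"
proof -
  define z where "z = restrict (\<lambda>v. if 0 \<le> c v then \<lfloor>x v\<rfloor> + 1 else \<lfloor>x v\<rfloor>) V"
  have "(\<Sum>v\<in>V. (real_of_int (z v))\<^sup>2) \<le> (\<Sum>v\<in>V. 2 * (x v)\<^sup>2 + 2)"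
  proof (rule sum_mono)
    fix v assume "v \<in> V"
    then have "\<bar>real_of_int (z v)\<bar> \<le> \<bar>x v\<bar> + 1" by (simp add: z_def) linarith
    then have "(real_of_int (z v))\<^sup>2 \<le> (\<bar>x v\<bar> + 1)\<^sup>2" by (simp add: abs_le_square_iff[symmetric])
    also have "\<dots> \<le> 2 * (x v)\<^sup>2 + 2"
      using zero_le_power2[of "\<bar>x v\<bar> - 1"] by (simp add: power2_eq_square algebra_simps)
    finally show "(real_of_int (z v))\<^sup>2 \<le> 2 * (x v)\<^sup>2 + 2" .
  qed
  also have "\<dots> = 2 * (L2_set x V)\<^sup>2 + 2 * card V"
    by (simp add: sum.distrib L2_set_power2 sum_distrib_left)
  also have "\<dots> \<le> 4 * L" using assms by simp
  finally have "z \<in> integer_points V (4 * L)" by (simp add: integer_points_def z_def)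
  moreover have "inner_on V x c \<le> inner_on V (\<lambda>v. real_of_int (z v)) c"
    unfolding inner_on_def
  proof (rule sum_mono)
    fix v assume v: "v \<in> V"
    show "x v * c v \<le> real_of_int (z v) * c v"
    proof (cases "0 \<le> c v")
      case True
      then show ?thesis using v by (intro mult_right_mono) (auto simp: z_def intro: less_imp_le)
    next
      case False
      then show ?thesis using v by (intro mult_right_mono_neg) (auto simp: z_def)
    qed
  qed
  ultimately show ?thesis by blast
qed

lemma inner_on_commute: "inner_on V x y = inner_on V y x"
  by (simp add: inner_on_def mult.commute)

lemma form_bounded_if_bounded_on_ball:
  fixes L \<tau> :: real
  assumes V: "finite V" and L: "0 < L"
    and bound: "\<And>x y. (L2_set x V)\<^sup>2 \<le> L \<Longrightarrow> (L2_set y V)\<^sup>2 \<le> L \<Longrightarrow> inner_on V x (mat_vec V W y) \<le> \<tau>"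
  shows "form_bounded V W (\<tau> / L)"
  unfolding form_bounded_def
proof (intro allI)
  fix x y
  show "inner_on V x (mat_vec V W y) \<le> \<tau> / L * (L2_set x V * L2_set y V)"
  proof (cases "L2_set x V = 0 \<or> L2_set y V = 0")
    case True
    then have "(\<forall>v\<in>V. x v = 0) \<or> (\<forall>v\<in>V. y v = 0)" using V by (simp add: L2_set_eq_0_iff)
    then have "inner_on V x (mat_vec V W y) = 0" unfolding inner_on_mat_vec by (auto intro!: sum.neutral)
    then show ?thesis using True by auto
  next
    case False
    define a b where "a = L2_set x V" and "b = L2_set y V"
    have ab: "0 < a" "0 < b" using False by (simp_all add: a_def b_def less_le)
    let ?s = "sqrt L"
    have "L2_set (\<lambda>v. ?s / a * x v) V = ?s / a * a" "L2_set (\<lambda>v. ?s / b * y v) V = ?s / b * b"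
      unfolding a_def b_def using L by (intro L2_set_right_distrib[symmetric]; simp)+
    then have "inner_on V (\<lambda>v. ?s / a * x v) (mat_vec V W (\<lambda>v. ?s / b * y v)) \<le> \<tau>"
      using L ab by (intro bound) simp_all
    also have "inner_on V (\<lambda>v. ?s / a * x v) (mat_vec V W (\<lambda>v. ?s / b * y v))
        = (?s / a) * (?s / b) * inner_on V x (mat_vec V W y)"
      unfolding inner_on_mat_vec sum_distrib_left by (simp only: mult_ac)
    also have "(?s / a) * (?s / b) = L / (a * b)" using L by simp
    finally have "inner_on V x (mat_vec V W y) \<le> \<tau> / L * (a * b)" using ab L by (simp add: field_simps)
    then show ?thesis by (simp add: a_def b_def)
  qed
qed

text \<open>A bilinear form attains its maximum over a box of the integer lattice at a corner, so that
  rounding to the lattice replaces an epsilon-net.\<close>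

lemma form_bounded_if_bounded_on_integer_points:
  fixes L \<tau> :: real
  assumes V: "finite V" "card V \<le> L" and L: "0 < L"
    and symmetric: "\<And>u v. u \<in> V \<Longrightarrow> v \<in> V \<Longrightarrow> W u v = W v u"
    and bound: "\<And>z z'. z \<in> integer_points V (4 * L) \<Longrightarrow> z' \<in> integer_points V (4 * L) \<Longrightarrow>
       inner_on V (\<lambda>v. real_of_int (z v)) (mat_vec V W (\<lambda>v. real_of_int (z' v))) \<le> \<tau>"
  shows "form_bounded V W (\<tau> / L)"
proof (rule form_bounded_if_bounded_on_ball[OF V(1) L])
  fix x y
  assume xy: "(L2_set x V)\<^sup>2 \<le> L" "(L2_set y V)\<^sup>2 \<le> L"
  obtain z where z: "z \<in> integer_points V (4 * L)"
    "inner_on V x (mat_vec V W y) \<le> inner_on V (\<lambda>v. real_of_int (z v)) (mat_vec V W y)"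
    using linear_form_le_at_integer_point[OF xy(1) V(2)] by blast
  obtain z' where z': "z' \<in> integer_points V (4 * L)"
    "inner_on V y (mat_vec V W (\<lambda>v. of_int (z v)))
      \<le> inner_on V (\<lambda>v. real_of_int (z' v)) (mat_vec V W (\<lambda>v. of_int (z v)))"
    using linear_form_le_at_integer_point[OF xy(2) V(2)] by blast
  have "inner_on V (\<lambda>v. of_int (z v)) (mat_vec V W y) = inner_on V y (mat_vec V W (\<lambda>v. of_int (z v)))"
    using inner_on_mat_vec_symmetric[OF symmetric, where x = "\<lambda>v. of_int (z v)" and y = y]
    by (simp add: inner_on_commute)
  then show "inner_on V x (mat_vec V W y) \<le> \<tau>" using z(2) z'(2) bound[OF z'(1) z(1)] by linarith
qed

section \<open>Probability bounds for random graphs\<close>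

lemma all_pairs_eq_nsets: "all_pairs n = nsets {..<n} 2"
  by (auto simp: all_pairs_def nsets_2_eq)

lemma finite_all_pairs: "finite (all_pairs n)"
  by (simp add: all_pairs_eq_nsets finite_imp_finite_nsets)

lemma prob_gnp_le_prod:
  fixes f :: "nat set \<Rightarrow> bool \<Rightarrow> real"
  assumes p: "0 \<le> p" "p \<le> 1" and nonneg: "\<And>e b. 0 \<le> f e b" "0 \<le> c"
    and ge_1: "\<And>E. E \<in> S \<Longrightarrow> 1 \<le> c * (\<Prod>e\<in>all_pairs n. f e (e \<in> E))"
  shows "measure_pmf.prob (gnp n p) S \<le> c * (\<Prod>e\<in>all_pairs n. p * f e True + (1 - p) * f e False)"
proof -
  define \<mu> where "\<mu> = Pi_pmf (all_pairs n) False (\<lambda>_. bernoulli_pmf p)"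
  let ?edges = "\<lambda>b. {e \<in> all_pairs n. b e}"
  have "finite (set_pmf \<mu>)"
    unfolding \<mu>_def set_Pi_pmf[OF finite_all_pairs] by (rule finite_PiE_dflt[OF finite_all_pairs]) simp
  note integrable = integrable_measure_pmf_finite[OF this]
  have "measure_pmf.prob (gnp n p) S = measure_pmf.expectation \<mu> (indicator (?edges -` S))"
    by (simp add: gnp_def \<mu>_def)
  also have "\<dots> \<le> measure_pmf.expectation \<mu> (\<lambda>b. c * (\<Prod>e\<in>all_pairs n. f e (b e)))"
  proof (intro integral_mono integrable)
    fix b
    have "(\<Prod>e\<in>all_pairs n. f e (e \<in> ?edges b)) = (\<Prod>e\<in>all_pairs n. f e (b e))" by (intro prod.cong) auto
    then show "indicator (?edges -` S) b \<le> c * (\<Prod>e\<in>all_pairs n. f e (b e))"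
      using ge_1[of "?edges b"] nonneg by (simp add: indicator_def prod_nonneg)
  qed
  also have "\<dots> = c * (\<Prod>e\<in>all_pairs n. measure_pmf.expectation (bernoulli_pmf p) (f e))"
    using nonneg(1) finite_all_pairs unfolding \<mu>_def
    by (simp add: expectation_prod_Pi_pmf integrable_measure_pmf_finite)
  finally show ?thesis using p by (simp add: mult.commute)
qed

lemma bernoulli_mgf_le:
  fixes p x :: real
  assumes "0 \<le> p" "p \<le> 1"
  shows "p * exp (x * (1 - p)) + (1 - p) * exp (x * (0 - p)) \<le> exp (x\<^sup>2 / 8)"
proof -
  have nonneg: "q * exp (h * (1 - q)) + (1 - q) * exp (h * (0 - q)) \<le> exp (h\<^sup>2 / 8)"
    if h: "0 \<le> h" and q: "0 \<le> q" "q \<le> 1" for h q :: real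
  proof -
    have "0 \<le> q * (exp h - 1)" using h q by (intro mult_nonneg_nonneg) auto
    then have pos: "0 < 1 + q * (exp h - 1)" by linarith
    have "q * exp (h * (1 - q)) + (1 - q) * exp (h * (0 - q)) = exp (- h * q) * (1 + q * (exp h - 1))"
      by (simp add: algebra_simps exp_diff exp_minus field_simps exp_add[symmetric])
    also have "\<dots> = exp (- h * q + ln (1 + q * (exp h - 1)))"
      unfolding exp_add using pos by simp
    also have "\<dots> \<le> exp (h\<^sup>2 / 8)" using Hoeffdings_lemma_aux[OF h q(1)] by simp
    finally show ?thesis .
  qed
  show ?thesis
    using nonneg[of x p] nonneg[of "- x" "1 - p"] assms by (cases "0 \<le> x") (auto simp: algebra_simps)
qed

theorem prob_edges_and_deviation_le:
  assumes p: "0 \<le> p" "p \<le> 1" and F: "F \<subseteq> all_pairs n" and D: "D \<subseteq> all_pairs n - F" and l: "0 \<le> l"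
  shows "measure_pmf.prob (gnp n p) {E. F \<subseteq> E \<and> \<tau> \<le> (\<Sum>e\<in>D. a e * (of_bool (e \<in> E) - p))}
     \<le> p ^ card F * exp (l\<^sup>2 * (\<Sum>e\<in>D. (a e)\<^sup>2) / 8 - l * \<tau>)"
proof -
  define dev where "dev e b = exp (l * a e * (of_bool b - p))" for e b
  define f where "f e b = (if e \<in> F then of_bool b else 1) * (if e \<in> D then dev e b else 1)" for e b
  define mgf where "mgf e = p * dev e True + (1 - p) * dev e False" for e
  have restrict: "(\<Prod>e\<in>all_pairs n. if e \<in> H then g e else 1) = prod g H"
    if "H \<subseteq> all_pairs n" for H and g :: "nat set \<Rightarrow> real"
    using that by (simp add: finite_all_pairs Int_absorb1 flip: prod.inter_restrict)
  have D': "D \<subseteq> all_pairs n" "finite D" using D finite_subset[OF _ finite_all_pairs] by auto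
  have "measure_pmf.prob (gnp n p) {E. F \<subseteq> E \<and> \<tau> \<le> (\<Sum>e\<in>D. a e * (of_bool (e \<in> E) - p))}
     \<le> exp (- l * \<tau>) * (\<Prod>e\<in>all_pairs n. p * f e True + (1 - p) * f e False)"
  proof (rule prob_gnp_le_prod[OF p])
    fix E assume "E \<in> {E. F \<subseteq> E \<and> \<tau> \<le> (\<Sum>e\<in>D. a e * (of_bool (e \<in> E) - p))}"
    then have E: "F \<subseteq> E" "\<tau> \<le> (\<Sum>e\<in>D. a e * (of_bool (e \<in> E) - p))" by auto
    have "(\<Prod>e\<in>F. of_bool (e \<in> E)) = (1::real)" using E(1) by (intro prod.neutral) auto
    then have "(\<Prod>e\<in>all_pairs n. f e (e \<in> E)) = exp (l * (\<Sum>e\<in>D. a e * (of_bool (e \<in> E) - p)))"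
      using D' by (simp add: f_def prod.distrib restrict F dev_def mult.assoc sum_distrib_left exp_sum)
    then have "exp (- l * \<tau>) * (\<Prod>e\<in>all_pairs n. f e (e \<in> E))
        = exp (l * ((\<Sum>e\<in>D. a e * (of_bool (e \<in> E) - p)) - \<tau>))"
      by (simp add: exp_add[symmetric] algebra_simps)
    then show "1 \<le> exp (- l * \<tau>) * (\<Prod>e\<in>all_pairs n. f e (e \<in> E))" using E(2) l by simp
  qed (auto simp: f_def dev_def)
  also have "(\<Prod>e\<in>all_pairs n. p * f e True + (1 - p) * f e False) =
      (\<Prod>e\<in>all_pairs n. (if e \<in> F then p else 1) * (if e \<in> D then mgf e else 1))"
    using D by (intro prod.cong) (auto simp: f_def mgf_def)
  also have "\<dots> = p ^ card F * (\<Prod>e\<in>D. mgf e)" using F D' by (simp add: prod.distrib restrict)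
  also have "exp (- l * \<tau>) * (p ^ card F * (\<Prod>e\<in>D. mgf e))
      \<le> exp (- l * \<tau>) * (p ^ card F * (\<Prod>e\<in>D. exp ((l * a e)\<^sup>2 / 8)))"
    using p bernoulli_mgf_le[OF p] unfolding mgf_def dev_def
    by (intro mult_left_mono prod_mono) auto
  also have "(\<Prod>e\<in>D. exp ((l * a e)\<^sup>2 / 8)) = exp (l\<^sup>2 * (\<Sum>e\<in>D. (a e)\<^sup>2) / 8)"
    using D' by (simp add: exp_sum[symmetric] sum_distrib_left power_mult_distrib sum_divide_distrib)
  also have "exp (- l * \<tau>) * (p ^ card F * exp (l\<^sup>2 * (\<Sum>e\<in>D. (a e)\<^sup>2) / 8))
      = p ^ card F * exp (l\<^sup>2 * (\<Sum>e\<in>D. (a e)\<^sup>2) / 8 - l * \<tau>)"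
    unfolding mult.left_commute[of "exp _"] exp_add[symmetric] by simp
  finally show ?thesis .
qed

corollary prob_edges_le:
  "0 \<le> p \<Longrightarrow> p \<le> 1 \<Longrightarrow> F \<subseteq> all_pairs n \<Longrightarrow> measure_pmf.prob (gnp n p) {E. F \<subseteq> E} \<le> p ^ card F"
  using prob_edges_and_deviation_le[of p F n "{}" 0 0] by simp

lemma prob_Bex_le_sum:
  assumes "finite I" "\<And>i. i \<in> I \<Longrightarrow> measure_pmf.prob M {x. P i x} \<le> f i"
  shows "measure_pmf.prob M {x. \<exists>i\<in>I. P i x} \<le> sum f I"
proof -
  have "{x. \<exists>i\<in>I. P i x} = (\<Union>i\<in>I. {x. P i x})" by auto
  then have "measure_pmf.prob M {x. \<exists>i\<in>I. P i x} \<le> (\<Sum>i\<in>I. measure_pmf.prob M {x. P i x})"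
    using assms(1) by (simp add: measure_pmf.finite_measure_subadditive_finite)
  also have "\<dots> \<le> sum f I" by (intro sum_mono assms)
  finally show ?thesis .
qed

lemma prob_Bex_nsets_le:
  assumes S: "S \<subseteq> {..<n}" and c_nonneg: "0 \<le> c"
    and prob_le: "\<And>A. A \<in> nsets S m \<Longrightarrow> measure_pmf.prob M {x. P A x} \<le> c"
  shows "measure_pmf.prob M {x. \<exists>A\<in>nsets S m. P A x} \<le> real n ^ m * c"
proof -
  have finite_S: "finite S" using S finite_subset by blast
  have "card S choose m \<le> n choose m" using card_mono[OF _ S] by (intro binomial_right_mono) simp
  also have "\<dots> \<le> n ^ m" by (cases "m \<le> n") (auto intro: binomial_le_pow simp: binomial_eq_0)
  finally have "real (card (nsets S m)) \<le> real n ^ m" by (simp flip: of_nat_power)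
  then have "real (card (nsets S m)) * c \<le> real n ^ m * c" using c_nonneg by (rule mult_right_mono)
  with prob_Bex_le_sum[OF finite_imp_finite_nsets[OF finite_S] prob_le] show ?thesis by fastforce
qed

lemma prob_Bex_Pow_le:
  assumes S: "S \<subseteq> {..<n}" and x: "0 \<le> x" and c_nonneg: "0 \<le> c"
    and prob_le: "\<And>B. B \<subseteq> S \<Longrightarrow> measure_pmf.prob M {\<omega>. P B \<omega>} \<le> x ^ card B * c"
  shows "measure_pmf.prob M {\<omega>. \<exists>B\<in>Pow S. P B \<omega>} \<le> exp (real n * x) * c"
proof -
  have finite_S: "finite S" using S finite_subset by blast
  have "measure_pmf.prob M {\<omega>. \<exists>B\<in>Pow S. P B \<omega>} \<le> (\<Sum>B\<in>Pow S. x ^ card B * c)"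
    using finite_S prob_le by (intro prob_Bex_le_sum) auto
  also have "\<dots> = (x + 1) ^ card S * c"
    using prod_add[OF finite_S, of "\<lambda>_. x" "\<lambda>_. 1"] by (simp add: sum_distrib_right)
  also have "\<dots> \<le> exp (real n * x) * c"
  proof (intro mult_right_mono c_nonneg)
    have "(x + 1) ^ card S \<le> (x + 1) ^ n" using card_mono[OF _ S] x by (intro power_increasing) auto
    also have "\<dots> \<le> exp x ^ n"
      using x exp_ge_add_one_self[of x] by (intro power_mono) (simp_all add: add.commute)
    finally show "(x + 1) ^ card S \<le> exp (real n * x)" by (simp add: exp_of_nat_mult)
  qed
  finally show ?thesis .
qed

section \<open>Typical graphs\<close>

definition pairs_between :: "'a set \<Rightarrow> 'a set \<Rightarrow> 'a set set" where
  "pairs_between A B = (\<lambda>(a, b). {a, b}) ` (A \<times> B)"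

lemma inj_on_doubleton: "A \<inter> B = {} \<Longrightarrow> inj_on (\<lambda>(a, b). {a, b}) (A \<times> B)"
  by (auto simp: inj_on_def doubleton_eq_iff)

lemma card_pairs_between: "A \<inter> B = {} \<Longrightarrow> card (pairs_between A B) = card A * card B"
  by (simp add: pairs_between_def card_image inj_on_doubleton card_cartesian_product)

lemma pairs_between_subset_all_pairs:
  "A \<subseteq> {..<n} \<Longrightarrow> B \<subseteq> {..<n} - A \<Longrightarrow> pairs_between A B \<subseteq> all_pairs n"
  by (auto simp: pairs_between_def all_pairs_eq_nsets)

definition common_nbhds_small :: "nat \<Rightarrow> nat set set \<Rightarrow> nat \<Rightarrow> real \<Rightarrow> bool" where
  "common_nbhds_small n E t m \<longleftrightarrow>
     (\<forall>Q\<in>nsets {..<n} t. \<forall>B\<in>Pow ({..<n} - Q). pairs_between Q B \<subseteq> E \<longrightarrow> real (card B) < m)"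

text \<open>Weighting a set B by the probability that it lies in the common neighbourhood of Q lets the
  union bound run over all B at the cost of a factor exp(O(n p^t)) only.\<close>

lemma prob_not_common_nbhds_small_le:
  assumes p: "0 \<le> p" "p \<le> 1"
  shows "measure_pmf.prob (gnp n p) {E. \<not> common_nbhds_small n E t m}
     \<le> real n ^ t * (exp (real n * (8 * p ^ t)) * exp (- 2 * m))"
proof -
  have "measure_pmf.prob (gnp n p) {E. pairs_between Q B \<subseteq> E \<and> \<not> real (card B) < m}
      \<le> (8 * p ^ t) ^ card B * exp (- 2 * m)"
    if Q: "Q \<in> nsets {..<n} t" and B: "B \<subseteq> {..<n} - Q" for Q B
  proof (cases "real (card B) < m")
    case False
    have "exp (2 * m) \<le> exp (real (card B) * 2)" using False by simp
    also have "\<dots> = exp (1 + 1) ^ card B" by (simp add: exp_of_nat_mult)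
    also have "\<dots> \<le> 8 ^ card B"
    proof (rule power_mono)
      have "exp (1 + 1) \<le> 272/100 * (272/100 :: real)"
        unfolding exp_add using e_less_272 by (intro mult_mono) auto
      then show "exp (1 + 1) \<le> (8::real)" by simp
    qed simp
    finally have "1 \<le> 8 ^ card B * exp (- 2 * m)" by (simp add: exp_minus field_simps)
    then have "(p ^ t) ^ card B * 1 \<le> (p ^ t) ^ card B * (8 ^ card B * exp (- 2 * m))"
      using p by (intro mult_left_mono) auto
    moreover have "measure_pmf.prob (gnp n p) {E. pairs_between Q B \<subseteq> E} \<le> (p ^ t) ^ card B"
    proof -
      have "Q \<inter> B = {}" using B by auto
      then show ?thesis
        using prob_edges_le[OF p pairs_between_subset_all_pairs, of Q n B] Q B
        by (simp add: card_pairs_between nsets_def power_mult)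
    qed
    ultimately show ?thesis using False by (simp add: power_mult_distrib mult_ac)
  qed (use p in simp)
  then have "measure_pmf.prob (gnp n p)
      {E. \<exists>Q\<in>nsets {..<n} t. \<exists>B\<in>Pow ({..<n} - Q). pairs_between Q B \<subseteq> E \<and> \<not> real (card B) < m}
     \<le> real n ^ t * (exp (real n * (8 * p ^ t)) * exp (- 2 * m))"
    using p by (intro prob_Bex_nsets_le prob_Bex_Pow_le) auto
  then show ?thesis by (simp add: common_nbhds_small_def)
qed

definition no_clique :: "nat \<Rightarrow> nat set set \<Rightarrow> nat \<Rightarrow> bool" where
  "no_clique n E m \<longleftrightarrow> (\<forall>C\<in>nsets {..<n} m. \<not> nsets C 2 \<subseteq> E)"

lemma prob_not_no_clique_le:
  assumes p: "0 \<le> p" "p \<le> 1"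
  shows "measure_pmf.prob (gnp n p) {E. \<not> no_clique n E m} \<le> real n ^ m * p ^ (m choose 2)"
proof -
  have "measure_pmf.prob (gnp n p) {E. nsets C 2 \<subseteq> E} \<le> p ^ (m choose 2)" if "C \<in> nsets {..<n} m" for C
    using prob_edges_le[OF p, of "nsets C 2" n] that nsets_mono[of C "{..<n}" 2]
    by (auto simp: all_pairs_eq_nsets nsets_def[of _ m])
  then show ?thesis using p by (simp add: no_clique_def prob_Bex_nsets_le)
qed

definition sparse_between :: "nat \<Rightarrow> nat set set \<Rightarrow> nat \<Rightarrow> nat \<Rightarrow> real \<Rightarrow> bool" where
  "sparse_between n E m k \<delta> \<longleftrightarrow>
     (\<forall>D\<in>nsets {..<n} m. \<forall>K\<in>nsets ({..<n} - D) k. real (card (pairs_between D K \<inter> E)) < \<delta> * (m * k))"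

lemma prob_not_sparse_between_le:
  assumes p: "0 \<le> p" "p \<le> 1" and \<gamma>: "0 \<le> \<gamma>"
  shows "measure_pmf.prob (gnp n p) {E. \<not> sparse_between n E m k (p + \<gamma>)}
     \<le> real n ^ m * (real n ^ k * exp (- 2 * \<gamma>\<^sup>2 * (m * k)))"
proof -
  have "measure_pmf.prob (gnp n p) {E. \<not> real (card (pairs_between D K \<inter> E)) < (p + \<gamma>) * (m * k)}
      \<le> exp (- 2 * \<gamma>\<^sup>2 * (m * k))"
    if D: "D \<in> nsets {..<n} m" and K: "K \<in> nsets ({..<n} - D) k" for D K
  proof -
    let ?P = "pairs_between D K"
    have P: "?P \<subseteq> all_pairs n" using D K by (intro pairs_between_subset_all_pairs) (auto simp: nsets_def)
    have disjoint: "D \<inter> K = {}" using K by (auto simp: nsets_def)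
    then have card_P: "card ?P = m * k" using D K by (simp add: card_pairs_between nsets_def)
    have finite_P: "finite ?P" using P finite_all_pairs finite_subset by blast
    have deviation: "(\<Sum>e\<in>?P. 1 * (of_bool (e \<in> E) - p)) = card (?P \<inter> E) - p * (m * k)" for E
      using finite_P card_P by (simp add: sum_subtractf of_bool_def sum.If_cases mult.commute Int_def)
    have "{E. \<not> real (card (?P \<inter> E)) < (p + \<gamma>) * (m * k)} =
        {E. {} \<subseteq> E \<and> \<gamma> * (m * k) \<le> (\<Sum>e\<in>?P. 1 * (of_bool (e \<in> E) - p))}"
      unfolding deviation by (auto simp: algebra_simps)
    also have "measure_pmf.prob (gnp n p) \<dots>
        \<le> p ^ card ({} :: nat set set) * exp ((4 * \<gamma>)\<^sup>2 * (\<Sum>e\<in>?P. 1\<^sup>2) / 8 - 4 * \<gamma> * (\<gamma> * (m * k)))"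
      by (rule prob_edges_and_deviation_le[OF p]) (use P \<gamma> in auto)
    also have "\<dots> = exp (- 2 * \<gamma>\<^sup>2 * (m * k))" using card_P by (simp add: power2_eq_square)
    finally show ?thesis .
  qed
  then show ?thesis unfolding sparse_between_def by (simp add: prob_Bex_nsets_le)
qed

definition centred :: "nat set set \<Rightarrow> real \<Rightarrow> nat \<Rightarrow> nat \<Rightarrow> real" where
  "centred E p u v = (if u = v then 0 else of_bool ({u, v} \<in> E) - p)"

definition edge_coeff :: "'a set \<Rightarrow> ('a \<Rightarrow> real) \<Rightarrow> ('a \<Rightarrow> real) \<Rightarrow> 'a set \<Rightarrow> real" where
  "edge_coeff V x y e = (\<Sum>(u, v) | (u, v) \<in> V \<times> V \<and> {u, v} = e. x u * y v)"

lemma sum_ordered_pairs_group: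
  fixes f :: "'a \<times> 'a \<Rightarrow> real"
  assumes "finite V"
  shows "(\<Sum>e\<in>nsets V 2. \<Sum>(u, v) | (u, v) \<in> V \<times> V \<and> {u, v} = e. f (u, v))
      = (\<Sum>(u, v) | (u, v) \<in> V \<times> V \<and> u \<noteq> v. f (u, v))"
proof -
  have "(\<Sum>(u, v) | (u, v) \<in> V \<times> V \<and> u \<noteq> v. f (u, v))
      = (\<Sum>e\<in>nsets V 2. sum f {z \<in> {(u, v). (u, v) \<in> V \<times> V \<and> u \<noteq> v}. {fst z, snd z} = e})"
    using assms finite_subset[of "{(u, v). (u, v) \<in> V \<times> V \<and> u \<noteq> v}" "V \<times> V"]
    by (subst sum.group) (auto intro!: finite_imp_finite_nsets sum.cong)
  also have "\<dots> = (\<Sum>e\<in>nsets V 2. \<Sum>(u, v) | (u, v) \<in> V \<times> V \<and> {u, v} = e. f (u, v))"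
    by (intro sum.cong refl) (auto simp: nsets_def)
  finally show ?thesis ..
qed

lemma inner_on_centred:
  assumes "finite V"
  shows "inner_on V x (mat_vec V (centred E p) y)
      = (\<Sum>e\<in>nsets V 2. edge_coeff V x y e * (of_bool (e \<in> E) - p))"
proof -
  have "inner_on V x (mat_vec V (centred E p) y) = (\<Sum>(u, v)\<in>V \<times> V. centred E p u v * (x u * y v))"
    by (simp add: inner_on_mat_vec sum.cartesian_product)
  also have "\<dots> = (\<Sum>(u, v) | (u, v) \<in> V \<times> V \<and> u \<noteq> v. x u * y v * (of_bool ({u, v} \<in> E) - p))"
    using assms by (intro sum.mono_neutral_cong_right) (auto simp: centred_def)
  also have "\<dots> = (\<Sum>e\<in>nsets V 2. \<Sum>(u, v) | (u, v) \<in> V \<times> V \<and> {u, v} = e. x u * y v * (of_bool ({u, v} \<in> E) - p))"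
    using sum_ordered_pairs_group[OF assms, of "\<lambda>(u, v). x u * y v * (of_bool ({u, v} \<in> E) - p)"] by simp
  also have "\<dots> = (\<Sum>e\<in>nsets V 2. edge_coeff V x y e * (of_bool (e \<in> E) - p))"
    unfolding edge_coeff_def sum_distrib_right by (intro sum.cong refl) auto
  finally show ?thesis .
qed

lemma sum_edge_coeff_power2_le:
  assumes "finite V"
  shows "(\<Sum>e\<in>nsets V 2. (edge_coeff V x y e)\<^sup>2) \<le> 2 * ((L2_set x V)\<^sup>2 * (L2_set y V)\<^sup>2)"
proof -
  have "(edge_coeff V x y e)\<^sup>2 \<le> (\<Sum>(u, v) | (u, v) \<in> V \<times> V \<and> {u, v} = e. 2 * (x u * y v)\<^sup>2)"
    if e: "e \<in> nsets V 2" for e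
  proof -
    let ?S = "{(u, v). (u, v) \<in> V \<times> V \<and> {u, v} = e}"
    obtain u v where uv: "e = {u, v}" using e by (rule nsets2_E)
    have "?S \<subseteq> {(u, v), (v, u)}" unfolding uv doubleton_eq_iff by auto
    then have "card ?S \<le> card {(u, v), (v, u)}" by (rule card_mono[rotated]) simp
    also have "\<dots> \<le> 2" by (cases "u = v") auto
    finally have "(\<Sum>(u, v)\<in>?S. (x u * y v)\<^sup>2) * card ?S \<le> (\<Sum>(u, v)\<in>?S. (x u * y v)\<^sup>2) * 2"
      by (intro mult_left_mono sum_nonneg) auto
    moreover have "(edge_coeff V x y e)\<^sup>2 \<le> (\<Sum>(u, v)\<in>?S. (x u * y v)\<^sup>2) * card ?S"
      using sum_squared_le_sum_of_squares[of "\<lambda>(u, v). x u * y v" ?S]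
      by (simp add: edge_coeff_def split_def)
    ultimately show ?thesis by (simp add: split_def mult.commute flip: sum_distrib_left)
  qed
  then have "(\<Sum>e\<in>nsets V 2. (edge_coeff V x y e)\<^sup>2)
      \<le> (\<Sum>e\<in>nsets V 2. \<Sum>(u, v) | (u, v) \<in> V \<times> V \<and> {u, v} = e. 2 * (x u * y v)\<^sup>2)"
    by (rule sum_mono)
  also have "\<dots> = (\<Sum>(u, v) | (u, v) \<in> V \<times> V \<and> u \<noteq> v. 2 * (x u * y v)\<^sup>2)"
    using sum_ordered_pairs_group[OF assms, of "\<lambda>(u, v). 2 * (x u * y v)\<^sup>2"] by simp
  also have "\<dots> \<le> (\<Sum>(u, v)\<in>V \<times> V. 2 * (x u * y v)\<^sup>2)" using assms by (intro sum_mono2) auto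
  also have "\<dots> = 2 * ((L2_set x V)\<^sup>2 * (L2_set y V)\<^sup>2)"
    unfolding L2_set_power2 sum_product
    by (simp add: sum_distrib_left power_mult_distrib flip: sum.cartesian_product)
  finally show ?thesis .
qed

lemma prob_form_large_le:
  assumes p: "0 \<le> p" "p \<le> 1" and L: "0 < L" and Q: "Q \<subseteq> {..<n}" and V: "V \<subseteq> {..<n} - Q" "B \<subseteq> V"
    and norms: "(L2_set x V)\<^sup>2 \<le> 4 * L" "(L2_set y V)\<^sup>2 \<le> 4 * L"
  shows "measure_pmf.prob (gnp n p) {E. pairs_between Q B \<subseteq> E \<and> 16 * L * sqrt L \<le> inner_on V x (mat_vec V (centred E p) y)}
     \<le> (p ^ card Q) ^ card B * exp (- 16 * L)"
proof -
  define S where "S = (\<Sum>e\<in>nsets V 2. (edge_coeff V x y e)\<^sup>2)"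
  define l where "l = 2 / sqrt L"
  have l: "0 \<le> l" "l\<^sup>2 = 4 / L" "l * (16 * L * sqrt L) = 32 * L"
    using L by (auto simp: l_def power_divide)
  have finite_V: "finite V" using V(1) finite_subset by blast
  have "S \<le> 2 * ((L2_set x V)\<^sup>2 * (L2_set y V)\<^sup>2)"
    unfolding S_def by (rule sum_edge_coeff_power2_le[OF finite_V])
  also have "\<dots> \<le> 2 * ((4 * L) * (4 * L))" using norms L by (intro mult_left_mono mult_mono) auto
  finally have "S \<le> 32 * L\<^sup>2" by (simp add: power2_eq_square)
  then have "l\<^sup>2 * S \<le> 4 / L * (32 * L\<^sup>2)" unfolding l(2) using L by (intro mult_left_mono) auto
  then have exponent: "l\<^sup>2 * S / 8 - l * (16 * L * sqrt L) \<le> - 16 * L"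
    unfolding l(3) using L by (simp add: power2_eq_square)
  have pairs: "pairs_between Q B \<subseteq> all_pairs n" "card (pairs_between Q B) = card Q * card B"
    using Q V by (intro pairs_between_subset_all_pairs card_pairs_between; auto)+
  have "nsets V 2 \<subseteq> all_pairs n - pairs_between Q B"
    using V(1) by (auto simp: all_pairs_eq_nsets pairs_between_def nsets_def)
  then have "measure_pmf.prob (gnp n p) {E. pairs_between Q B \<subseteq> E \<and>
       16 * L * sqrt L \<le> (\<Sum>e\<in>nsets V 2. edge_coeff V x y e * (of_bool (e \<in> E) - p))}
     \<le> p ^ card (pairs_between Q B) * exp (l\<^sup>2 * S / 8 - l * (16 * L * sqrt L))"
    unfolding S_def using pairs(1) l(1) by (intro prob_edges_and_deviation_le[OF p])
  also have "\<dots> \<le> p ^ card (pairs_between Q B) * exp (- 16 * L)"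
    using exponent p by (intro mult_left_mono) auto
  finally show ?thesis by (simp add: inner_on_centred[OF finite_V] pairs(2) power_mult)
qed

lemma prob_not_form_bounded_le:
  fixes L :: real
  assumes p: "0 \<le> p" "p \<le> 1" and L: "0 < L" and Q: "Q \<subseteq> {..<n}"
    and V: "V \<subseteq> {..<n} - Q" "B \<subseteq> V" "card V \<le> L"
  shows "measure_pmf.prob (gnp n p) {E. pairs_between Q B \<subseteq> E \<and> \<not> form_bounded V (centred E p) (16 * sqrt L)}
     \<le> (p ^ card Q) ^ card B * exp (- 4 * L)"
proof -
  let ?I = "integer_points V (4 * L)"
  let ?large = "\<lambda>z z' E. pairs_between Q B \<subseteq> E \<and> 16 * L * sqrt L \<le>
    inner_on V (\<lambda>v. real_of_int (z v)) (mat_vec V (centred E p) (\<lambda>v. real_of_int (z' v)))"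
  have finite_V: "finite V" using V(1) finite_subset by blast
  have "form_bounded V (centred E p) (16 * sqrt L)"
    if "pairs_between Q B \<subseteq> E" and small: "\<not> (\<exists>z\<in>?I. \<exists>z'\<in>?I. ?large z z' E)" for E
  proof -
    have "form_bounded V (centred E p) (16 * L * sqrt L / L)"
      using that by (intro form_bounded_if_bounded_on_integer_points[OF finite_V V(3) L])
        (auto simp: centred_def insert_commute not_le dest: less_imp_le)
    then show ?thesis using L by simp
  qed
  then have "{E. pairs_between Q B \<subseteq> E \<and> \<not> form_bounded V (centred E p) (16 * sqrt L)}
      \<subseteq> {E. \<exists>z\<in>?I. \<exists>z'\<in>?I. ?large z z' E}"
    by blast
  then have "measure_pmf.prob (gnp n p) {E. pairs_between Q B \<subseteq> E \<and> \<not> form_bounded V (centred E p) (16 * sqrt L)}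
     \<le> measure_pmf.prob (gnp n p) {E. \<exists>z\<in>?I. \<exists>z'\<in>?I. ?large z z' E}"
    by (intro measure_pmf.finite_measure_mono) auto
  also have "\<dots> \<le> (\<Sum>z\<in>?I. \<Sum>z'\<in>?I. (p ^ card Q) ^ card B * exp (- 16 * L))"
    using finite_integer_points[OF finite_V]
    by (intro prob_Bex_le_sum prob_form_large_le p L Q V(1,2))
      (auto simp: integer_points_def L2_set_power2)
  also have "\<dots> = real (card ?I) * real (card ?I) * ((p ^ card Q) ^ card B * exp (- 16 * L))" by simp
  also have "\<dots> \<le> exp (6 * L) * exp (6 * L) * ((p ^ card Q) ^ card B * exp (- 16 * L))"
  proof -
    have "exp (4 * L + 2 * real (card V)) \<le> exp (6 * L)" using V(3) by simp
    then have "real (card ?I) \<le> exp (6 * L)" using card_integer_points_le[OF finite_V, of "4 * L"]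
      by linarith
    then show ?thesis using p by (intro mult_right_mono mult_mono) auto
  qed
  also have "\<dots> = (p ^ card Q) ^ card B * (exp (6 * L) * exp (6 * L) * exp (- 16 * L))" by simp
  also have "\<dots> = (p ^ card Q) ^ card B * exp (- 4 * L)" unfolding exp_add[symmetric] by simp
  finally show ?thesis .
qed

definition noise_bounded :: "nat \<Rightarrow> nat set set \<Rightarrow> real \<Rightarrow> nat \<Rightarrow> nat \<Rightarrow> real \<Rightarrow> bool" where
  "noise_bounded n E p t k \<rho> \<longleftrightarrow> (\<forall>Q\<in>nsets {..<n} t. \<forall>B\<in>Pow ({..<n} - Q). \<forall>K\<in>nsets ({..<n} - Q) k.
     pairs_between Q B \<subseteq> E \<longrightarrow> form_bounded (B \<union> K) (centred E p) \<rho>)"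

lemma prob_not_noise_bounded_le:
  assumes p: "0 \<le> p" "p \<le> 1" and L: "0 < L"
  shows "measure_pmf.prob (gnp n p) {E. common_nbhds_small n E t (L - k) \<and> \<not> noise_bounded n E p t k (16 * sqrt L)}
     \<le> real n ^ t * (exp (real n * p ^ t) * (real n ^ k * exp (- 4 * L)))"
proof -
  let ?bad = "\<lambda>Q B K E. card B \<le> L - k \<and> pairs_between Q B \<subseteq> E \<and>
    \<not> form_bounded (B \<union> K) (centred E p) (16 * sqrt L)"
  have "measure_pmf.prob (gnp n p) {E. \<exists>K\<in>nsets ({..<n} - Q) k. ?bad Q B K E}
      \<le> real n ^ k * ((p ^ t) ^ card B * exp (- 4 * L))"
    if Q: "Q \<in> nsets {..<n} t" and B: "B \<subseteq> {..<n} - Q" for Q B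
  proof (rule prob_Bex_nsets_le)
    fix K assume K: "K \<in> nsets ({..<n} - Q) k"
    show "measure_pmf.prob (gnp n p) {E. ?bad Q B K E} \<le> (p ^ t) ^ card B * exp (- 4 * L)"
    proof (cases "card B \<le> L - k")
      case True
      have "real (card (B \<union> K)) \<le> L" using card_Un_le[of B K] K True by (simp add: nsets_def)
      then show ?thesis
        using prob_not_form_bounded_le[OF p L, of Q n "B \<union> K" B] True Q B K by (auto simp: nsets_def)
    qed (use p in simp)
  qed (use p in auto)
  then have "measure_pmf.prob (gnp n p)
      {E. \<exists>Q\<in>nsets {..<n} t. \<exists>B\<in>Pow ({..<n} - Q). \<exists>K\<in>nsets ({..<n} - Q) k. ?bad Q B K E}
     \<le> real n ^ t * (exp (real n * p ^ t) * (real n ^ k * exp (- 4 * L)))"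
    using p by (intro prob_Bex_nsets_le prob_Bex_Pow_le) (auto simp: mult_ac)
  moreover have "\<exists>Q\<in>nsets {..<n} t. \<exists>B\<in>Pow ({..<n} - Q). \<exists>K\<in>nsets ({..<n} - Q) k. ?bad Q B K E"
    if small: "common_nbhds_small n E t (L - k)" and "\<not> noise_bounded n E p t k (16 * sqrt L)" for E
  proof -
    from that(2) obtain Q B K
      where QBK: "Q \<in> nsets {..<n} t" "B \<in> Pow ({..<n} - Q)" "K \<in> nsets ({..<n} - Q) k"
      "pairs_between Q B \<subseteq> E" "\<not> form_bounded (B \<union> K) (centred E p) (16 * sqrt L)"
      unfolding noise_bounded_def by blast
    with small have "card B \<le> L - k" unfolding common_nbhds_small_def by (meson less_imp_le)
    with QBK show ?thesis by (intro bexI) auto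
  qed
  then have "measure_pmf.prob (gnp n p) {E. common_nbhds_small n E t (L - k) \<and> \<not> noise_bounded n E p t k (16 * sqrt L)}
      \<le> measure_pmf.prob (gnp n p) {E. \<exists>Q\<in>nsets {..<n} t. \<exists>B\<in>Pow ({..<n} - Q). \<exists>K\<in>nsets ({..<n} - Q) k. ?bad Q B K E}"
    by (intro measure_pmf.finite_measure_mono subsetI CollectI) simp_all
  ultimately show ?thesis by linarith
qed

section \<open>Graphs with a planted clique\<close>

definition plant :: "nat \<Rightarrow> nat set set \<Rightarrow> nat set \<Rightarrow> nat set set" where
  "plant n E K = E \<union> {e \<in> all_pairs n. e \<subseteq> K}"

lemma adj_plant: "K \<subseteq> {..<n} \<Longrightarrow> adj (plant n E K) u v \<longleftrightarrow> adj E u v \<or> u \<in> K \<and> v \<in> K \<and> u \<noteq> v"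
  by (auto simp: adj_def plant_def all_pairs_eq_nsets)

lemma is_clique_plant: "K \<subseteq> {..<n} \<Longrightarrow> is_clique n (plant n E K) K"
  by (auto simp: is_clique_def plant_def all_pairs_eq_nsets)

lemma ex_is_max_clique: "\<exists>C. is_max_clique n E C"
proof -
  have "card D < Suc n" if "is_clique n E D" for D
    using that card_mono[of "{..<n}" D] by (auto simp: is_clique_def less_Suc_eq_le)
  moreover have "is_clique n E {}" by (simp add: is_clique_def)
  ultimately show ?thesis
    using ex_has_greatest_nat[of "is_clique n E" "{}" card "Suc n"] by (auto simp: is_max_clique_def)
qed

lemma common_nbrs_plant:
  assumes K: "K \<subseteq> {..<n}" "Q \<subseteq> K" and V: "V = common_nbrs n (plant n E K) Q"
  shows "V \<subseteq> {..<n} - Q" "K - Q \<subseteq> V" "pairs_between Q (V - K) \<subseteq> E"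
proof -
  show "V \<subseteq> {..<n} - Q" by (auto simp: V common_nbrs_def)
  show "K - Q \<subseteq> V" using K by (auto simp: V common_nbrs_def adj_plant)
  show "pairs_between Q (V - K) \<subseteq> E"
    by (force simp: V common_nbrs_def adj_def plant_def pairs_between_def insert_commute)
qed

lemma card_clique_Diff_planted_less:
  assumes E: "no_clique n E m" and K: "K \<subseteq> {..<n}" and C: "is_clique n (plant n E K) C"
  shows "card (C - K) < m"
proof (rule ccontr)
  assume "\<not> ?thesis"
  then obtain C' where C': "C' \<subseteq> C - K" "card C' = m" using obtain_subset_with_card_n[of m "C - K"]
    by auto
  have C_n: "C \<subseteq> {..<n}" using C by (simp add: is_clique_def)
  then have "C' \<in> nsets {..<n} m" using C' finite_subset[of C' "{..<n}"] by (auto simp: nsets_def)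
  moreover have "nsets C' 2 \<subseteq> E"
  proof
    fix e assume "e \<in> nsets C' 2"
    then obtain u v where uv: "e = {u, v}" "u \<in> C'" "v \<in> C'" "u \<noteq> v" by (auto elim: nsets2_E)
    then have "adj (plant n E K) u v" "u \<notin> K" using C' is_clique_adj[OF C] by auto
    then show "e \<in> E" using uv(1) K by (simp add: adj_plant) (simp add: adj_def)
  qed
  ultimately show False using E by (auto simp: no_clique_def)
qed

lemma card_pairs_between_Int:
  assumes "finite D" "finite K" "D \<inter> K = {}"
  shows "card (pairs_between D K \<inter> E) = (\<Sum>v\<in>D. card {x \<in> K. adj E v x})"
proof -
  let ?S = "SIGMA v:D. {x \<in> K. adj E v x}"
  have "pairs_between D K \<inter> E = (\<lambda>(v, x). {v, x}) ` ?S"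
    using assms(3) by (auto simp: pairs_between_def adj_def image_iff)
  moreover have "inj_on (\<lambda>(v, x). {v, x}) ?S"
    by (rule inj_on_subset[OF inj_on_doubleton[OF assms(3)]]) auto
  ultimately show ?thesis using assms(1,2) by (simp add: card_image)
qed

lemma card_dense_vertices_less:
  assumes E: "sparse_between n E m k \<delta>" and K: "K \<in> nsets {..<n} k" and F: "F \<subseteq> {..<n} - K"
    and dense: "\<And>v. v \<in> F \<Longrightarrow> \<delta> * k \<le> card {x \<in> K. adj E v x}"
  shows "card F < m"
proof (rule ccontr)
  assume "\<not> ?thesis"
  then obtain D where D: "D \<subseteq> F" "card D = m" using obtain_subset_with_card_n[of m F] by auto
  have finite: "finite D" "finite K" using D F K finite_subset[of D "{..<n}"] by (auto simp: nsets_def)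
  have "D \<in> nsets {..<n} m" "K \<in> nsets ({..<n} - D) k" using D F K finite by (auto simp: nsets_def)
  then have "card (pairs_between D K \<inter> E) < \<delta> * (m * k)" using E by (auto simp: sparse_between_def)
  moreover have "card (pairs_between D K \<inter> E) = (\<Sum>v\<in>D. card {x \<in> K. adj E v x})"
    using finite D F by (intro card_pairs_between_Int) auto
  moreover have "(\<Sum>v\<in>D. \<delta> * k) \<le> (\<Sum>v\<in>D. real (card {x \<in> K. adj E v x}))"
    using dense D(1) by (intro sum_mono) auto
  ultimately show False using D(2) by (simp add: mult_ac)
qed

section \<open>From an approximation of the planted clique to a maximum clique\<close>

definition approximates :: "nat \<Rightarrow> 'a set \<Rightarrow> 'a set \<Rightarrow> bool" where
  "approximates h T K \<longleftrightarrow> finite T \<and> finite K \<and> 4 * h * card (sym_diff T K) \<le> card K"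

lemma approximates_card_le:
  assumes "approximates h T K" "0 < h"
  shows "3 * card K \<le> 4 * card T" "4 * card T \<le> 5 * card K"
proof -
  have finite: "finite T" "finite K" and close: "4 * h * card (sym_diff T K) \<le> card K"
    using assms(1) by (auto simp: approximates_def)
  have "4 * card (sym_diff T K) \<le> 4 * h * card (sym_diff T K)" using assms(2) by simp
  with close have "4 * card (sym_diff T K) \<le> card K" by linarith
  moreover have "card K \<le> card (sym_diff T K \<union> T)" "card T \<le> card (sym_diff T K \<union> K)"
    using finite by (auto intro!: card_mono)
  ultimately show "3 * card K \<le> 4 * card T" "4 * card T \<le> 5 * card K"
    using card_Un_le[of "sym_diff T K" T] card_Un_le[of "sym_diff T K" K] by linarith+
qed

lemma clique_subset_nearly_complete_to:
  assumes T: "approximates h T K" and h: "0 < h"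
    and C: "is_clique n E C" "card (K - C) \<le> m" "2 * h * m \<le> card K"
  shows "C \<subseteq> nearly_complete_to n E h T"
proof
  fix v assume v: "v \<in> C"
  let ?N = "{x \<in> T. x \<noteq> v \<and> \<not> adj E v x}"
  have finite: "finite T" "finite K" and close: "4 * h * card (sym_diff T K) \<le> card K"
    using T by (auto simp: approximates_def)
  have "?N \<subseteq> sym_diff T K \<union> (K - C)" using is_clique_adj[OF C(1) v] by auto
  then have "card ?N \<le> card (sym_diff T K \<union> (K - C))" using finite by (intro card_mono) auto
  also have "\<dots> \<le> card (sym_diff T K) + m" using card_Un_le[of "sym_diff T K" "K - C"] C(2) by linarith
  finally have "4 * h * card ?N \<le> 4 * h * (card (sym_diff T K) + m)" by (intro mult_le_mono2)
  also have "\<dots> \<le> 3 * card K" using close C(3) by (simp add: distrib_left)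
  also have "\<dots> \<le> 4 * card T" by (rule approximates_card_le[OF T h])
  finally have "h * card ?N \<le> card T" by simp
  moreover have "v < n" using v C(1) by (auto simp: is_clique_def)
  ultimately show "v \<in> nearly_complete_to n E h T" by (simp add: nearly_complete_to_def)
qed

lemma card_nbrs_ge_if_nearly_complete_to:
  assumes T: "approximates h T (K - Q)" and h: "0 < h" and K: "finite K" "Q \<subseteq> K" "h * card Q \<le> card K"
    and v: "v \<in> nearly_complete_to n E h T" "v \<notin> K"
  shows "(1 - 3 / h) * card K \<le> card {x \<in> K. adj E v x}"
proof -
  let ?N = "{x \<in> T. x \<noteq> v \<and> \<not> adj E v x}" and ?A = "{x \<in> K. adj E v x}"
  have finite_T: "finite T" and close: "4 * h * card (sym_diff T (K - Q)) \<le> card (K - Q)"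
    using T by (auto simp: approximates_def)
  have "K \<subseteq> ?A \<union> Q \<union> (sym_diff T (K - Q) \<union> ?N)" using v(2) by auto
  then have "card K \<le> card (?A \<union> Q \<union> (sym_diff T (K - Q) \<union> ?N))"
    using K finite_T finite_subset[OF K(2,1)] by (intro card_mono) auto
  also have "\<dots> \<le> card ?A + card Q + (card (sym_diff T (K - Q)) + card ?N)"
    using card_Un_le[of "?A \<union> Q" "sym_diff T (K - Q) \<union> ?N"] card_Un_le[of ?A Q]
      card_Un_le[of "sym_diff T (K - Q)" ?N] by linarith
  finally have "4 * h * card K \<le> 4 * h * (card ?A + card Q + (card (sym_diff T (K - Q)) + card ?N))"
    by (intro mult_le_mono2)
  also have "\<dots> = 4 * (h * card ?A) + 4 * (h * card Q) + 4 * h * card (sym_diff T (K - Q))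
      + 4 * (h * card ?N)"
    by (simp add: distrib_left)
  also have "\<dots> \<le> 4 * (h * card ?A) + 4 * card K + card (K - Q) + 5 * card (K - Q)"
    using K(3) close v(1) approximates_card_le(2)[OF T h] by (simp add: nearly_complete_to_def)
  also have "\<dots> \<le> 4 * (h * card ?A) + 12 * card K" using card_mono[of K "K - Q"] K(1) by auto
  finally have "h * card K \<le> h * card ?A + 3 * card K" by simp
  then have "real (h * card K) \<le> real (h * card ?A + 3 * card K)" by (simp only: of_nat_le_iff)
  then show ?thesis using h by (simp add: field_simps)
qed

lemma nearly_complete_to_resolves_to_max_clique:
  fixes n k m h :: nat and E :: "nat set set" and K :: "nat set"
  defines "G \<equiv> plant n E K"
  assumes K: "K \<in> nsets {..<n} k" and Q: "Q \<subseteq> K" and T: "approximates h T (K - Q)"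
    and h: "0 < h" "h * card Q \<le> k" "2 * h * m \<le> card (K - Q)"
    and sparse: "sparse_between n E m k \<delta>" "\<delta> \<le> 1 - 3 / h" and no_clique: "no_clique n E m"
  shows "\<exists>y<2 ^ m. \<exists>C. is_max_clique n G C \<and> card C \<le> card (resolve n G y (nearly_complete_to n G h T))"
proof -
  let ?F = "nearly_complete_to n G h T"
  have K': "K \<subseteq> {..<n}" "finite K" "card K = k" using K by (auto simp: nsets_def)
  have K_clique: "is_clique n G K" unfolding G_def by (rule is_clique_plant[OF K'(1)])
  obtain C where C: "is_max_clique n G C" using ex_is_max_clique by blast
  then have C': "is_clique n G C" "k \<le> card C" using K_clique K'(3) by (auto simp: is_max_clique_def)
  have finite_C: "finite C" using C' finite_subset[of C "{..<n}"] by (auto simp: is_clique_def)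
  have F: "?F \<subseteq> {..<n}" "finite ?F" by (auto simp: nearly_complete_to_def)
  have "card (C - K) < m"
    using card_clique_Diff_planted_less[OF no_clique K'(1)] C'(1) by (simp add: G_def)
  then have "card (K - C) \<le> m" using card_le_sym_Diff[OF K'(2) finite_C] C'(2) K'(3) by linarith
  then have "card (K - Q - C) \<le> m"
    using K' card_mono[of "K - C" "K - Q - C"] by fastforce
  then have C_F: "C \<subseteq> ?F" by (rule clique_subset_nearly_complete_to[OF T h(1) C'(1) _ h(3)])
  have K_F: "K \<subseteq> ?F"
    by (rule clique_subset_nearly_complete_to[OF T h(1) K_clique, of 0]) (auto simp: card_eq_0_iff)
  have "\<delta> * k \<le> card {x \<in> K. adj E v x}" if "v \<in> ?F - K" for v
  proof -
    have "\<delta> * k \<le> (1 - 3 / h) * k" using sparse(2) by (intro mult_right_mono) auto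
    also have "\<dots> \<le> card {x \<in> K. adj G v x}"
      using card_nbrs_ge_if_nearly_complete_to[OF T h(1) K'(2) Q, of v n G] that h(2) K'(3) by simp
    finally show ?thesis using that by (simp add: G_def adj_plant[OF K'(1)])
  qed
  then have "card (?F - K) < m" using F(1) by (intro card_dense_vertices_less[OF sparse(1) K]) auto
  moreover have "card (?F - K) + k = card ?F" "card (?F - C) + card C = card ?F"
    using K' K_F C_F finite_C card_mono[OF F(2) K_F] card_mono[OF F(2) C_F]
    by (simp_all add: card_Diff_subset)
  ultimately have "card (?F - C) \<le> m" using C'(2) by linarith
  then obtain y where y: "y < 2 ^ m" "C \<subseteq> resolve n G y ?F"
    using resolve_superset[OF C'(1) C_F F(2)] by blast
  then have "card C \<le> card (resolve n G y ?F)"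
    using finite_subset[OF resolve_subset F(2)] by (intro card_mono)
  with y(1) C show ?thesis by blast
qed

section \<open>Spectral approximation of the planted clique\<close>

lemma scaled_power_column_eq:
  fixes n j :: nat
  assumes "0 < n" "finite V" "i \<in> V"
  shows "real_of_int (scaled_power_column n E V j i r v) =
    real n ^ r * (mat_vec V (\<lambda>u v. of_bool (adj E u v) - j / n) ^^ r) (\<lambda>v. of_bool (v = i)) v"
proof (induction r arbitrary: v)
  case (Suc r)
  have "real n * of_bool b - real j = real n * (of_bool b - j / n)" for b
    using assms(1) by (simp add: field_simps)
  then show ?case by (simp add: Suc mat_vec_def sum_distrib_left mult_ac)
qed simp

lemma level_set_approximates_planted:
  fixes n j :: nat and \<epsilon> \<rho> :: real
  assumes V: "V \<subseteq> {..<n}" "K \<subseteq> V" "K \<noteq> {}" and j: "j < n"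
    and noise: "form_bounded V (\<lambda>u v. of_bool (adj E u v) - j / n - (1 - j / n) * of_bool (u \<in> K \<and> v \<in> K)) \<rho>"
      "0 \<le> \<rho>" "\<rho> \<le> \<epsilon> * ((1 - j / n) * card K)"
    and \<epsilon>: "0 < \<epsilon>" "\<epsilon> \<le> 1 / 10" "n * (2 * \<epsilon>) ^ (2 * n) \<le> \<epsilon>\<^sup>2"
  shows "\<exists>i\<in>V. \<exists>l\<in>V. card (sym_diff (level_set n E V j i l) K) \<le> 80 * \<epsilon>\<^sup>2 * card K"
proof -
  define \<kappa> where "\<kappa> = (1 - j / n) * card K"
  have finite_V: "finite V" using V(1) finite_subset by blast
  then have card_K: "0 < card K" using V finite_subset by (auto simp: card_gt_0_iff)
  have \<kappa>: "0 < \<kappa>" unfolding \<kappa>_def using j card_K by (intro mult_pos_pos) auto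
  have rank_one: "\<kappa> * unit_indicator K u * unit_indicator K v
      = (1 - j / n) * of_bool (u \<in> K \<and> v \<in> K)" for u v
    using card_K by (simp add: \<kappa>_def mult.assoc unit_indicator_mult)
  have nonneg: "0 \<le> unit_indicator K v" for v by (simp add: unit_indicator_def)
  interpret rank_one_noise V "\<lambda>u v. of_bool (adj E u v) - j / n"
    "\<lambda>u v. of_bool (adj E u v) - j / n - (1 - j / n) * of_bool (u \<in> K \<and> v \<in> K)" "unit_indicator K" \<kappa> \<rho> \<epsilon>
    by unfold_locales
      (use finite_V V noise[folded \<kappa>_def] \<kappa> \<epsilon> nonneg in \<open>auto simp: rank_one adj_commute L2_set_unit_indicator\<close>)
  have "card V * (2 * \<epsilon>) ^ (2 * n) \<le> n * (2 * \<epsilon>) ^ (2 * n)"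
    using card_mono[OF _ V(1)] \<epsilon>(1) by (intro mult_right_mono) auto
  also note \<epsilon>(3)
  finally obtain i where i: "i \<in> V" "0 < iterate n i"
    "(norm_V (\<lambda>v. column n i v - iterate n i * unit_indicator K v))\<^sup>2 \<le> 20 * \<epsilon>\<^sup>2 * (iterate n i)\<^sup>2"
    by (rule column_along_planted_direction)
  have "\<epsilon>\<^sup>2 \<le> (1 / 10)\<^sup>2" using \<epsilon> by (intro power_mono) auto
  then have "4 * (20 * \<epsilon>\<^sup>2) < 1" by (simp add: power2_eq_square)
  then obtain l where l: "l \<in> V" "card (sym_diff {v \<in> V. column n i l \<le> column n i v} K)
      \<le> 4 * (20 * \<epsilon>\<^sup>2) * card K"
    using level_set_approximates[OF finite_V V(2,3) i(2) _ i(3)] by blast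
  moreover have "level_set n E V j i l = {v \<in> V. column n i l \<le> column n i v}"
  proof -
    have "scaled_power_column n E V j i n l \<le> scaled_power_column n E V j i n v \<longleftrightarrow> column n i l
        \<le> column n i v" for v
      using scaled_power_column_eq[OF _ finite_V i(1), of n E j n] j
      by (simp flip: of_int_le_iff[where 'a = real])
    then show ?thesis by (simp add: level_set_def)
  qed
  ultimately have "card (sym_diff (level_set n E V j i l) K) \<le> 80 * \<epsilon>\<^sup>2 * card K" by simp
  then show ?thesis using i(1) l(1) by blast
qed

lemma planted_noise_form_bounded:
  fixes n :: nat and p q \<rho> :: real
  assumes V: "finite V" "card V \<le> n" "K \<subseteq> {..<n}" "V \<inter> K = K'" and p: "0 \<le> p" "p \<le> 1" "\<bar>p - q\<bar> \<le> 1 / n"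
    and bounded: "form_bounded V (centred E p) \<rho>" "form_bounded K' (centred E p) \<rho>" "0 \<le> \<rho>"
  shows "form_bounded V (\<lambda>u v. of_bool (adj (plant n E K) u v) - q - (1 - q) * of_bool (u \<in> K' \<and> v \<in> K')) (2 * \<rho> + 2)"
proof -
  let ?W = "centred E p" and ?d = "\<lambda>u. if u \<in> K' then 1 else p"
  let ?restricted = "\<lambda>u v. if u \<in> K' \<and> v \<in> K' then ?W u v else 0"
  let ?shift = "\<lambda>u v. (p - q) * (1 - of_bool (u \<in> K' \<and> v \<in> K'))"
  let ?diagonal = "\<lambda>u v. if u = v then ?d u else 0"
  have "1 / n * card V \<le> 1" using V(2) by (cases "n = 0") auto
  then have "form_bounded V ?shift 1"
    using p(3) by (intro form_bounded_mono[OF form_bounded_entries[where c = "1 / n"]])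
      (auto simp: of_bool_def)
  moreover have "form_bounded V ?restricted \<rho>"
    using V bounded by (intro form_bounded_restrict) auto
  moreover have "form_bounded V ?diagonal 1" using V(1) p by (intro form_bounded_diagonal) auto
  ultimately have "form_bounded V (\<lambda>u v. ?W u v - ?restricted u v + ?shift u v - ?diagonal u v)
      (\<rho> + \<rho> + 1 + 1)"
    using bounded(1) by (intro form_bounded_add form_bounded_diff)
  moreover have "of_bool (adj (plant n E K) u v) - q - (1 - q) * of_bool (u \<in> K' \<and> v \<in> K')
      = ?W u v - ?restricted u v + ?shift u v - ?diagonal u v" if "u \<in> V" "v \<in> V" for u v
    using that V(4) by (auto simp: adj_plant[OF V(3)] centred_def) (auto simp: adj_def)
  moreover have "\<rho> + \<rho> + 1 + 1 = 2 * \<rho> + 2" by simp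
  ultimately show ?thesis by (simp only:) (rule form_bounded_cong)
qed

lemma ex_guess_approximating:
  fixes n k t j :: nat and E :: "nat set set" and K :: "nat set" and p \<epsilon> \<rho> :: real
  defines "G \<equiv> plant n E K"
  assumes K: "K \<in> nsets {..<n} k" and t: "t < k" and p: "0 \<le> p" "p \<le> 1"
    and j: "j < n" "\<bar>p - j / n\<bar> \<le> 1 / n"
    and noise: "noise_bounded n E p t (k - t) \<rho>" "0 \<le> \<rho>" "2 * \<rho> + 2 \<le> \<epsilon> * ((1 - j / n) * real (k - t))"
    and \<epsilon>: "0 < \<epsilon>" "\<epsilon> \<le> 1 / 10" "n * (2 * \<epsilon>) ^ (2 * n) \<le> \<epsilon>\<^sup>2"
  shows "\<exists>g Q. (\<forall>i<t + 3. g i < n) \<and> Q \<in> nsets K t \<and>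
    card (sym_diff (level_set n G (common_nbrs n G (g ` {..<t})) (g t) (g (t + 1)) (g (t + 2))) (K - Q)) \<le> 80 * \<epsilon>\<^sup>2 * real (k - t)"
proof -
  have K': "K \<subseteq> {..<n}" "finite K" "card K = k" using K by (auto simp: nsets_def)
  obtain Q where Q: "Q \<subseteq> K" "card Q = t" "finite Q"
    using obtain_subset_with_card_n[of t K] t K' by auto
  then have Q_nsets: "Q \<in> nsets K t" "Q \<in> nsets {..<n} t" using K' by (auto simp: nsets_def)
  have card_KQ: "card (K - Q) = k - t" using Q K' by (simp add: card_Diff_subset)
  obtain b where "bij_betw b {0..<t} Q" using ex_bij_betw_nat_finite[OF Q(3)] Q(2) by auto
  then have b: "b ` {..<t} = Q" by (simp add: bij_betw_def lessThan_atLeast0)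
  define V where "V = common_nbrs n G Q"
  note V = common_nbrs_plant[OF K'(1) Q(1) V_def[unfolded G_def]]
  have V_n: "V \<subseteq> {..<n}" "finite V" "card V \<le> n"
    using V(1) finite_subset[of V "{..<n}"] card_mono[of "{..<n}" V] by auto
  have KQ: "K - Q \<in> nsets ({..<n} - Q) (k - t)" using K' card_KQ by (auto simp: nsets_def)
  have bounded: "form_bounded (B \<union> (K - Q)) (centred E p) \<rho>"
    if "B \<subseteq> {..<n} - Q" "pairs_between Q B \<subseteq> E" for B
    using noise(1) Q_nsets(2) KQ that by (auto simp: noise_bounded_def)
  have "V - K \<union> (K - Q) = V" "V \<inter> K = K - Q" using V(1,2) by auto
  then have noise_V: "form_bounded V (\<lambda>u v. of_bool (adj G u v) - j / n - (1 - j / n) * of_bool (u \<in> K - Q \<and> v \<in> K - Q)) (2 * \<rho> + 2)"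
    unfolding G_def using bounded[of "V - K"] bounded[of "{}"] V(1,3) V_n K' p j(2) noise(2)
    by (intro planted_noise_form_bounded) (auto simp: pairs_between_def)
  have "K - Q \<noteq> {}" using card_KQ t by (intro notI) (simp only: card.empty)
  from level_set_approximates_planted[OF V_n(1) V(2) this j(1) noise_V _ _ \<epsilon>]
  obtain i l where il: "i \<in> V" "l \<in> V"
    "card (sym_diff (level_set n G V j i l) (K - Q)) \<le> 80 * \<epsilon>\<^sup>2 * card (K - Q)"
    using noise(2,3) by (auto simp: card_KQ simp del: of_nat_diff)
  define g where "g x = (if x < t then b x else if x = t then j else if x = t + 1 then i else l)" for x
  have "g ` {..<t} = Q" using b by (simp add: g_def)
  moreover have "\<forall>x<t + 3. g x < n" using b Q(1) K'(1) il(1,2) V_n(1) j(1) by (auto simp: g_def)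
  ultimately show ?thesis
    using il(3) Q_nsets(1) card_KQ by (intro exI[of _ g] exI[of _ Q]) (simp add: g_def V_def)
qed

theorem some_guess_optimal_planted:
  fixes n k t j h m :: nat and p \<epsilon> \<rho> \<delta> :: real
  assumes K: "K \<in> nsets {..<n} k" and t: "t < k" and p: "0 \<le> p" "p \<le> 1"
    and j: "j < n" "\<bar>p - j / n\<bar> \<le> 1 / n"
    and noise: "noise_bounded n E p t (k - t) \<rho>" "0 \<le> \<rho>" "2 * \<rho> + 2 \<le> \<epsilon> * ((1 - j / n) * real (k - t))"
    and \<epsilon>: "0 < \<epsilon>" "\<epsilon> \<le> 1 / 10" "n * (2 * \<epsilon>) ^ (2 * n) \<le> \<epsilon>\<^sup>2" "320 * h * \<epsilon>\<^sup>2 \<le> 1"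
    and h: "0 < h" "h * t \<le> k" "2 * h * m \<le> k - t"
    and sparse: "sparse_between n E m k \<delta>" "\<delta> \<le> 1 - 3 / h" and no_clique: "no_clique n E m"
  shows "some_guess_optimal n (plant n E K) t h (2 ^ m)"
proof -
  let ?G = "plant n E K"
  let ?T = "\<lambda>g. level_set n ?G (common_nbrs n ?G (g ` {..<t})) (g t) (g (t + 1)) (g (t + 2))"
  obtain g Q where g: "\<forall>i<t + 3. g i < n" and Q: "Q \<in> nsets K t"
    and close: "card (sym_diff (?T g) (K - Q)) \<le> 80 * \<epsilon>\<^sup>2 * real (k - t)"
    using ex_guess_approximating[OF K t p j noise \<epsilon>(1-3)] by blast
  have Q': "Q \<subseteq> K" "card Q = t" using Q by (auto simp: nsets_def)
  have card_KQ: "card (K - Q) = k - t" using Q K by (auto simp: nsets_def card_Diff_subset)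
  have "approximates h (?T g) (K - Q)"
    unfolding approximates_def
  proof (intro conjI)
    show "finite (?T g)" by (rule finite_subset[of _ "{..<n}"]) (auto simp: level_set_def common_nbrs_def)
    show "finite (K - Q)" using K by (simp add: nsets_def)
    have "real (4 * h * card (sym_diff (?T g) (K - Q))) \<le> 4 * h * (80 * \<epsilon>\<^sup>2 * real (k - t))"
      using mult_left_mono[OF close, of "4 * real h"] by simp
    also have "\<dots> = 320 * h * \<epsilon>\<^sup>2 * real (k - t)" by simp
    also have "\<dots> \<le> 1 * real (k - t)" using \<epsilon>(4) by (intro mult_right_mono) auto
    finally show "4 * h * card (sym_diff (?T g) (K - Q)) \<le> card (K - Q)"
      unfolding card_KQ by (simp only: mult_1 of_nat_le_iff)
  qed
  from nearly_complete_to_resolves_to_max_clique[OF K Q'(1) this h(1) _ _ sparse no_clique]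
  obtain y C where "y < 2 ^ m" "is_max_clique n ?G C"
    "card C \<le> card (resolve n ?G y (nearly_complete_to n ?G h (?T g)))"
    using h Q'(2) card_KQ by auto
  with g show ?thesis unfolding some_guess_optimal_def guessed_clique_def candidate_def by blast
qed

section \<open>A clique planted in the empty graph\<close>

lemma fold_delete_endpoint_nonempty: "snd yF \<noteq> {} \<Longrightarrow> snd (fold (delete_endpoint E) ps yF) \<noteq> {}"
proof (induction ps arbitrary: yF)
  case (Cons p ps)
  have "snd (delete_endpoint E p yF) \<noteq> {}"
    using Cons.prems by (auto simp: delete_endpoint_def split: prod.splits)
  then show ?case using Cons.IH[of "delete_endpoint E p yF"] by simp
qed simp

lemma some_guess_optimal_edgeless:
  assumes E: "\<And>u v. \<not> adj E u v" and n: "0 < n" and t: "0 < t"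
  shows "some_guess_optimal n E t h 1"
proof -
  let ?g = "\<lambda>_. 0 :: nat"
  have "common_nbrs n E (?g ` {..<t}) = {}" using E t by (auto simp: common_nbrs_def)
  then have "candidate n E t h ?g = {..<n}"
    by (auto simp: candidate_def level_set_def nearly_complete_to_def)
  then have "guessed_clique n E t h ?g 0 \<noteq> {}"
    unfolding guessed_clique_def resolve_def using n by (intro fold_delete_endpoint_nonempty) auto
  moreover have "finite (guessed_clique n E t h ?g 0)"
    using finite_subset[OF resolve_subset]
    by (auto simp: guessed_clique_def candidate_def nearly_complete_to_def)
  ultimately have "1 \<le> card (guessed_clique n E t h ?g 0)" by (simp add: Suc_le_eq card_gt_0_iff)
  moreover have "card D \<le> 1" if "is_clique n E D" for D
    using E is_clique_adj[OF that] finite_subset[of D "{..<n}"] that card_le_Suc0_iff_eq[of D]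
    by (auto simp: is_clique_def)
  then have "is_max_clique n E {0}" using n by (simp add: is_max_clique_def is_clique_def)
  ultimately show ?thesis
    using n by (auto simp: some_guess_optimal_def intro!: exI[of _ ?g] exI[of _ "{0}"])
qed

lemma adj_plant_empty: "K \<subseteq> {..<n} \<Longrightarrow> adj (plant n {} K) u v \<longleftrightarrow> u \<in> K \<and> v \<in> K \<and> u \<noteq> v"
  by (simp add: adj_plant) (simp add: adj_def)

lemma is_max_clique_plant_empty:
  assumes K: "K \<subseteq> {..<n}" "1 \<le> card K"
  shows "is_max_clique n (plant n {} K) K"
  unfolding is_max_clique_def
proof (intro conjI allI impI is_clique_plant[OF K(1)])
  fix D assume D: "is_clique n (plant n {} K) D"
  show "card D \<le> card K"
  proof (cases "D \<subseteq> K")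
    case True
    then show ?thesis using finite_subset[OF K(1)] by (simp add: card_mono)
  next
    case False
    then obtain v where "v \<in> D" "v \<notin> K" by blast
    then have "D \<subseteq> {v}" using is_clique_adj[OF D] by (auto simp: adj_plant_empty[OF K(1)])
    then show ?thesis using card_mono[of "{v}" D] K(2) by simp
  qed
qed

lemma nearly_complete_to_plant_empty:
  assumes K: "K \<subseteq> {..<n}" and T: "T \<subseteq> K" "T \<noteq> {}" and h: "2 \<le> h"
  shows "nearly_complete_to n (plant n {} K) h T = K"
proof -
  have "finite T" using finite_subset[OF order.trans[OF T(1) K]] by simp
  then have "0 < card T" using T(2) by (simp add: card_gt_0_iff)
  moreover have "{x \<in> T. x \<noteq> v \<and> \<not> adj (plant n {} K) v x} = (if v \<in> K then {} else T)" for v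
    using T(1) by (auto simp: adj_plant_empty[OF K])
  ultimately show ?thesis using K h by (auto simp: nearly_complete_to_def split: if_splits)
qed

lemma some_guess_optimal_plant_empty:
  assumes K: "K \<subseteq> {..<n}" and n: "0 < n" and t: "0 < t" and h: "2 \<le> h"
  shows "some_guess_optimal n (plant n {} K) t h 1"
proof (cases "card K \<le> 1")
  case True
  then have "\<not> adj (plant n {} K) u v" for u v
    using finite_subset[OF K] card_le_Suc0_iff_eq[of K] by (auto simp: adj_plant_empty[OF K])
  then show ?thesis using n t by (rule some_guess_optimal_edgeless)
next
  case False
  let ?G = "plant n {} K"
  have finite_K: "finite K" using K finite_subset by blast
  have "\<not> (\<forall>a\<in>K. \<forall>l\<in>K. a = l)" using False card_le_Suc0_iff_eq[OF finite_K] by simp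
  then obtain a l where distinct: "a \<in> K" "l \<in> K" "a \<noteq> l" by blast
  define g where "g i = (if i < t then a else if i < t + 2 then 0 else l)" for i
  have "common_nbrs n ?G (g ` {..<t}) = K - {a}"
    using K distinct t by (auto simp: common_nbrs_def g_def adj_plant_empty[OF K])
  then have "candidate n ?G t h g = nearly_complete_to n ?G h (level_set n ?G (K - {a}) 0 0 l)"
    by (simp add: candidate_def g_def)
  also have "\<dots> = K"
    using distinct by (intro nearly_complete_to_plant_empty[OF K _ _ h]) (auto simp: level_set_def)
  finally have "guessed_clique n ?G t h g y = resolve n ?G y K" for y by (simp add: guessed_clique_def)
  moreover obtain y where y: "y < 2 ^ 0" "K \<subseteq> resolve n ?G y K"
    using resolve_superset[OF is_clique_plant[OF K] order.refl finite_K, of 0] by auto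
  ultimately have "card K \<le> card (guessed_clique n ?G t h g y)"
    using finite_K by (auto intro: card_mono finite_subset[OF resolve_subset])
  moreover have "is_max_clique n ?G K" using False by (intro is_max_clique_plant_empty[OF K]) simp
  moreover have "\<forall>i<t + 3. g i < n" using distinct K n by (auto simp: g_def)
  ultimately show ?thesis using y(1) unfolding some_guess_optimal_def by auto
qed

section \<open>Choice of the constants\<close>

lemma some_guess_optimal_mono: "some_guess_optimal n E t h Y \<Longrightarrow> Y \<le> Y' \<Longrightarrow> some_guess_optimal n E t h Y'"
  unfolding some_guess_optimal_def by (meson less_le_trans)

locale edge_density =
  fixes c :: real
  assumes c_bounds: "0 < c" "c < 1"
begin

text \<open>The noise has to stay below accuracy times the signal, for then the level set misses the planted
  clique by at most a fraction 80 accuracy^2 <= 1 / (4 ratio) of it. To this end the noise scale must not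
  exceed (signal_share k)^2, which determines the number of seeds.\<close>

definition gap :: real where "gap = (1 - c) / 2"
definition ratio :: nat where "ratio = nat \<lceil>6 / (1 - c)\<rceil>"
definition accuracy :: real where "accuracy = 1 / (320 * ratio)"
definition signal_share :: real where "signal_share = accuracy * (1 - c) / 128"
definition seeds :: nat where "seeds = Suc (LEAST N. c ^ N \<le> signal_share\<^sup>2)"
definition rate :: real where "rate = 2 / gap\<^sup>2 + 4 / ln (1 / c)"
definition exponent :: nat where "exponent = nat \<lceil>rate\<rceil> + 2"
definition excess :: "nat \<Rightarrow> nat" where "excess n = nat \<lceil>rate * ln n\<rceil> + 1"
definition margin :: real where
  "margin = Min {gap\<^sup>2 / 2, signal_share\<^sup>2 / 4, 1 / (4 * ratio * rate), 1}"
definition offset :: real where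
  "offset = 1 / (16 * signal_share) + real (ratio * seeds + 2 * (4 * ratio + seeds) + 1)"

lemma gap_pos: "0 < gap"
  using c_bounds by (simp add: gap_def)

lemma ratio_ge: "6 \<le> ratio" "6 / (1 - c) \<le> ratio"
proof -
  show quotient_le: "6 / (1 - c) \<le> ratio" unfolding ratio_def by linarith
  have "6 \<le> 6 / (1 - c)" using c_bounds by (simp add: field_simps)
  with quotient_le show "6 \<le> ratio" by linarith
qed

lemma accuracy_bounds: "0 < accuracy" "accuracy \<le> 1 / 10" "320 * ratio * accuracy\<^sup>2 \<le> 1"
proof -
  show "0 < accuracy" "accuracy \<le> 1 / 10" using ratio_ge(1) by (auto simp: accuracy_def field_simps)
  moreover have "320 * ratio * accuracy\<^sup>2 = accuracy"
    using ratio_ge(1) by (simp add: accuracy_def power2_eq_square)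
  ultimately show "320 * ratio * accuracy\<^sup>2 \<le> 1" by simp
qed

lemma signal_share_pos: "0 < signal_share"
  using accuracy_bounds(1) c_bounds by (simp add: signal_share_def)

lemma seeds_bounds: "0 < seeds" "c ^ (seeds - 1) \<le> signal_share\<^sup>2"
proof -
  obtain N where "c ^ N < signal_share\<^sup>2"
    using real_arch_pow_inv[of "signal_share\<^sup>2" c] signal_share_pos c_bounds by auto
  then show "c ^ (seeds - 1) \<le> signal_share\<^sup>2"
    unfolding seeds_def by (simp add: LeastI[of "\<lambda>N. c ^ N \<le> signal_share\<^sup>2" N])
qed (simp add: seeds_def)

lemma rate_bounds: "0 < rate" "2 / gap\<^sup>2 \<le> rate" "4 / ln (1 / c) \<le> rate"
  using gap_pos c_bounds by (auto simp: rate_def add_pos_pos)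

lemma margin_bounds: "0 < margin" "margin \<le> gap\<^sup>2 / 2" "margin \<le> signal_share\<^sup>2 / 4"
  "margin \<le> 1 / (4 * ratio * rate)" "margin \<le> 1"
  using gap_pos signal_share_pos rate_bounds(1) ratio_ge(1) by (auto simp: margin_def)

lemma excess_bounds:
  assumes "1 \<le> n"
  shows "rate * ln n \<le> real (excess n) - 1" "excess n \<le> rate * ln n + 2" "0 < excess n"
proof -
  have "0 \<le> rate * ln n" using rate_bounds(1) assms by simp
  then show "rate * ln n \<le> real (excess n) - 1" "excess n \<le> rate * ln n + 2"
    unfolding excess_def by linarith+
qed (simp add: excess_def)

lemma two_power_excess_le:
  assumes "2 \<le> n"
  shows "2 ^ excess n \<le> n ^ exponent"
proof -
  have ln_bounds: "ln 2 \<le> ln (real n)" "ln 2 \<le> (1::real)" "0 \<le> ln (real n)"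
    using assms ln_2_less_1 by auto
  have "excess n * ln 2 \<le> (rate * ln n + 2) * ln 2"
    using excess_bounds(2)[of n] assms by (intro mult_right_mono) auto
  also have "\<dots> = rate * ln n * ln 2 + 2 * ln 2" by (simp add: algebra_simps)
  also have "\<dots> \<le> rate * ln n * 1 + 2 * ln n"
    using ln_bounds rate_bounds(1) by (intro add_mono mult_left_mono) auto
  also have "\<dots> = (rate + 2) * ln n" by (simp add: algebra_simps)
  also have "\<dots> \<le> exponent * ln n" using ln_bounds(3)
    unfolding exponent_def by (intro mult_right_mono) linarith+
  finally have "exp (excess n * ln 2) \<le> exp (exponent * ln n)" by simp
  then have "(2::real) ^ excess n \<le> real n ^ exponent" using assms by (simp add: exp_of_nat_mult)
  then have "real (2 ^ excess n) \<le> real (n ^ exponent)" by simp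
  then show ?thesis by (simp only: of_nat_le_iff)
qed

end

section \<open>Typical graphs have an optimal guess\<close>

locale admissible = edge_density +
  fixes n k :: nat and w :: real
  assumes n: "3 \<le> n" and w: "0 \<le> w" "w \<le> c * n" and w_le_k: "25 * w \<le> (real k)\<^sup>2"
    and ln_le_k: "offset + ln n \<le> margin * k"
    and n_large: "n * (2 * accuracy) ^ (2 * n) \<le> accuracy\<^sup>2"
begin

definition p :: real where "p = w / n"
definition j :: nat where "j = nat \<lfloor>w\<rfloor>"
definition noise_scale :: real where "noise_scale = 8 * (n * p ^ seeds) + 2 * (k * ln n)"

definition typical :: "nat set set \<Rightarrow> bool" where
  "typical E \<longleftrightarrow> noise_bounded n E p seeds (k - seeds) (16 * sqrt noise_scale) \<and>
     sparse_between n E (excess n) k (p + gap) \<and> no_clique n E (excess n)"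

lemma p_bounds: "0 \<le> p" "p \<le> c" "p \<le> 1" "n * p = w"
proof -
  show "0 \<le> p" "p \<le> c" "n * p = w" using w n by (auto simp: p_def field_simps)
  then show "p \<le> 1" using c_bounds by linarith
qed

lemma ln_n_ge_1: "1 \<le> ln n"
proof -
  have "exp 1 \<le> real n" using e_less_272 n by linarith
  then show ?thesis using n by (simp add: ln_ge_iff)
qed

lemma j_bounds: "j < n" "j / n \<le> p" "\<bar>p - j / n\<bar> \<le> 1 / n"
proof -
  have floor: "j \<le> w" "w < j + 1" using w(1) unfolding j_def by linarith+
  have "c * n < 1 * real n" using c_bounds n by (intro mult_strict_right_mono) auto
  then show "j < n" using floor(1) w(2) by linarith
  show j_le: "j / n \<le> p" using floor(1) n by (simp add: p_def divide_right_mono)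
  have "p - j / n = (w - j) / n" by (simp add: p_def diff_divide_distrib)
  also have "\<dots> \<le> 1 / n" using floor(2) by (intro divide_right_mono) auto
  finally show "\<bar>p - j / n\<bar> \<le> 1 / n" using j_le by simp
qed

lemma ln_n_le:
  fixes x :: real
  assumes "margin \<le> x"
  shows "ln n \<le> x * k"
proof -
  have "0 \<le> offset" using signal_share_pos by (simp add: offset_def)
  moreover have "margin * k \<le> x * k" using assms by (rule mult_right_mono) simp
  ultimately show ?thesis using ln_le_k by linarith
qed

lemma ln_n_le_k: "2 * ln n \<le> gap\<^sup>2 * k" "4 * ln n \<le> signal_share\<^sup>2 * k" "4 * ratio * (rate * ln n) \<le> k"
  using ln_n_le[OF margin_bounds(2)] ln_n_le[OF margin_bounds(3)] ln_n_le[OF margin_bounds(4)]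
    rate_bounds(1) ratio_ge(1)
  by (auto simp: field_simps)

lemma k_ge: "1 \<le> 16 * signal_share * k" "ratio * seeds \<le> k" "2 * (4 * ratio + seeds) + 1 \<le> k"
proof -
  have "margin * k \<le> k" using mult_right_mono[OF margin_bounds(5), of "real k"] by simp
  then have "offset \<le> k" using ln_le_k ln_n_ge_1 by linarith
  moreover have "0 \<le> 1 / (16 * signal_share)" using signal_share_pos by simp
  ultimately have "1 / (16 * signal_share) \<le> k"
    "real (ratio * seeds + 2 * (4 * ratio + seeds) + 1) \<le> real k"
    unfolding offset_def by linarith+
  then have bounds: "1 / (16 * signal_share) \<le> k" "ratio * seeds + 2 * (4 * ratio + seeds) + 1 \<le> k"
    by (simp_all only: of_nat_le_iff)
  show "1 \<le> 16 * signal_share * k" using bounds(1) signal_share_pos by (simp add: field_simps)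
  show "ratio * seeds \<le> k" "2 * (4 * ratio + seeds) + 1 \<le> k" using bounds(2) by linarith+
qed

lemma seeds_le: "seeds < k" "2 * seeds \<le> k"
  using k_ge(3) by auto

lemma ratio_excess_le: "2 * ratio * excess n \<le> k - seeds"
proof -
  have "2 * real ratio * excess n \<le> 2 * real ratio * (rate * ln n + 2)"
    using excess_bounds(2)[of n] n by (intro mult_left_mono) auto
  then have "2 * real (2 * ratio * excess n) \<le> k + 8 * ratio"
    using ln_n_le_k(3) by (simp add: distrib_left)
  then have "real (2 * ratio * excess n + seeds) \<le> real k" using k_ge(3) by simp
  then show ?thesis by (simp only: of_nat_le_iff)
qed

lemma noise_below_signal:
  "2 * (16 * sqrt noise_scale) + 2 \<le> accuracy * ((1 - j / n) * real (k - seeds))"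
proof -
  let ?s = signal_share
  have "n * p ^ seeds = (n * p) * p ^ (seeds - 1)" using seeds_bounds(1) by (cases seeds) auto
  also have "\<dots> \<le> ((real k)\<^sup>2 / 25) * ?s\<^sup>2"
  proof (intro mult_mono)
    show "n * p \<le> (real k)\<^sup>2 / 25" using w_le_k p_bounds(4) by simp
    have "p ^ (seeds - 1) \<le> c ^ (seeds - 1)" using p_bounds by (intro power_mono)
    then show "p ^ (seeds - 1) \<le> ?s\<^sup>2" using seeds_bounds(2) by linarith
  qed (use p_bounds in auto)
  finally have "8 * (n * p ^ seeds) \<le> 8 / 25 * (?s\<^sup>2 * (real k)\<^sup>2)" by simp
  moreover have "k * (4 * ln n) \<le> k * (?s\<^sup>2 * k)" using ln_n_le_k(2) by (intro mult_left_mono) auto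
  then have "2 * (k * ln n) \<le> 1 / 2 * (?s\<^sup>2 * (real k)\<^sup>2)" by (simp add: power2_eq_square mult_ac)
  moreover have "0 \<le> ?s\<^sup>2 * (real k)\<^sup>2" by simp
  ultimately have "noise_scale \<le> ?s\<^sup>2 * (real k)\<^sup>2" unfolding noise_scale_def by linarith
  then have "noise_scale \<le> (?s * k)\<^sup>2" by (simp add: power_mult_distrib)
  then have "sqrt noise_scale \<le> ?s * k" using signal_share_pos by (intro real_le_lsqrt) auto
  then have "2 * (16 * sqrt noise_scale) + 2 \<le> 64 * (?s * k)" using k_ge(1) by simp
  also have "\<dots> = accuracy * ((1 - c) * (k / 2))" by (simp add: signal_share_def)
  also have "\<dots> \<le> accuracy * ((1 - j / n) * real (k - seeds))"
    using accuracy_bounds(1) j_bounds(2) p_bounds(2) c_bounds seeds_le(2)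
    by (intro mult_left_mono mult_mono) auto
  finally show ?thesis .
qed

theorem typical_some_guess_optimal:
  assumes "typical E" "K \<in> nsets {..<n} k"
  shows "some_guess_optimal n (plant n E K) seeds ratio (n ^ exponent)"
proof -
  have "3 / ratio \<le> gap" "c = 1 - 2 * gap" using ratio_ge c_bounds by (simp_all add: gap_def field_simps)
  then have "p + gap \<le> 1 - 3 / ratio" using p_bounds(2) by linarith
  moreover have "0 \<le> noise_scale" using p_bounds(1) n by (simp add: noise_scale_def)
  ultimately have "some_guess_optimal n (plant n E K) seeds ratio (2 ^ excess n)"
    using assms(1) ratio_ge(1) unfolding typical_def
    by (intro some_guess_optimal_planted[OF assms(2) seeds_le(1) p_bounds(1,3) j_bounds(1,3) _ _ noise_below_signal
          accuracy_bounds(1,2) n_large accuracy_bounds(3) _ k_ge(2) ratio_excess_le]) auto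
  then show ?thesis using two_power_excess_le n by (auto intro: some_guess_optimal_mono)
qed

section \<open>Most graphs are typical\<close>

lemma power_n_eq_exp: "real n ^ i = exp (i * ln n)"
  using n by (simp add: exp_of_nat_mult)

lemma exp_le_inverse_n:
  assumes "x \<le> - ln n"
  shows "exp x \<le> 1 / n"
proof -
  have "exp x \<le> exp (- ln n)" using assms by simp
  also have "\<dots> = 1 / n" using n by (simp add: exp_minus inverse_eq_divide)
  finally show ?thesis .
qed

lemma k_ln_n_ge: "k \<le> k * ln n" "ln n \<le> k * ln n" "2 * (seeds * ln n) \<le> k * ln n"
proof -
  show "k \<le> k * ln n" using mult_left_mono[OF ln_n_ge_1, of "real k"] by simp
  show "ln n \<le> k * ln n" using mult_right_mono[of 1 "real k" "ln n"] ln_n_ge_1 seeds_le(1) by simp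
  have "2 * real seeds \<le> k" using seeds_le(2) by (simp flip: of_nat_mult)
  then show "2 * (seeds * ln n) \<le> k * ln n"
    using mult_right_mono[of "2 * real seeds" k "ln n"] ln_n_ge_1 by simp
qed

lemma noise_scale_pos: "0 < noise_scale"
  unfolding noise_scale_def using p_bounds(1) k_ln_n_ge(2) ln_n_ge_1 by (intro add_nonneg_pos) auto

lemma prob_not_common_nbhds_small:
  "measure_pmf.prob (gnp n p) {E. \<not> common_nbhds_small n E seeds (noise_scale - real (k - seeds))}
    \<le> 1 / n"
  (is "?prob \<le> _")
proof -
  define x y d where "x = k * ln n" and "y = n * p ^ seeds" and "d = real (k - seeds)"
  have "?prob \<le> real n ^ seeds *
      (exp (real n * (8 * p ^ seeds)) * exp (- 2 * (noise_scale - real (k - seeds))))"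
    by (rule prob_not_common_nbhds_small_le[OF p_bounds(1,3)])
  also have "\<dots> = exp (seeds * ln n + (8 * y + - 2 * (8 * y + 2 * x - d)))"
    unfolding power_n_eq_exp exp_add noise_scale_def x_def y_def d_def by (simp add: mult_ac)
  also have "\<dots> \<le> 1 / n"
  proof (rule exp_le_inverse_n)
    have "0 \<le> y" "d \<le> x" using p_bounds(1) k_ln_n_ge(1) by (simp_all add: x_def y_def d_def)
    then show "seeds * ln n + (8 * y + - 2 * (8 * y + 2 * x - d)) \<le> - ln n"
      using k_ln_n_ge(2,3)[folded x_def] ln_n_ge_1 by simp
  qed
  finally show ?thesis .
qed

lemma prob_not_noise_bounded:
  "measure_pmf.prob (gnp n p) {E. common_nbhds_small n E seeds (noise_scale - real (k - seeds)) \<and>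
     \<not> noise_bounded n E p seeds (k - seeds) (16 * sqrt noise_scale)} \<le> 1 / n"
  (is "?prob \<le> _")
proof -
  define x y d where "x = k * ln n" and "y = n * p ^ seeds" and "d = real (k - seeds) * ln n"
  have "?prob \<le> real n ^ seeds *
      (exp (real n * p ^ seeds) * (real n ^ (k - seeds) * exp (- 4 * noise_scale)))"
    by (rule prob_not_noise_bounded_le[OF p_bounds(1,3) noise_scale_pos])
  also have "\<dots> = exp (seeds * ln n + (y + (d + - 4 * (8 * y + 2 * x))))"
    unfolding power_n_eq_exp exp_add noise_scale_def x_def y_def d_def by simp
  also have "\<dots> \<le> 1 / n"
  proof (rule exp_le_inverse_n)
    have "0 \<le> y" "d \<le> x"
      using p_bounds(1) ln_n_ge_1 by (auto simp: x_def y_def d_def intro!: mult_right_mono)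
    then show "seeds * ln n + (y + (d + - 4 * (8 * y + 2 * x))) \<le> - ln n"
      using k_ln_n_ge(2,3)[folded x_def] ln_n_ge_1 by simp
  qed
  finally show ?thesis .
qed

lemma excess_ge: "2 * ln n \<le> gap\<^sup>2 * excess n" "4 * ln n \<le> (real (excess n) - 1) * ln (1 / c)"
proof -
  have "rate * ln n \<le> real (excess n) - 1" using excess_bounds(1)[of n] n by simp
  moreover have "2 / gap\<^sup>2 * ln n \<le> rate * ln n" "4 / ln (1 / c) * ln n \<le> rate * ln n"
    using rate_bounds ln_n_ge_1 by (intro mult_right_mono; simp)+
  ultimately have "2 / gap\<^sup>2 * ln n \<le> excess n" "4 / ln (1 / c) * ln n \<le> real (excess n) - 1" by linarith+
  then show "2 * ln n \<le> gap\<^sup>2 * excess n" "4 * ln n \<le> (real (excess n) - 1) * ln (1 / c)"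
    using gap_pos c_bounds by (auto simp: field_simps)
qed

lemma prob_not_sparse_between:
  "measure_pmf.prob (gnp n p) {E. \<not> sparse_between n E (excess n) k (p + gap)} \<le> 1 / n"
proof -
  let ?m = "excess n"
  have "measure_pmf.prob (gnp n p) {E. \<not> sparse_between n E ?m k (p + gap)}
      \<le> real n ^ ?m * (real n ^ k * exp (- 2 * gap\<^sup>2 * (?m * k)))"
    using gap_pos by (intro prob_not_sparse_between_le[OF p_bounds(1,3)]) simp
  also have "\<dots> = exp (?m * ln n + (k * ln n + - 2 * gap\<^sup>2 * (?m * k)))"
    unfolding power_n_eq_exp exp_add by simp
  also have "\<dots> \<le> 1 / n"
  proof (rule exp_le_inverse_n)
    have "k * (2 * ln n) \<le> k * (gap\<^sup>2 * ?m)" using excess_ge(1) by (intro mult_left_mono) auto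
    moreover have "?m * (2 * ln n) \<le> ?m * (gap\<^sup>2 * k)" using ln_n_le_k(1) by (intro mult_left_mono) auto
    ultimately have "2 * (k * ln n) \<le> gap\<^sup>2 * (?m * k)" "2 * (?m * ln n) \<le> gap\<^sup>2 * (?m * k)"
      by (simp_all add: mult_ac)
    moreover have "- 2 * gap\<^sup>2 * (?m * k) = - 2 * (gap\<^sup>2 * (?m * k))" by simp
    ultimately show "?m * ln n + (k * ln n + - 2 * gap\<^sup>2 * (?m * k)) \<le> - ln n"
      using k_ln_n_ge(2) ln_n_ge_1 by linarith
  qed
  finally show ?thesis .
qed

lemma prob_not_no_clique: "measure_pmf.prob (gnp n p) {E. \<not> no_clique n E (excess n)} \<le> 1 / n"
proof -
  let ?m = "excess n"
  have "measure_pmf.prob (gnp n p) {E. \<not> no_clique n E ?m} \<le> real n ^ ?m * p ^ (?m choose 2)"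
    by (rule prob_not_no_clique_le[OF p_bounds(1,3)])
  also have "\<dots> \<le> real n ^ ?m * c ^ (?m choose 2)" using p_bounds by (intro mult_left_mono power_mono) auto
  also have "\<dots> = exp (?m * ln n + real (?m choose 2) * ln c)"
    using c_bounds by (simp add: power_n_eq_exp exp_add exp_of_nat_mult)
  also have "\<dots> \<le> 1 / n"
  proof (rule exp_le_inverse_n)
    have m: "1 \<le> ?m" using excess_bounds(3)[of n] n by simp
    then have "real (?m choose 2) = ?m * (real ?m - 1) / 2"
      by (simp add: choose_two real_of_nat_div of_nat_diff)
    then have "real (?m choose 2) * ln c = - (?m / 2) * ((real ?m - 1) * ln (1 / c))"
      using c_bounds by (simp add: ln_div)
    also have "\<dots> \<le> - (?m / 2) * (4 * ln n)" using excess_ge(2) by (intro mult_left_mono_neg) auto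
    finally have "?m * ln n + real (?m choose 2) * ln c \<le> - (?m * ln n)" by linarith
    moreover have "1 * ln n \<le> ?m * ln n" using m ln_n_ge_1 by (intro mult_right_mono) auto
    ultimately show "?m * ln n + real (?m choose 2) * ln c \<le> - ln n" by linarith
  qed
  finally show ?thesis .
qed

theorem prob_typical_ge: "1 - 4 / n \<le> measure_pmf.prob (gnp n p) {E. typical E}"
proof -
  let ?P = "measure_pmf.prob (gnp n p)"
  let ?small = "\<lambda>E. common_nbhds_small n E seeds (noise_scale - real (k - seeds))"
  let ?noise = "\<lambda>E. noise_bounded n E p seeds (k - seeds) (16 * sqrt noise_scale)"
  let ?sparse = "\<lambda>E. sparse_between n E (excess n) k (p + gap)"
  let ?no_clique = "\<lambda>E. no_clique n E (excess n)"
  have "{E. \<not> typical E} \<subseteq> ({E. \<not> ?small E} \<union> {E. ?small E \<and> \<not> ?noise E}) \<union>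
      ({E. \<not> ?sparse E} \<union> {E. \<not> ?no_clique E})"
    by (auto simp: typical_def)
  then have "?P {E. \<not> typical E}
      \<le> ?P (({E. \<not> ?small E} \<union> {E. ?small E \<and> \<not> ?noise E}) \<union> ({E. \<not> ?sparse E} \<union> {E. \<not> ?no_clique E}))"
    by (intro measure_pmf.finite_measure_mono) auto
  also have "\<dots> \<le> (1 / n + 1 / n) + (1 / n + 1 / n)"
    by (intro order.trans[OF measure_Un_le] add_mono prob_not_common_nbhds_small prob_not_noise_bounded
        prob_not_sparse_between prob_not_no_clique) auto
  finally have "?P {E. \<not> typical E} \<le> 4 / n" by simp
  moreover have "?P {E. typical E} = 1 - ?P {E. \<not> typical E}"
    using measure_pmf.prob_neg[of "gnp n p" typical] by simp
  ultimately show ?thesis by linarith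
qed

end

section \<open>The limit\<close>

lemma AG_eq_map_plant: "AG n p S = map_pmf (\<lambda>E. plant n E (S E)) (gnp n p)"
  by (simp add: AG_def plant_def)

lemma bernoulli_pmf_0: "bernoulli_pmf 0 = return_pmf False"
  proof (rule pmf_eqI)
  show "pmf (bernoulli_pmf 0) b = pmf (return_pmf False) b" for b by (cases b) auto
qed

lemma gnp_0: "gnp n 0 = return_pmf {}"
proof -
  have "gnp n 0 = map_pmf (\<lambda>b. {e \<in> all_pairs n. b e}) (Pi_pmf (all_pairs n) False (\<lambda>_. return_pmf False))"
    by (simp add: gnp_def bernoulli_pmf_0)
  then show ?thesis by (simp add: Pi_pmf_return_pmf[OF finite_all_pairs])
qed

context edge_density
begin

lemma admissible_prob_AG_ge:
  assumes "admissible c n k w" and S: "valid_strategy n k S"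
  shows "1 - 4 / n \<le>
    measure_pmf.prob (AG n (w / n) S) {G. some_guess_optimal n G seeds ratio (n ^ exponent)}"
proof -
  interpret admissible c n k w by fact
  have "S E \<in> nsets {..<n} k" for E
    using S finite_subset[of "S E" "{..<n}"] by (auto simp: valid_strategy_def nsets_def)
  then have "{E. typical E} \<subseteq> {E. some_guess_optimal n (plant n E (S E)) seeds ratio (n ^ exponent)}"
    using typical_some_guess_optimal by blast
  then have "measure_pmf.prob (gnp n p) {E. typical E}
      \<le> measure_pmf.prob (gnp n p) {E. some_guess_optimal n (plant n E (S E)) seeds ratio (n ^ exponent)}"
    by (intro measure_pmf.finite_measure_mono) auto
  then show ?thesis using prob_typical_ge by (simp add: AG_eq_map_plant vimage_def p_def)
qed

text \<open>The growth hypothesis of the theorem divides by w n and hence does not exclude w n = 0.\<close>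

lemma prob_AG_0_eq_1:
  assumes "valid_strategy n k S" "0 < n"
  shows "measure_pmf.prob (AG n 0 S) {G. some_guess_optimal n G seeds ratio (n ^ exponent)} = 1"
proof -
  have "some_guess_optimal n (plant n {} (S {})) seeds ratio 1"
    using assms ratio_ge(1) seeds_bounds(1)
    by (intro some_guess_optimal_plant_empty) (auto simp: valid_strategy_def)
  then have "some_guess_optimal n (plant n {} (S {})) seeds ratio (n ^ exponent)"
    by (rule some_guess_optimal_mono) (use assms(2) in \<open>simp add: Suc_le_eq\<close>)
  then show ?thesis by (simp add: AG_eq_map_plant gnp_0)
qed

lemma sizes_if_w_large:
  fixes n k :: nat and w :: real
  assumes n: "0 < n" and w: "w \<le> c * n" "n powr (2/3) < w" and k: "5 / (1 - w / n) * sqrt w \<le> k"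
  shows "25 * w \<le> (real k)\<^sup>2" "n powr (1/3) \<le> k"
proof -
  have w_pos: "0 < w" using w(2) le_less_trans[OF powr_ge_zero] by blast
  have "c * n < 1 * real n" using c_bounds n by (intro mult_strict_right_mono) auto
  then have "w < n" using w(1) by linarith
  then have "1 \<le> 1 / (1 - w / n)" using w_pos n by (simp add: field_simps)
  then have "5 * sqrt w \<le> 5 / (1 - w / n) * sqrt w" using w_pos by (intro mult_right_mono) auto
  then have k_ge: "5 * sqrt w \<le> k" using k by linarith
  then have "(5 * sqrt w)\<^sup>2 \<le> (real k)\<^sup>2" using w_pos by (intro power_mono) auto
  then show "25 * w \<le> (real k)\<^sup>2" using w_pos by (simp add: power_mult_distrib)
  have "(real n powr (1/3))\<^sup>2 = real n powr (2/3)" by (simp add: power2_eq_square flip: powr_add)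
  then have "n powr (1/3) < sqrt w" using w(2) by (intro real_less_rsqrt) simp
  moreover have "0 \<le> sqrt w" using w_pos by simp
  ultimately show "n powr (1/3) \<le> k" using k_ge by linarith
qed

lemma eventually_admissible:
  fixes w :: "nat \<Rightarrow> real" and k :: "nat \<Rightarrow> nat"
  assumes w_growth: "(\<lambda>n. real n powr (2/3) / w n) \<longlonglongrightarrow> 0"
    and w_bounds: "\<And>n. 0 \<le> w n \<and> w n \<le> c * real n"
    and k_lower: "\<forall>\<^sub>F n in sequentially. real (k n) \<ge> 5 / (1 - w n / real n) * sqrt (w n)"
  shows "\<forall>\<^sub>F n in sequentially. w n = 0 \<or> admissible c n (k n) (w n)"
proof -
  have "(\<lambda>n. real n * ((2 * accuracy)\<^sup>2) ^ n) \<longlonglongrightarrow> 0"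
  proof (rule powser_times_n_limit_0)
    have "(2 * accuracy)\<^sup>2 \<le> (1 / 5)\<^sup>2" using accuracy_bounds by (intro power_mono) auto
    then show "norm ((2 * accuracy)\<^sup>2) < 1" by (simp add: power2_eq_square)
  qed
  then have n_large: "\<forall>\<^sub>F n in sequentially. real n * ((2 * accuracy)\<^sup>2) ^ n < accuracy\<^sup>2"
    using accuracy_bounds(1) by (intro order_tendstoD(2)) auto
  have ln_small: "\<forall>\<^sub>F n in sequentially. offset + ln (real n) \<le> margin * real n powr (1/3)"
    using margin_bounds(1) by real_asymp
  have w_large: "\<forall>\<^sub>F n in sequentially. real n powr (2/3) / w n < 1"
    using order_tendstoD(2)[OF w_growth, of 1] by simp
  show ?thesis
    using n_large ln_small w_large k_lower eventually_ge_at_top[of 3]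
  proof eventually_elim
    case (elim n)
    have "admissible c n (k n) (w n)" if "w n \<noteq> 0"
    proof -
      have w: "0 < w n" "w n \<le> c * n" using w_bounds[of n] that by auto
      then have "n powr (2/3) < w n" using elim(3) by (simp add: field_simps)
      note sizes = sizes_if_w_large[OF _ w(2) this elim(4)]
      have "margin * n powr (1/3) \<le> margin * k n"
        using sizes(2) margin_bounds(1) elim(5) by (intro mult_left_mono) auto
      then show ?thesis using elim w sizes(1) by unfold_locales (auto simp: power_mult)
    qed
    then show ?case by blast
  qed
qed

lemma eventually_prob_AG_ge:
  fixes w :: "nat \<Rightarrow> real" and k :: "nat \<Rightarrow> nat"
  assumes "(\<lambda>n. real n powr (2/3) / w n) \<longlonglongrightarrow> 0" "\<And>n. 0 \<le> w n \<and> w n \<le> c * real n"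
    and "\<forall>\<^sub>F n in sequentially. real (k n) \<ge> 5 / (1 - w n / real n) * sqrt (w n)"
    and S: "\<And>n. valid_strategy n (k n) (S n)"
  shows "\<forall>\<^sub>F n in sequentially. 1 - 4 / real n \<le>
    measure_pmf.prob (AG n (w n / n) (S n)) {G. some_guess_optimal n G seeds ratio (n ^ exponent)}"
  using eventually_admissible[OF assms(1-3)] eventually_gt_at_top[of 0]
proof eventually_elim
  case (elim n)
  then show ?case
    using admissible_prob_AG_ge[of n "k n" "w n" "S n"] prob_AG_0_eq_1[of n "k n" "S n"] S by auto
qed

end

theorem theoremB2:
  fixes c :: real and w :: "nat \<Rightarrow> real" and k :: "nat \<Rightarrow> nat"
  assumes c: "0 < c" "c < 1"
    and w_growth: "(\<lambda>n. real n powr (2/3) / w n) \<longlonglongrightarrow> 0"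
    and w_bounds: "\<And>n. 0 \<le> w n \<and> w n \<le> c * real n"
    and k_le_n: "\<And>n. k n \<le> n"
    and k_lower: "\<forall>\<^sub>F n in sequentially.
                    real (k n) \<ge> 5 / (1 - w n / real n) * sqrt (w n)"
  shows "\<exists>(P :: instr list) (C :: nat) (d :: nat).
           (\<forall>n E. E \<subseteq> all_pairs n \<longrightarrow> ram_halts_within P (C * (n + 1) ^ d) n E) \<and>
           (\<forall>S :: nat \<Rightarrow> nat set set \<Rightarrow> nat set.
              (\<forall>n. valid_strategy n (k n) (S n)) \<longrightarrow>
              (\<lambda>n. measure_pmf.prob (AG n (w n / real n) (S n))
                     {G. is_max_clique n G (ram_output P (C * (n + 1) ^ d) n G)})
                \<longlonglongrightarrow> 1)"
proof -
  interpret edge_density c using c by unfold_locales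
  let ?optimal = "\<lambda>n G. some_guess_optimal n G seeds ratio (n ^ exponent)"
  obtain P C d N where halts: "\<And>n E. ram_halts_within P (C * (n + 1) ^ d) n E"
    and finds: "\<And>n E. N \<le> n \<Longrightarrow> ?optimal n E \<Longrightarrow> is_max_clique n E (ram_output P (C * (n + 1) ^ d) n E)"
    using ram_finds_max_clique_if_some_guess_optimal[of seeds ratio exponent] by blast
  let ?found = "\<lambda>S n. measure_pmf.prob (AG n (w n / real n) (S n))
      {G. is_max_clique n G (ram_output P (C * (n + 1) ^ d) n G)}"
  have "?found S \<longlonglongrightarrow> 1" if S: "\<forall>n. valid_strategy n (k n) (S n)" for S
  proof (rule tendsto_sandwich)
    have "\<forall>\<^sub>F n in sequentially. 1 - 4 / n \<le> measure_pmf.prob (AG n (w n / n) (S n)) {G. ?optimal n G}"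
      using eventually_prob_AG_ge[OF w_growth w_bounds k_lower] S by blast
    then show "\<forall>\<^sub>F n in sequentially. 1 - 4 / real n \<le> ?found S n"
      using eventually_ge_at_top[of N]
    proof eventually_elim
      case (elim n)
      have "measure_pmf.prob (AG n (w n / n) (S n)) {G. ?optimal n G} \<le> ?found S n"
        using finds[OF elim(2)] by (intro measure_pmf.finite_measure_mono) auto
      with elim(1) show ?case by linarith
    qed
    show "(\<lambda>n. 1 - 4 / real n) \<longlonglongrightarrow> 1" by real_asymp
  qed auto
  with halts show ?thesis by blast
qed

end
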